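(* Let $\mathbf{k}$ be a field of characteristic $0$ and $B$ a $\mathbb{Z}$-graded normal affine $\mathbf{k}$-domain. (a) $M(B)$ is a finite primitive subset of the set of divisors of $\bar e(B)$. (b) If $e(B)=0$ then $M(B)$ is either $\emptyset$ or $\{1\}$. (c) If $e(B) \neq 0$ and $\bar e(B)=0$ then $M(B) = \{1\}$.
   Context: Rings are commutative, associative and unital; "domain" means integral domain; normal means integrally closed in the field of fractions; an affine $\mathbf{k}$-domain is a domain that is a finitely generated $\mathbf{k}$-algebra. $\mathbb{N}$ contains $0$. Let $B=\bigoplus_{i\in\mathbb{Z}}B_i$ be a $\mathbb{Z}$-graded domain. For $d\ge1$, $B^{(d)}=\bigoplus_{i\in d\mathbb{Z}}B_i$. Define $e(B)=\gcd\{n\in\mathbb{Z}:B_n\neq0\}\in\mathbb{N}$. Let $Z$ be the set of height $1$ homogeneous prime ideals of $B$; define $\bar e(B)=\mathrm{lcm}\{e(B/\mathfrak{p}):\mathfrak{p}\in Z\}$ if $Z\neq\emptyset$, and $\bar e(B)=e(B)$ if $Z=\emptyset$. Here $\gcd(S)$ is the nonnegative generator of the ideal of $\mathbb{Z}$ generated by $S$, and for nonempty $S\subseteq\mathbb{Z}$, $\mathrm{lcm}(S)$ is the nonnegative generator of $\bigcap_{a\in S}a\mathbb{Z}$ (so $e(B)$ and $\bar e(B)$ may be $0$). A derivation $D:R\to R$ is locally nilpotent if for each $b\in R$ there is $n>0$ with $D^n(b)=0$. A ring is rigid if its only locally nilpotent derivation is $0$. $\mathrm{NR}(B)=\{d\in\mathbb{N}\setminus\{0\}:B^{(d)}\text{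 is non-rigid}\}$, and $M(B)$ is the set of maximal elements of the poset $(\mathrm{NR}(B),\preceq)$, where $d_1\preceq d_2\Leftrightarrow d_2\mid d_1$. A primitive set is a subset $Y$ of $\mathbb{N}\setminus\{0\}$ such that $y,y'\in Y$ and $y\mid y'$ imply $y=y'$. *)

theory Defs
  imports
    "HOL-Algebra.Module"
    "HOL-Algebra.QuotRing"
    "HOL-Algebra.Generated_Rings"
    "HOL-Algebra.Polynomials"
    "HOL-Library.Extended_Nat"
begin

section \<open>Fields of characteristic zero and affine domains\<close>

definition char_zero :: "('a, 'm) ring_scheme \<Rightarrow> bool" where
  "char_zero K \<longleftrightarrow> (\<forall>n::nat. n > 0 \<longrightarrow> [n] \<cdot>\<^bsub>K\<^esub> \<one>\<^bsub>K\<^esub> \<noteq> \<zero>\<^bsub>K\<^esub>)"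

text \<open>A subset is a subalgebra iff it is a subring containing the image of \<open>K\<close> under the
  structure map \<open>c \<mapsto> c \<odot> \<one>\<close>; so \<open>K[S]\<close> is generated, as a ring, by that image and \<open>S\<close>.\<close>

definition finitely_generated_algebra ::
    "('a, 'm) ring_scheme \<Rightarrow> ('a, 'b, 'n) module_scheme \<Rightarrow> bool" where
  "finitely_generated_algebra K B \<longleftrightarrow> algebra K B \<and>
     (\<exists>S. finite S \<and> S \<subseteq> carrier B \<and>
        generate_ring B ((\<lambda>c. c \<odot>\<^bsub>B\<^esub> \<one>\<^bsub>B\<^esub>) ` carrier K \<union> S) = carrier B)"

definition affine_domain ::
    "('a, 'm) ring_scheme \<Rightarrow> ('a, 'b, 'n) module_scheme \<Rightarrow> bool" where
  "affine_domain K B \<longleftrightarrow> domain B \<and> finitely_generated_algebra K B"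

section \<open>Field of fractions and normality\<close>

text \<open>The fraction \<open>a / b\<close> is the class of \<open>(a, b)\<close> under
  \<open>(a, b) \<sim> (c, d) \<longleftrightarrow> a \<otimes> d = c \<otimes> b\<close>.\<close>

definition fraction :: "('a, 'm) ring_scheme \<Rightarrow> 'a \<Rightarrow> 'a \<Rightarrow> ('a \<times> 'a) set" where
  "fraction R a b = {(c, d). c \<in> carrier R \<and> d \<in> carrier R - {\<zero>\<^bsub>R\<^esub>} \<and> a \<otimes>\<^bsub>R\<^esub> d = c \<otimes>\<^bsub>R\<^esub> b}"

definition fraction_mult ::
    "('a, 'm) ring_scheme \<Rightarrow> ('a \<times> 'a) set \<Rightarrow> ('a \<times> 'a) set \<Rightarrow> ('a \<times> 'a) set" where
  "fraction_mult R U V =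
     (\<Union>x\<in>U. \<Union>y\<in>V. fraction R (fst x \<otimes>\<^bsub>R\<^esub> fst y) (snd x \<otimes>\<^bsub>R\<^esub> snd y))"

definition fraction_add ::
    "('a, 'm) ring_scheme \<Rightarrow> ('a \<times> 'a) set \<Rightarrow> ('a \<times> 'a) set \<Rightarrow> ('a \<times> 'a) set" where
  "fraction_add R U V =
     (\<Union>x\<in>U. \<Union>y\<in>V.
        fraction R (fst x \<otimes>\<^bsub>R\<^esub> snd y \<oplus>\<^bsub>R\<^esub> fst y \<otimes>\<^bsub>R\<^esub> snd x) (snd x \<otimes>\<^bsub>R\<^esub> snd y))"

definition fraction_field :: "('a, 'm) ring_scheme \<Rightarrow> (('a \<times> 'a) set) ring" where
  "fraction_field R =
     \<lparr>carrier = {fraction R a b | a b. a \<in> carrier R \<and> b \<in> carrier R - {\<zero>\<^bsub>R\<^esub>}},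
      monoid.mult = fraction_mult R, one = fraction R \<one>\<^bsub>R\<^esub> \<one>\<^bsub>R\<^esub>,
      zero = fraction R \<zero>\<^bsub>R\<^esub> \<one>\<^bsub>R\<^esub>, add = fraction_add R\<rparr>"

definition to_fractions :: "('a, 'm) ring_scheme \<Rightarrow> 'a \<Rightarrow> ('a \<times> 'a) set" where
  "to_fractions R a = fraction R a \<one>\<^bsub>R\<^esub>"

text \<open>Polynomials are coefficient lists, leading coefficient first; \<open>p\<close> is monic.\<close>

definition integral_over :: "('a, 'm) ring_scheme \<Rightarrow> 'a set \<Rightarrow> 'a \<Rightarrow> bool" where
  "integral_over F A x \<longleftrightarrow>
     (\<exists>p. p \<noteq> [] \<and> polynomial\<^bsub>F\<^esub> A p \<and> lead_coeff p = \<one>\<^bsub>F\<^esub> \<and> ring.eval F p x = \<zero>\<^bsub>F\<^esub>)"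

definition normal_domain :: "('a, 'm) ring_scheme \<Rightarrow> bool" where
  "normal_domain R \<longleftrightarrow> domain R \<and>
     (\<forall>x\<in>carrier (fraction_field R).
        integral_over (fraction_field R) (to_fractions R ` carrier R) x
          \<longrightarrow> x \<in> to_fractions R ` carrier R)"

section \<open>Gradings by the integers\<close>

definition grading :: "('a, 'm) ring_scheme \<Rightarrow> (int \<Rightarrow> 'a set) \<Rightarrow> bool" where
  "grading B G \<longleftrightarrow>
     (\<forall>i. additive_subgroup (G i) B) \<and>
     (\<forall>i j. \<forall>x\<in>G i. \<forall>y\<in>G j. x \<otimes>\<^bsub>B\<^esub> y \<in> G (i + j)) \<and>
     (\<forall>b\<in>carrier B. \<exists>!f. (\<forall>i. f i \<in> G i) \<and> finite {i. f i \<noteq> \<zero>\<^bsub>B\<^esub>} \<and>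
        b = (\<Oplus>\<^bsub>B\<^esub>i\<in>{i. f i \<noteq> \<zero>\<^bsub>B\<^esub>}. f i))"

definition veronese :: "('a, 'm) ring_scheme \<Rightarrow> (int \<Rightarrow> 'a set) \<Rightarrow> nat \<Rightarrow> 'a set" where
  "veronese B G d = {\<Oplus>\<^bsub>B\<^esub>i\<in>I. f i | I f. finite I \<and> (\<forall>i\<in>I. int d dvd i \<and> f i \<in> G i)}"

definition homogeneous_ideal :: "('a, 'm) ring_scheme \<Rightarrow> (int \<Rightarrow> 'a set) \<Rightarrow> 'a set \<Rightarrow> bool" where
  "homogeneous_ideal B G I \<longleftrightarrow> (\<exists>S \<subseteq> (\<Union>i. G i). I = Idl\<^bsub>B\<^esub> S)"

definition height :: "('a, 'm) ring_scheme \<Rightarrow> 'a set \<Rightarrow> enat" where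
  "height R p = Sup {enat n | n. \<exists>c :: nat \<Rightarrow> 'a set.
     (\<forall>i\<le>n. primeideal (c i) R) \<and> (\<forall>i<n. c i \<subset> c (Suc i)) \<and> c n = p}"

definition quotient_grading ::
    "('a, 'm) ring_scheme \<Rightarrow> (int \<Rightarrow> 'a set) \<Rightarrow> 'a set \<Rightarrow> int \<Rightarrow> 'a set set" where
  "quotient_grading B G p i = (\<lambda>b. p +>\<^bsub>B\<^esub> b) ` G i"

definition e_grading :: "('a, 'm) ring_scheme \<Rightarrow> (int \<Rightarrow> 'a set) \<Rightarrow> nat" where
  "e_grading B G = nat (Gcd {n. G n \<noteq> {\<zero>\<^bsub>B\<^esub>}})"

definition height_one_homogeneous_primes ::
    "('a, 'm) ring_scheme \<Rightarrow> (int \<Rightarrow> 'a set) \<Rightarrow> 'a set set" where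
  "height_one_homogeneous_primes B G =
     {p. primeideal p B \<and> homogeneous_ideal B G p \<and> height B p = 1}"

text \<open>On \<open>nat\<close>, \<open>Lcm\<close> of an infinite set, or of a set containing \<open>0\<close>, is \<open>0\<close>, which is
  the nonnegative generator of the intersection of the corresponding ideals of the integers.\<close>

definition e_bar :: "('a, 'm) ring_scheme \<Rightarrow> (int \<Rightarrow> 'a set) \<Rightarrow> nat" where
  "e_bar B G =
     (if height_one_homogeneous_primes B G = {} then e_grading B G
      else Lcm ((\<lambda>p. e_grading (B Quot p) (quotient_grading B G p))
                 ` height_one_homogeneous_primes B G))"

section \<open>Locally nilpotent derivations and rigidity\<close>

definition derivation :: "('a, 'm) ring_scheme \<Rightarrow> ('a \<Rightarrow> 'a) \<Rightarrow> bool" where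
  "derivation R D \<longleftrightarrow> D \<in> carrier R \<rightarrow> carrier R \<and>
     (\<forall>x\<in>carrier R. \<forall>y\<in>carrier R.
        D (x \<oplus>\<^bsub>R\<^esub> y) = D x \<oplus>\<^bsub>R\<^esub> D y \<and>
        D (x \<otimes>\<^bsub>R\<^esub> y) = D x \<otimes>\<^bsub>R\<^esub> y \<oplus>\<^bsub>R\<^esub> x \<otimes>\<^bsub>R\<^esub> D y)"

definition locally_nilpotent :: "('a, 'm) ring_scheme \<Rightarrow> ('a \<Rightarrow> 'a) \<Rightarrow> bool" where
  "locally_nilpotent R D \<longleftrightarrow> (\<forall>b\<in>carrier R. \<exists>n>0. (D ^^ n) b = \<zero>\<^bsub>R\<^esub>)"

definition rigid :: "('a, 'm) ring_scheme \<Rightarrow> bool" where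
  "rigid R \<longleftrightarrow>
     (\<forall>D. derivation R D \<and> locally_nilpotent R D \<longrightarrow> (\<forall>x\<in>carrier R. D x = \<zero>\<^bsub>R\<^esub>))"

section \<open>The sets NR and M\<close>

definition NR :: "('a, 'm) ring_scheme \<Rightarrow> (int \<Rightarrow> 'a set) \<Rightarrow> nat set" where
  "NR B G = {d. d > 0 \<and> \<not> rigid (B\<lparr>carrier := veronese B G d\<rparr>)}"

definition NR_le :: "nat \<Rightarrow> nat \<Rightarrow> bool" where
  "NR_le d1 d2 \<longleftrightarrow> d2 dvd d1"

definition maximal_NR :: "('a, 'm) ring_scheme \<Rightarrow> (int \<Rightarrow> 'a set) \<Rightarrow> nat set" where
  "maximal_NR B G = {d \<in> NR B G. \<forall>d'\<in>NR B G. NR_le d d' \<longrightarrow> d' = d}"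

definition primitive_set :: "nat set \<Rightarrow> bool" where
  "primitive_set Y \<longleftrightarrow> 0 \<notin> Y \<and> (\<forall>y\<in>Y. \<forall>y'\<in>Y. y dvd y' \<longrightarrow> y = y')"

end

theory Submission
  imports Defs
begin

text \<open>
  The key point is that \<open>d \<in> NR\<close> implies \<open>gcd d m \<in> NR\<close> for every common multiple \<open>m\<close> of the numbers
  \<open>e(B/P)\<close>, with \<open>P\<close> a homogeneous prime of height one. A locally nilpotent derivation \<open>D\<close> of the Veronese subring of degree \<open>d\<close> can only extend
  by \<open>b \<mapsto> D (b\<^sup>d) / (d b\<^sup>d\<^sup>-\<^sup>1)\<close> on homogeneous elements. If \<open>gcd d (e(B/P))\<close> divides the degree of
  \<open>b\<close>, some homogeneous \<open>w \<notin> P\<close> has \<open>D (b w)\<close> and \<open>D (w\<^sup>d)\<close> defined, and the Leibniz rule shows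
  that this fraction is regular at \<open>P\<close>. By normality a homogeneous fraction that is regular at all
  homogeneous primes of height one lies in \<open>B\<close>: a maximal proper conductor ideal of homogeneous
  fractions is such a prime. Replacing \<open>D\<close> by \<open>d D\<close> removes the factor \<open>d\<close> in the denominator.

  If \<open>e(B/P) = 0\<close> while \<open>e(B) \<noteq> 0\<close>, then after inverting the degree-zero elements outside \<open>P\<close> the
  ring becomes \<open>K\<^sub>0[t]\<close>, \<open>K\<^sub>0\<close> a field, with \<open>t\<close> homogeneous, and clearing the denominator of a multiple of
  \<open>d/dt\<close> gives a nonzero locally nilpotent derivation of \<open>B\<close> itself. Finite generation leaves only
  finitely many values \<open>e(B/P)\<close>, so \<open>e_bar = 0\<close> with \<open>e(B) \<noteq> 0\<close> forces one of them to
  vanish.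
\<close>

section \<open>Noetherian subrings\<close>

text \<open>No localisation or valuation ring is formed. Primes that are conductors of homogeneous
  fractions are studied through a pair of homogeneous elements, t in P and u outside P, such that t
  divides u p for every p in P; the fraction t / u then acts as a uniformizer at P. The pair comes
  from the usual proof that a noetherian normal local domain whose maximal ideal is a conductor is a
  discrete valuation ring. Every descent in it is a sequence obtained by multiplying again and again
  by one fixed fraction, which makes that fraction integral.

  The scalars are not placed in degree 0 by assumption. That they lie there is derived, and it is
  what lets e(B/P) be computed from finitely many generators.

  A locally nilpotent derivation of a Veronese subring need not be homogeneous. Only classes of
  degrees modulo d survive, and nilpotency of the extension is measured by the D-degree of d-th
  powers.

  Divisibility of the members of M(B) by way of \<open>e_bar\<close> also covers
  \<open>e_bar\<close> equal to 0, where it says nothing; finiteness is then read off from (b) and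
  (c).\<close>

context ring
begin

text \<open>Ideals are relative to a subset \<open>A\<close> of one fixed ring, so that elements can
  be adjoined repeatedly without changing the ambient ring. For a subring \<open>A\<close>,
  negatives come from multiplying by \<open>\<ominus> \<one>\<close>.\<close>

definition ideal_in :: "'a set \<Rightarrow> 'a set \<Rightarrow> bool" where
  "ideal_in A J \<longleftrightarrow> J \<subseteq> A \<and> \<zero> \<in> J \<and> (\<forall>x\<in>J. \<forall>y\<in>J. x \<oplus> y \<in> J) \<and> (\<forall>a\<in>A. \<forall>x\<in>J. a \<otimes> x \<in> J)"

definition noetherian_in :: "'a set \<Rightarrow> bool" where
  "noetherian_in A \<longleftrightarrow>
     (\<forall>I :: nat \<Rightarrow> 'a set. (\<forall>n. ideal_in A (I n)) \<and> (\<forall>n. I n \<subseteq> I (Suc n))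
        \<longrightarrow> (\<exists>n. \<forall>m\<ge>n. I m = I n))"

lemma ideal_inD:
  assumes "ideal_in A J"
  shows "J \<subseteq> A" "\<zero> \<in> J" "x \<in> J \<Longrightarrow> y \<in> J \<Longrightarrow> x \<oplus> y \<in> J" "a \<in> A \<Longrightarrow> x \<in> J \<Longrightarrow> a \<otimes> x \<in> J"
  using assms unfolding ideal_in_def by auto

lemma noetherian_inE:
  assumes "noetherian_in A" "\<And>n. ideal_in A (I n)" "\<And>n. I n \<subseteq> I (Suc n)"
  obtains n where "\<And>m. m \<ge> n \<Longrightarrow> I m = I n"
  using assms unfolding noetherian_in_def by metis

lemma noetherian_in_maximal:
  assumes N: "noetherian_in A" and F: "\<And>J. J \<in> F \<Longrightarrow> ideal_in A J" and "J0 \<in> F"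
  obtains M where "M \<in> F" "\<And>J. J \<in> F \<Longrightarrow> M \<subseteq> J \<Longrightarrow> J = M"
proof (rule ccontr)
  assume "\<not> thesis"
  with that have "\<And>M. M \<in> F \<Longrightarrow> \<exists>J\<in>F. M \<subset> J" by blast
  then obtain g where g: "\<And>M. M \<in> F \<Longrightarrow> g M \<in> F \<and> M \<subset> g M" by metis
  define I where "I = rec_nat J0 (\<lambda>_. g)"
  have I: "I 0 = J0" "\<And>n. I (Suc n) = g (I n)" by (simp_all add: I_def)
  have mem: "I n \<in> F" for n by (induction n) (auto simp: I g \<open>J0 \<in> F\<close>)
  obtain n where n: "\<And>m. m \<ge> n \<Longrightarrow> I m = I n"
  proof (rule noetherian_inE[OF N, of I])
    show "I n \<subseteq> I (Suc n)" for n using g[OF mem[of n]] I(2)[of n] by blast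
  qed (use F[OF mem] in auto)
  have "I (Suc n) = I n" by (rule n) simp
  then show False using g[OF mem[of n]] I(2)[of n] by blast
qed

section \<open>Hilbert's basis theorem for adjoining one element\<close>

primrec polys :: "'a set \<Rightarrow> 'a \<Rightarrow> nat \<Rightarrow> 'a set" where
  "polys A x 0 = {\<zero>}"
| "polys A x (Suc n) = {a \<otimes> x [^] n \<oplus> f | a f. a \<in> A \<and> f \<in> polys A x n}"

text \<open>\<open>polys A x n\<close> holds the values at \<open>x\<close> of polynomials over
  \<open>A\<close> of degree below \<open>n\<close>. As \<open>x\<close> may be algebraic over
  \<open>A\<close>, an element has no leading coefficient of its own; collecting those of all
  representations amounts to applying Hilbert's argument to the preimage of \<open>J\<close> in the
  polynomial ring.\<close>

definition leading_coeffs :: "'a set \<Rightarrow> 'a \<Rightarrow> nat \<Rightarrow> 'a set \<Rightarrow> 'a set" where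
  "leading_coeffs A x n J = {a \<in> A. \<exists>f \<in> polys A x n. a \<otimes> x [^] n \<oplus> f \<in> J}"

end

context cring
begin

context
  fixes A x assumes A: "subring A R" and x: "x \<in> carrier R"
begin

lemma subring_mem_carrier: "a \<in> A \<Longrightarrow> a \<in> carrier R"
  using subringE(1)[OF A] by auto

lemma polys_carrier: "f \<in> polys A x n \<Longrightarrow> f \<in> carrier R"
  using x by (induction n arbitrary: f) (auto simp: subring_mem_carrier)

lemma polys_add: "f \<in> polys A x n \<Longrightarrow> g \<in> polys A x n \<Longrightarrow> f \<oplus> g \<in> polys A x n"
proof (induction n arbitrary: f g)
  case (Suc n)
  obtain a f' b g' where *: "f = a \<otimes> x [^] n \<oplus> f'" "g = b \<otimes> x [^] n \<oplus> g'" "a \<in> A" "b \<in> A"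
    "f' \<in> polys A x n" "g' \<in> polys A x n" using Suc.prems by auto
  have "f \<oplus> g = (a \<oplus> b) \<otimes> x [^] n \<oplus> (f' \<oplus> g')"
    using * subring_mem_carrier[of a] subring_mem_carrier[of b] polys_carrier[of f'] polys_carrier[of g'] x
    by (simp add: l_distr a_ac)
  moreover have "a \<oplus> b \<in> A" using * subringE(7)[OF A] by auto
  ultimately show ?case using Suc.IH * by auto
qed simp

lemma polys_smult: "f \<in> polys A x n \<Longrightarrow> c \<in> A \<Longrightarrow> c \<otimes> f \<in> polys A x n"
proof (induction n arbitrary: f)
  case (Suc n)
  obtain a f' where *: "f = a \<otimes> x [^] n \<oplus> f'" "a \<in> A" "f' \<in> polys A x n" using Suc.prems by auto
  have "c \<otimes> f = (c \<otimes> a) \<otimes> x [^] n \<oplus> c \<otimes> f'"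
    using * subring_mem_carrier[of a] subring_mem_carrier[of c] polys_carrier[of f'] x Suc.prems
    by (simp add: r_distr m_ac)
  moreover have "c \<otimes> a \<in> A" using * subringE(6)[OF A] Suc.prems by auto
  ultimately show ?case using Suc.IH[of f'] Suc.prems * by auto
qed (auto simp: subring_mem_carrier)

lemma polys_shift: "f \<in> polys A x n \<Longrightarrow> x \<otimes> f \<in> polys A x (Suc n)"
proof (induction n arbitrary: f)
  case 0
  have "\<zero> \<in> A" using subringE(2)[OF A] .
  then show ?case using 0 x by (auto intro!: exI[of _ \<zero>])
next
  case (Suc n)
  obtain a f' where *: "f = a \<otimes> x [^] n \<oplus> f'" "a \<in> A" "f' \<in> polys A x n" using Suc.prems by auto
  have "x \<otimes> f = a \<otimes> x [^] (Suc n) \<oplus> x \<otimes> f'"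
    using * subring_mem_carrier[of a] polys_carrier[of f'] x
    by (simp add: r_distr m_ac)
  moreover have "x \<otimes> f' \<in> polys A x (Suc n)" using Suc.IH * by auto
  ultimately show ?case using * by auto
qed

lemma polys_Suc_mono: "polys A x n \<subseteq> polys A x (Suc n)"
proof
  fix f assume f: "f \<in> polys A x n"
  then have "f = \<zero> \<otimes> x [^] n \<oplus> f" using polys_carrier x by simp
  then show "f \<in> polys A x (Suc n)" using subringE(2)[OF A] f by auto
qed

lemma polys_mono: "m \<le> n \<Longrightarrow> polys A x m \<subseteq> polys A x n"
  using polys_Suc_mono by (rule lift_Suc_mono_le)

lemma polys_power_mult: "f \<in> polys A x n \<Longrightarrow> x [^] m \<otimes> f \<in> polys A x (m + n)"
proof (induction m)
  case (Suc m)
  have "x [^] Suc m \<otimes> f = x \<otimes> (x [^] m \<otimes> f)"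
    using x polys_carrier[of f n] Suc.prems by (simp add: m_ac)
  then show ?case using polys_shift[OF Suc.IH[OF Suc.prems]] by simp
qed (simp add: polys_carrier)

lemma polys_mult: "f \<in> polys A x m \<Longrightarrow> g \<in> polys A x n \<Longrightarrow> f \<otimes> g \<in> polys A x (m + n)"
proof (induction m arbitrary: f)
  case 0
  then have "f \<otimes> g = \<zero>" "\<zero> \<in> polys A x 0" using polys_carrier by auto
  then show ?case using polys_mono[of 0 n] by auto
next
  case (Suc m)
  obtain a f' where *: "f = a \<otimes> x [^] m \<oplus> f'" "a \<in> A" "f' \<in> polys A x m" using Suc.prems by auto
  have "f \<otimes> g = a \<otimes> (x [^] m \<otimes> g) \<oplus> f' \<otimes> g"
    using * subring_mem_carrier[of a] polys_carrier[of f'] polys_carrier[of g n] x Suc.prems(2)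
    by (simp add: l_distr m_assoc)
  moreover have "a \<otimes> (x [^] m \<otimes> g) \<in> polys A x (m + n)"
    using * polys_smult[OF polys_power_mult] Suc.prems by auto
  moreover have "f' \<otimes> g \<in> polys A x (m + n)" using * Suc by auto
  ultimately show ?case using polys_add[of _ "m+n"] polys_Suc_mono[of "m+n"] by auto
qed

lemma subring_adjoin: "subring (\<Union>n. polys A x n) R" (is "subring ?P R")
proof (rule subringI)
  show "?P \<subseteq> carrier R" using polys_carrier by auto
  have one: "c \<in> polys A x 1" if "c \<in> A" for c
    using that subring_mem_carrier[of c] by (auto intro!: exI[of _ c])
  then show "\<one> \<in> ?P" using subringE(3)[OF A] by blast
  have "\<ominus> \<one> \<in> A" using subringE(3,5)[OF A] by auto
  then show "\<ominus> h \<in> ?P" if "h \<in> ?P" for h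
    using that polys_smult[of h _ "\<ominus> \<one>"] polys_carrier[of h] by (auto simp: l_minus)
  show "h1 \<otimes> h2 \<in> ?P" if "h1 \<in> ?P" "h2 \<in> ?P" for h1 h2 using that polys_mult by blast
  show "h1 \<oplus> h2 \<in> ?P" if "h1 \<in> ?P" "h2 \<in> ?P" for h1 h2
  proof -
    obtain m n where "h1 \<in> polys A x m" "h2 \<in> polys A x n" using \<open>h1 \<in> ?P\<close> \<open>h2 \<in> ?P\<close> by auto
    then have "h1 \<in> polys A x (max m n)" "h2 \<in> polys A x (max m n)"
      using polys_mono[of m "max m n"] polys_mono[of n "max m n"] by auto
    then show ?thesis using polys_add by blast
  qed
qed

lemma adjoin_incl: "A \<subseteq> (\<Union>n. polys A x n)" "x \<in> (\<Union>n. polys A x n)"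
proof -
  have one: "c \<in> polys A x 1" if "c \<in> A" for c
    using that subring_mem_carrier[of c] by (auto intro!: exI[of _ c])
  then show "A \<subseteq> (\<Union>n. polys A x n)" by blast
  have "\<one> \<in> polys A x 1" using subringE(3)[OF A] one by simp
  then have "x \<otimes> \<one> \<in> polys A x (Suc 1)" by (rule polys_shift)
  then show "x \<in> (\<Union>n. polys A x n)" using x by (auto simp del: polys.simps)
qed

lemma leading_coeffs_ideal:
  assumes "ideal_in (\<Union>n. polys A x n) J"
  shows "ideal_in A (leading_coeffs A x n J)"
proof -
  note J = ideal_inD(2,3)[OF assms] ideal_inD(4)[OF assms subsetD[OF adjoin_incl(1)]]
  show ?thesis
  unfolding ideal_in_def
proof (intro conjI ballI)
  show "leading_coeffs A x n J \<subseteq> A" by (auto simp: leading_coeffs_def)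
  have "\<zero> \<in> polys A x n" using polys_mono[of 0 n] by auto
  then show "\<zero> \<in> leading_coeffs A x n J"
    using J(1) subringE(2)[OF A] x by (auto simp: leading_coeffs_def intro!: bexI[of _ \<zero>])
next
  fix a b assume "a \<in> leading_coeffs A x n J" "b \<in> leading_coeffs A x n J"
  then obtain f g where *: "a \<in> A" "b \<in> A" "f \<in> polys A x n" "g \<in> polys A x n"
    "a \<otimes> x [^] n \<oplus> f \<in> J" "b \<otimes> x [^] n \<oplus> g \<in> J" by (auto simp: leading_coeffs_def)
  have "(a \<oplus> b) \<otimes> x [^] n \<oplus> (f \<oplus> g) = (a \<otimes> x [^] n \<oplus> f) \<oplus> (b \<otimes> x [^] n \<oplus> g)"
    using * subring_mem_carrier[of a] subring_mem_carrier[of b] polys_carrier[of f] polys_carrier[of g] x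
    by (simp add: l_distr a_ac)
  then have "(a \<oplus> b) \<otimes> x [^] n \<oplus> (f \<oplus> g) \<in> J" using J(2) * by metis
  then show "a \<oplus> b \<in> leading_coeffs A x n J"
    using * polys_add subringE(7)[OF A] by (auto simp: leading_coeffs_def)
next
  fix c a assume "c \<in> A" "a \<in> leading_coeffs A x n J"
  then obtain f where *: "a \<in> A" "f \<in> polys A x n" "c \<in> A"
    "a \<otimes> x [^] n \<oplus> f \<in> J" by (auto simp: leading_coeffs_def)
  have "(c \<otimes> a) \<otimes> x [^] n \<oplus> (c \<otimes> f) = c \<otimes> (a \<otimes> x [^] n \<oplus> f)"
    using * subring_mem_carrier[of a] subring_mem_carrier[of c] polys_carrier[of f] x
    by (simp add: r_distr m_ac)
  then have "(c \<otimes> a) \<otimes> x [^] n \<oplus> (c \<otimes> f) \<in> J" using J * by metis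
  then show "c \<otimes> a \<in> leading_coeffs A x n J"
    using * polys_smult subringE(6)[OF A] by (auto simp: leading_coeffs_def)
qed
qed

lemma leading_coeffs_Suc:
  assumes "ideal_in (\<Union>n. polys A x n) J"
  shows "leading_coeffs A x n J \<subseteq> leading_coeffs A x (Suc n) J"
proof
  fix a assume "a \<in> leading_coeffs A x n J"
  then obtain f where *: "a \<in> A" "f \<in> polys A x n" "a \<otimes> x [^] n \<oplus> f \<in> J"
    by (auto simp: leading_coeffs_def)
  have "x \<otimes> (a \<otimes> x [^] n \<oplus> f) = a \<otimes> x [^] Suc n \<oplus> x \<otimes> f"
    using * subring_mem_carrier[of a] polys_carrier[of f] x by (simp add: r_distr m_ac)
  moreover have "x \<otimes> (a \<otimes> x [^] n \<oplus> f) \<in> J"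
    using ideal_inD(4)[OF assms] adjoin_incl(2) * by blast
  ultimately show "a \<in> leading_coeffs A x (Suc n) J"
    using * polys_shift[of f n] unfolding leading_coeffs_def by (metis (mono_tags, lifting) mem_Collect_eq)
qed

text \<open>Subtracting from \<open>f\<close> in \<open>J'\<close> an element of \<open>J\<close>
  with the same leading coefficient leaves a value of lower degree that is still in
  \<open>J'\<close>; induction on the degree bound then puts \<open>f\<close> into
  \<open>J\<close>.\<close>

lemma leading_coeffs_determine:
  assumes "ideal_in (\<Union>n. polys A x n) J" "ideal_in (\<Union>n. polys A x n) J'" "J \<subseteq> J'"
    and eq: "\<And>n. leading_coeffs A x n J' \<subseteq> leading_coeffs A x n J"
  shows "J' = J"
proof -
  have "f \<in> J" if "f \<in> J'" "f \<in> polys A x n" for f n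
    using that
  proof (induction n arbitrary: f)
    case 0
    then show ?case using assms(1) by (auto simp: ideal_in_def)
  next
    case (Suc n)
    then obtain a f' where *: "f = a \<otimes> x [^] n \<oplus> f'" "a \<in> A" "f' \<in> polys A x n" by auto
    then have "a \<in> leading_coeffs A x n J'" using Suc.prems by (auto simp: leading_coeffs_def)
    then obtain g where g: "g \<in> polys A x n" "a \<otimes> x [^] n \<oplus> g \<in> J"
      using eq by (auto simp: leading_coeffs_def)
    have m1: "\<ominus> \<one> \<in> A" using subringE(3,5)[OF A] by auto
    then have "\<ominus> \<one> \<otimes> (a \<otimes> x [^] n \<oplus> g) \<in> J'"
      using ideal_inD(4)[OF assms(2)] assms(3) g(2) adjoin_incl(1) by blast
    then have "f \<oplus> \<ominus> \<one> \<otimes> (a \<otimes> x [^] n \<oplus> g) \<in> J'"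
      using Suc.prems ideal_inD(3)[OF assms(2)] by blast
    moreover have "f \<oplus> \<ominus> \<one> \<otimes> (a \<otimes> x [^] n \<oplus> g) = f' \<oplus> \<ominus> \<one> \<otimes> g"
    proof -
      have c: "a \<in> carrier R" "f' \<in> carrier R" "g \<in> carrier R" "x [^] n \<in> carrier R"
        using * g subring_mem_carrier polys_carrier x by auto
      then show ?thesis unfolding *(1) by algebra
    qed
    moreover have "f' \<oplus> \<ominus> \<one> \<otimes> g \<in> polys A x n" using * g m1 polys_smult polys_add by blast
    ultimately have "f' \<oplus> \<ominus> \<one> \<otimes> g \<in> J" using Suc.IH by auto
    then have "(f' \<oplus> \<ominus> \<one> \<otimes> g) \<oplus> (a \<otimes> x [^] n \<oplus> g) \<in> J"
      using ideal_inD(3)[OF assms(1)] g(2) by blast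
    moreover have "(f' \<oplus> \<ominus> \<one> \<otimes> g) \<oplus> (a \<otimes> x [^] n \<oplus> g) = f"
    proof -
      have c: "a \<in> carrier R" "f' \<in> carrier R" "g \<in> carrier R" "x [^] n \<in> carrier R"
        using * g subring_mem_carrier polys_carrier x by auto
      then show ?thesis unfolding *(1) by algebra
    qed
    ultimately show ?case by simp
  qed
  moreover have "J' \<subseteq> (\<Union>n. polys A x n)" using assms(2) by (auto simp: ideal_in_def)
  ultimately show ?thesis using assms(3) by blast
qed

text \<open>Leading coefficients form a family \<open>L n k\<close> that increases in the degree
  \<open>n\<close> and in the index \<open>k\<close>. Stability of its diagonal controls all large
  degrees at once, leaving finitely many rows to be bounded separately.\<close>

theorem noetherian_adjoin:
  assumes N: "noetherian_in A"
  shows "noetherian_in (\<Union>n. polys A x n)"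
  unfolding noetherian_in_def
proof (intro allI impI, elim conjE)
  fix I :: "nat \<Rightarrow> 'a set"
  assume I: "\<forall>n. ideal_in (\<Union>n. polys A x n) (I n)" and inc: "\<forall>n. I n \<subseteq> I (Suc n)"
  define L where "L n k = leading_coeffs A x n (I k)" for n k
  have Imono: "I j \<subseteq> I k" if "j \<le> k" for j k using inc by (intro lift_Suc_mono_le[of I, OF _ that]) auto
  have Lid: "ideal_in A (L n k)" for n k unfolding L_def using I by (intro leading_coeffs_ideal) auto
  have Lk: "L n j \<subseteq> L n k" if "j \<le> k" for n j k
    using Imono[OF that] by (auto simp: L_def leading_coeffs_def)
  have Ln: "L m k \<subseteq> L n k" if "m \<le> n" for m n k
    using leading_coeffs_Suc I unfolding L_def
    by (intro lift_Suc_mono_le[of "\<lambda>n. leading_coeffs A x n (I k)", OF _ that]) auto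
  have Lmono: "L m j \<subseteq> L n k" if "m \<le> n" "j \<le> k" for m n j k
    using Ln[OF that(1), of j] Lk[OF that(2), of n] by auto
  obtain N where N': "\<And>m. m \<ge> N \<Longrightarrow> L m m = L N N"
    by (rule noetherian_inE[OF N, of "\<lambda>n. L n n"]) (use Lid Lmono in auto)
  have "\<exists>k. \<forall>m\<ge>k. L n m = L n k" for n
    by (rule noetherian_inE[OF N, of "L n"]) (use Lid Lk in auto)
  then obtain K where K: "\<And>n m. m \<ge> K n \<Longrightarrow> L n m = L n (K n)" by metis
  \<comment> \<open>Rows \<open>n \<le> N\<close> are stable from \<open>K n\<close> on. For
    \<open>n > N\<close> the row stays inside the diagonal value \<open>L N N\<close>, which
    \<open>L n M\<close> already contains.\<close>
  define M where "M = max N (Max (K ` {..N}))"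
  have KM: "K n \<le> M" if "n \<le> N" for n
    using that unfolding M_def by (intro max.coboundedI2 Max_ge) auto
  have "L n m \<subseteq> L n M" if "m \<ge> M" for n m
  proof (cases "n \<le> N")
    case True
    then show ?thesis using K[of n m] K[of n M] KM[OF True] that by auto
  next
    case False
    have "L n m \<subseteq> L (max n m) (max n m)" by (rule Lmono) auto
    also have "\<dots> = L N N" using False by (intro N') auto
    also have "\<dots> \<subseteq> L n M" using False by (intro Lmono) (auto simp: M_def)
    finally show ?thesis .
  qed
  then have "I m = I M" if "m \<ge> M" for m
    using that I Imono[OF that] unfolding L_def by (intro leading_coeffs_determine) auto
  then show "\<exists>n. \<forall>m\<ge>n. I m = I n" by blast
qed

end

lemma noetherian_generated:
  assumes "finite S" "S \<subseteq> carrier R" "subring A R" "noetherian_in A"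
  shows "\<exists>A'. subring A' R \<and> noetherian_in A' \<and> A \<union> S \<subseteq> A'"
  using assms(1,2)
proof (induction S)
  case (insert x S)
  then obtain A' where A': "subring A' R" "noetherian_in A'" "A \<union> S \<subseteq> A'" by auto
  have "subring (\<Union>n. polys A' x n) R" "noetherian_in (\<Union>n. polys A' x n)"
    "A' \<subseteq> (\<Union>n. polys A' x n)" "x \<in> (\<Union>n. polys A' x n)"
    using subring_adjoin noetherian_adjoin adjoin_incl A' insert.prems by auto
  then show ?case using A'(3) by (intro exI[of _ "\<Union>n. polys A' x n"]) blast
qed (use assms in auto)

lemma noetherian_subfield:
  assumes inv: "\<And>a. a \<in> A \<Longrightarrow> a \<noteq> \<zero> \<Longrightarrow> \<exists>b\<in>A. b \<otimes> a = \<one>" and "A \<subseteq> carrier R"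
  shows "noetherian_in A"
proof -
  have dich: "J = {\<zero>} \<or> J = A" if J: "ideal_in A J" for J
  proof (rule ccontr)
    assume *: "\<not> ?thesis"
    then obtain a where a: "a \<in> J" "a \<noteq> \<zero>" using J by (auto simp: ideal_in_def)
    then obtain b where "b \<in> A" "b \<otimes> a = \<one>" using inv[of a] ideal_inD(1)[OF J] by blast
    then have "\<one> \<in> J" using a J unfolding ideal_in_def by metis
    then have "c \<in> J" if "c \<in> A" for c
      using that J assms(2) unfolding ideal_in_def by (metis r_one subsetD)
    then show False using * J by (auto simp: ideal_in_def)
  qed
  show ?thesis
    unfolding noetherian_in_def
  proof (intro allI impI, elim conjE)
    fix I :: "nat \<Rightarrow> 'a set"
    assume I: "\<forall>n. ideal_in A (I n)" and inc: "\<forall>n. I n \<subseteq> I (Suc n)"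
    have Imono: "I j \<subseteq> I k" if "j \<le> k" for j k using inc by (intro lift_Suc_mono_le[of I, OF _ that]) auto
    show "\<exists>n. \<forall>m\<ge>n. I m = I n"
    proof (cases "\<exists>n. I n = A")
      case True
      then obtain n where "I n = A" ..
      then have "I m = A" if "m \<ge> n" for m using Imono[OF that] I that by (auto simp: ideal_in_def)
      then show ?thesis using \<open>I n = A\<close> by auto
    next
      case False
      then have "I m = {\<zero>}" for m using dich I by blast
      then show ?thesis by auto
    qed
  qed
qed

end

section \<open>Homogeneous components\<close>

locale graded_domain = domain R for R (structure) +
  fixes G :: "int \<Rightarrow> 'a set"
  assumes grading: "grading R G"
begin

lemma G_additive_subgroup: "additive_subgroup (G i) R"
  using grading by (simp add: grading_def)

lemma G_carrier [intro]: "x \<in> G i \<Longrightarrow> x \<in> carrier R"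
  using additive_subgroup.a_Hcarr[OF G_additive_subgroup] .

lemma G_zero [intro, simp]: "\<zero> \<in> G i"
  using additive_subgroup.zero_closed[OF G_additive_subgroup] .

lemma G_add [intro]: "x \<in> G i \<Longrightarrow> y \<in> G i \<Longrightarrow> x \<oplus> y \<in> G i"
  using additive_subgroup.a_closed[OF G_additive_subgroup] .

lemma G_mult [intro]: "x \<in> G i \<Longrightarrow> y \<in> G j \<Longrightarrow> x \<otimes> y \<in> G (i + j)"
  using grading by (simp add: grading_def)

definition comp :: "'a \<Rightarrow> int \<Rightarrow> 'a" where
  "comp b = (THE f. (\<forall>i. f i \<in> G i) \<and> finite {i. f i \<noteq> \<zero>} \<and> b = (\<Oplus>i\<in>{i. f i \<noteq> \<zero>}. f i))"

lemma finsum_supp_mono: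
  assumes "\<And>i. f i \<in> G i" "finite F" "\<And>i. f i \<noteq> \<zero> \<Longrightarrow> i \<in> F"
  shows "(\<Oplus>i\<in>{i. f i \<noteq> \<zero>}. f i) = (\<Oplus>i\<in>F. f i)"
  using assms by (intro add.finprod_mono_neutral_cong_left) auto

lemma comp_props:
  assumes "b \<in> carrier R"
  shows comp_G: "comp b i \<in> G i"
    and finite_supp: "finite {i. comp b i \<noteq> \<zero>}"
    and finsum_comp: "b = (\<Oplus>i\<in>{i. comp b i \<noteq> \<zero>}. comp b i)"
proof -
  have "\<exists>!f. (\<forall>i. f i \<in> G i) \<and> finite {i. f i \<noteq> \<zero>} \<and> b = (\<Oplus>i\<in>{i. f i \<noteq> \<zero>}. f i)"
    using grading assms by (simp add: grading_def)
  from theI'[OF this, folded comp_def]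
  show "comp b i \<in> G i" "finite {i. comp b i \<noteq> \<zero>}"
    "b = (\<Oplus>i\<in>{i. comp b i \<noteq> \<zero>}. comp b i)" by auto
qed

lemma comp_carrier [intro]: "b \<in> carrier R \<Longrightarrow> comp b i \<in> carrier R"
  using comp_G by blast

lemma finsum_comp_superset:
  assumes "b \<in> carrier R" "finite F" "\<And>i. comp b i \<noteq> \<zero> \<Longrightarrow> i \<in> F"
  shows "b = (\<Oplus>i\<in>F. comp b i)"
  using finsum_supp_mono[of "comp b", OF comp_G[OF assms(1)] assms(2,3)] finsum_comp[OF assms(1)]
  by simp

lemma comp_unique:
  assumes f: "\<And>i. f i \<in> G i" and F: "finite F" "\<And>i. i \<notin> F \<Longrightarrow> f i = \<zero>"
    and b: "b = (\<Oplus>i\<in>F. f i)"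
  shows "comp b = f"
proof -
  have bc: "b \<in> carrier R" using f b by (auto intro!: finsum_closed)
  have "\<exists>!f. (\<forall>i. f i \<in> G i) \<and> finite {i. f i \<noteq> \<zero>} \<and> b = (\<Oplus>i\<in>{i. f i \<noteq> \<zero>}. f i)"
    using grading bc by (simp add: grading_def)
  moreover have "finite {i. f i \<noteq> \<zero>}" using F by (auto intro: finite_subset[of _ F])
  moreover have "b = (\<Oplus>i\<in>{i. f i \<noteq> \<zero>}. f i)"
    using finsum_supp_mono[of f F, OF f F(1)] F(2) b by (metis (no_types, lifting))
  ultimately show ?thesis unfolding comp_def using f by (intro the1_equality) auto
qed

lemma comp_homogeneous:
  assumes "h \<in> G k"
  shows "comp h = (\<lambda>i. if i = k then h else \<zero>)"
proof (rule comp_unique[of _ "{k}"])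
  show "h = (\<Oplus>i\<in>{k}. if i = k then h else \<zero>)"
    using assms by (simp add: G_carrier)
qed (use assms in auto)

lemma comp_zero [simp]: "comp \<zero> i = \<zero>"
  using comp_homogeneous[OF G_zero[of 0]] by simp

lemma comp_add:
  assumes "a \<in> carrier R" "b \<in> carrier R"
  shows "comp (a \<oplus> b) i = comp a i \<oplus> comp b i"
proof -
  let ?F = "{i. comp a i \<noteq> \<zero>} \<union> {i. comp b i \<noteq> \<zero>}"
  have F: "finite ?F" using assms finite_supp by auto
  have "comp (a \<oplus> b) = (\<lambda>i. comp a i \<oplus> comp b i)"
  proof (rule comp_unique[of _ ?F])
    have "a = (\<Oplus>i\<in>?F. comp a i)" "b = (\<Oplus>i\<in>?F. comp b i)"
      using assms F by (auto intro!: finsum_comp_superset)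
    then have "a \<oplus> b = (\<Oplus>i\<in>?F. comp a i) \<oplus> (\<Oplus>i\<in>?F. comp b i)" by simp
    also have "\<dots> = (\<Oplus>i\<in>?F. comp a i \<oplus> comp b i)"
      using assms by (intro finsum_addf[symmetric]) auto
    finally show "a \<oplus> b = (\<Oplus>i\<in>?F. comp a i \<oplus> comp b i)" .
  qed (use assms F comp_G in auto)
  then show ?thesis by simp
qed

lemma comp_mult_homogeneous:
  assumes "h \<in> G k" "b \<in> carrier R"
  shows "comp (h \<otimes> b) i = h \<otimes> comp b (i - k)"
proof -
  let ?F = "{i. comp b i \<noteq> \<zero>}"
  have F: "finite ?F" using assms finite_supp by auto
  have "comp (h \<otimes> b) = (\<lambda>i. h \<otimes> comp b (i - k))"
  proof (rule comp_unique[of _ "(\<lambda>i. i + k) ` ?F"])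
    show "h \<otimes> comp b (i - k) \<in> G i" for i
      using G_mult[OF assms(1) comp_G[OF assms(2)], of "i - k"] by simp
    show "h \<otimes> comp b (i - k) = \<zero>" if "i \<notin> (\<lambda>i. i + k) ` ?F" for i
    proof -
      have "i - k \<notin> ?F" using that by (metis diff_add_cancel imageI)
      then show ?thesis using assms by (simp add: G_carrier)
    qed
    have "h \<otimes> b = h \<otimes> (\<Oplus>i\<in>?F. comp b i)" using finsum_comp[OF assms(2)] by simp
    also have "\<dots> = (\<Oplus>i\<in>?F. h \<otimes> comp b i)" using assms F by (intro finsum_rdistr) auto
    also have "\<dots> = (\<Oplus>i\<in>(\<lambda>i. i + k) ` ?F. h \<otimes> comp b (i - k))"
      using assms by (subst finsum_reindex) (auto simp: inj_on_def)
    finally show "h \<otimes> b = (\<Oplus>i\<in>(\<lambda>i. i + k) ` ?F. h \<otimes> comp b (i - k))" .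
  qed (use F in auto)
  then show ?thesis by simp
qed

text \<open>The degree set is arbitrary because four kinds occur: all integers for the ring,
  multiples of \<open>d\<close> for a Veronese subring, residue classes for the pieces preserved by
  a derivation, and half-lines for the terms below a leading one.\<close>

definition span :: "int set \<Rightarrow> 'a set" where
  "span S = {b \<in> carrier R. \<forall>k. comp b k \<noteq> \<zero> \<longrightarrow> k \<in> S}"

lemma span_carrier [intro]: "b \<in> span S \<Longrightarrow> b \<in> carrier R"
  by (simp add: span_def)

lemma span_UNIV: "span UNIV = carrier R"
  by (auto simp: span_def)

lemma span_mono: "S \<subseteq> T \<Longrightarrow> span S \<subseteq> span T"
  by (auto simp: span_def)

lemma span_zero [simp]: "\<zero> \<in> span S"
  by (simp add: span_def)

lemma G_subset_span: "k \<in> S \<Longrightarrow> h \<in> G k \<Longrightarrow> h \<in> span S"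
  by (auto simp: span_def comp_homogeneous)

lemma span_add: "a \<in> span S \<Longrightarrow> b \<in> span S \<Longrightarrow> a \<oplus> b \<in> span S"
proof -
  assume *: "a \<in> span S" "b \<in> span S"
  have "k \<in> S" if "comp (a \<oplus> b) k \<noteq> \<zero>" for k
  proof -
    have "comp a k \<noteq> \<zero> \<or> comp b k \<noteq> \<zero>"
      using that * comp_add[of a b k] by (auto simp: span_def)
    then show ?thesis using * by (auto simp: span_def)
  qed
  then show ?thesis using * by (simp add: span_def)
qed

lemma span_finsum:
  assumes "finite I" "\<And>i. i \<in> I \<Longrightarrow> f i \<in> span S"
  shows "(\<Oplus>i\<in>I. f i) \<in> span S"
  using assms
proof (induction I rule: finite_induct)
  case (insert x F)
  then have "(\<Oplus>i\<in>insert x F. f i) = f x \<oplus> (\<Oplus>i\<in>F. f i)"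
    by (intro finsum_insert) auto
  then show ?case using insert span_add by auto
qed simp

lemma span_induct [consumes 1, case_names zero homogeneous add]:
  assumes "b \<in> span S" and z: "P \<zero>" and h: "\<And>i h. i \<in> S \<Longrightarrow> h \<in> G i \<Longrightarrow> P h"
    and add: "\<And>a b. a \<in> span S \<Longrightarrow> b \<in> span S \<Longrightarrow> P a \<Longrightarrow> P b \<Longrightarrow> P (a \<oplus> b)"
  shows "P b"
proof -
  have bc: "b \<in> carrier R" using assms(1) by auto
  have "(\<Oplus>i\<in>I. comp b i) \<in> span S \<and> P (\<Oplus>i\<in>I. comp b i)"
    if "finite I" "I \<subseteq> {i. comp b i \<noteq> \<zero>}" for I
    using that
  proof (induction I rule: finite_induct)
    case (insert x F)
    then have "x \<in> S" using assms(1) by (auto simp: span_def)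
    then have "comp b x \<in> span S" "P (comp b x)"
      using comp_G[OF bc, of x] G_subset_span[of x S] h[of x] by blast+
    moreover have "(\<Oplus>i\<in>insert x F. comp b i) = comp b x \<oplus> (\<Oplus>i\<in>F. comp b i)"
      using insert bc by (intro finsum_insert) auto
    ultimately show ?case using insert span_add add by auto
  qed (use z in simp)
  from this[OF finite_supp[OF bc]] have "P (\<Oplus>i\<in>{i. comp b i \<noteq> \<zero>}. comp b i)" by blast
  then show ?thesis by (simp only: finsum_comp[OF bc, symmetric])
qed

lemma homogeneous_induct [consumes 1, case_names homogeneous add]:
  assumes "b \<in> carrier R" and h: "\<And>i h. h \<in> G i \<Longrightarrow> P h"
    and "\<And>a b. a \<in> carrier R \<Longrightarrow> b \<in> carrier R \<Longrightarrow> P a \<Longrightarrow> P b \<Longrightarrow> P (a \<oplus> b)"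
  shows "P b"
proof -
  have "b \<in> span UNIV" using assms(1) by (simp add: span_UNIV)
  then show ?thesis
    by (induction rule: span_induct) (use assms h[OF G_zero] span_UNIV in auto)
qed

lemma span_mult:
  assumes "a \<in> span S" "b \<in> span T" and U: "\<And>s t. s \<in> S \<Longrightarrow> t \<in> T \<Longrightarrow> s + t \<in> U"
  shows "a \<otimes> b \<in> span U"
  using assms(1)
proof (induction rule: span_induct)
  case (homogeneous i h)
  show ?case using assms(2)
  proof (induction rule: span_induct)
    case (homogeneous j k)
    then show ?case
      using G_subset_span[OF U[OF \<open>i \<in> S\<close>] G_mult[OF \<open>h \<in> G i\<close>]] by blast
  next
    case (add a b)
    then show ?case using homogeneous by (auto simp: r_distr span_add G_carrier span_carrier)
  qed (use homogeneous in \<open>simp add: G_carrier\<close>)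
next
  case (add a1 a2)
  then show ?case using assms(2) by (auto simp: l_distr span_add span_carrier)
qed (use assms in \<open>simp add: span_carrier\<close>)

lemma comp_minus:
  assumes "a \<in> carrier R" shows "comp (\<ominus> a) k = \<ominus> comp a k"
proof -
  have "comp a k \<oplus> comp (\<ominus> a) k = comp (a \<oplus> \<ominus> a) k" using assms comp_add by auto
  also have "\<dots> = \<zero>" using assms by (simp add: r_neg)
  finally show ?thesis using assms
    by (metis a_inv_closed add.m_comm comp_carrier minus_equality)
qed

lemma span_minus: "a \<in> span S \<Longrightarrow> \<ominus> a \<in> span S"
  by (auto simp: span_def comp_minus) (metis minus_zero)

lemma veronese_span: "veronese R G d = span {k. int d dvd k}"
proof
  show "veronese R G d \<subseteq> span {k. int d dvd k}"
    by (auto simp: veronese_def intro!: span_finsum intro: G_subset_span[of _ "{k. int d dvd k}", simplified])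
  show "span {k. int d dvd k} \<subseteq> veronese R G d"
  proof
    fix b assume b: "b \<in> span {k. int d dvd k}"
    then have "b = (\<Oplus>i\<in>{i. comp b i \<noteq> \<zero>}. comp b i)" using finsum_comp by auto
    then show "b \<in> veronese R G d"
      using b comp_G[of b] finite_supp[of b] unfolding veronese_def span_def by blast
  qed
qed

text \<open>The degree 0 component \<open>e\<close> of \<open>\<one>\<close> fixes every homogeneous
  \<open>h\<close>, by comparing components of the degree of \<open>h\<close> in
  \<open>h \<otimes> \<one> = h\<close>; hence \<open>e\<close> is an identity element.\<close>

lemma one_G0: "\<one> \<in> G 0"
proof -
  define e where "e = comp \<one> 0"
  have e: "e \<in> G 0" using comp_G[of \<one> 0] by (simp add: e_def)
  have "e \<otimes> b = b" if "b \<in> carrier R" for b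
    using that
  proof (induction rule: homogeneous_induct)
    case (homogeneous i h)
    have "comp (h \<otimes> \<one>) i = h \<otimes> comp \<one> (i - i)" by (rule comp_mult_homogeneous) (use homogeneous in auto)
    then show ?case using homogeneous comp_homogeneous[OF homogeneous] e
      by (simp add: e_def m_comm G_carrier)
  qed (use e in \<open>auto simp: r_distr G_carrier\<close>)
  from this[of \<one>] show ?thesis using e by (simp add: G_carrier)
qed

lemma span_subring:
  assumes "0 \<in> S" "\<And>s t. s \<in> S \<Longrightarrow> t \<in> S \<Longrightarrow> s + t \<in> S"
  shows "subring (span S) R"
proof (rule subringI)
  show "\<one> \<in> span S" using G_subset_span[OF assms(1) one_G0] .
qed (use assms in \<open>auto simp: span_minus span_add intro: span_mult\<close>)

lemma veronese_subring: "subring (veronese R G d) R"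
  unfolding veronese_span by (rule span_subring) auto

lemma G_minus: "h \<in> G k \<Longrightarrow> \<ominus> h \<in> G k"
  using G_additive_subgroup[of k] by (simp add: additive_subgroup.a_inv_closed)

lemma G_power: "h \<in> G k \<Longrightarrow> h [^] n \<in> G (int n * k)"
proof (induction n)
  case (Suc n)
  then show ?case using G_mult[of "h [^] n" "int n * k" h k] by (simp add: algebra_simps)
qed (simp add: one_G0)

lemma G_disjoint: "h \<in> G i \<Longrightarrow> h \<in> G j \<Longrightarrow> h \<noteq> \<zero> \<Longrightarrow> i = j"
  using comp_homogeneous by metis

lemma nonzero_comp: "b \<in> carrier R \<Longrightarrow> b \<noteq> \<zero> \<Longrightarrow> \<exists>i. comp b i \<noteq> \<zero>"
proof (rule ccontr)
  assume b: "b \<in> carrier R" "b \<noteq> \<zero>" and "\<nexists>i. comp b i \<noteq> \<zero>"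
  then have "{i. comp b i \<noteq> \<zero>} = {}" by simp
  then show False using finsum_comp[OF b(1)] b(2) by (metis finsum_empty)
qed

text \<open>Reduces divisibility of an inhomogeneous value of \<open>D\<close> to its components,
  the form to which the height-one criterion for homogeneous fractions applies.\<close>

lemma homogeneous_divides:
  assumes x: "x \<in> G i" and b: "b \<in> carrier R"
    and dvd: "\<And>k. \<exists>r\<in>carrier R. comp b k = x \<otimes> r"
  shows "\<exists>r\<in>carrier R. b = x \<otimes> r"
proof -
  obtain g where g: "\<And>k. g k \<in> carrier R" "\<And>k. comp b k = x \<otimes> g k" using dvd by metis
  let ?F = "{i. comp b i \<noteq> \<zero>}"
  have "b = (\<Oplus>i\<in>?F. x \<otimes> g i)" using finsum_comp[OF b] g(2) by simp
  also have "\<dots> = x \<otimes> (\<Oplus>i\<in>?F. g i)" using x g finite_supp[OF b] by (intro finsum_rdistr[symmetric]) auto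
  finally show ?thesis using g by (auto intro!: finsum_closed)
qed

end

section \<open>Integral dependence and the Krull intersection argument\<close>

text \<open>\<open>homogeneous_form \<alpha> \<beta> k z\<close> says that \<open>z\<close> is a combination of the monomials
  \<open>\<alpha>\<^sup>i \<beta>\<^sup>k\<^sup>-\<^sup>i\<close> with \<open>i < k\<close>, so that \<open>\<alpha>\<^sup>k = z\<close> is an equation of integral
  dependence for \<open>\<alpha> / \<beta>\<close>.\<close>

inductive (in ring) homogeneous_form :: "'a \<Rightarrow> 'a \<Rightarrow> nat \<Rightarrow> 'a \<Rightarrow> bool" for \<alpha> \<beta> where
  zero: "homogeneous_form \<alpha> \<beta> 0 \<zero>"
| Suc: "homogeneous_form \<alpha> \<beta> k z \<Longrightarrow> c \<in> carrier R \<Longrightarrow>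
          homogeneous_form \<alpha> \<beta> (Suc k) (\<beta> \<otimes> (c \<otimes> \<alpha> [^] k \<oplus> z))"

lemma (in ring) homogeneous_form_carrier:
  assumes "homogeneous_form \<alpha> \<beta> k z" "\<alpha> \<in> carrier R" "\<beta> \<in> carrier R"
  shows "z \<in> carrier R"
  using assms(1) by induction (use assms in auto)

lemma (in cring) homogeneous_form_ideal:
  assumes "homogeneous_form \<alpha> \<beta> k z" "\<alpha> \<in> carrier R" "\<beta> \<in> P" "ideal P R"
  shows "z \<in> P"
proof -
  have b: "\<beta> \<in> carrier R" using ideal.Icarr assms by metis
  show ?thesis using assms(1)
  proof induction
    case zero
    then show ?case using assms(4) by (simp add: additive_subgroup.zero_closed ideal.axioms(1))
  next
    case (Suc k z c)
    then show ?case
      using assms(2,3) homogeneous_form_carrier[OF Suc(1)] b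
      by (intro ideal.I_r_closed[OF assms(4)]) auto
  qed
qed

lemma (in domain) mult_cancelD:
  "a \<otimes> x = a \<otimes> y \<Longrightarrow> a \<noteq> \<zero> \<Longrightarrow> a \<in> carrier R \<Longrightarrow> x \<in> carrier R \<Longrightarrow> y \<in> carrier R \<Longrightarrow> x = y"
  using m_lcancel by blast

text \<open>Here \<open>s n\<close> is (\<alpha> / \<beta>)^n times \<open>s 0\<close>, so
  \<open>s 0\<close> is a common denominator of all powers of \<alpha> / \<beta>. Noetherianity
  writes some \<open>s n\<close> as a combination of its predecessors; multiplying by \<beta>^n and
  cancelling \<open>s 0\<close> gives an equation of integral dependence.\<close>

lemma (in domain) geometric_sequence_integral:
  assumes N: "noetherian_in (carrier R)"
    and ab: "\<alpha> \<in> carrier R" "\<beta> \<in> carrier R"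
    and s: "\<And>n. s n \<in> carrier R" "\<And>n. s n \<noteq> \<zero>" "\<And>n. \<alpha> \<otimes> s n = \<beta> \<otimes> s (Suc n)"
  shows "\<exists>k. homogeneous_form \<alpha> \<beta> k (\<alpha> [^] k)"
proof -
  \<comment> \<open>\<open>I n\<close> is the ideal generated by the first \<open>n\<close> terms
    \<open>s 0, ..., s (n - 1)\<close>.\<close>
  define I where "I = rec_nat {\<zero>} (\<lambda>n J. {c \<otimes> s n \<oplus> z | c z. c \<in> carrier R \<and> z \<in> J})"
  have I0: "I 0 = {\<zero>}" and IS: "I (Suc n) = {c \<otimes> s n \<oplus> z | c z. c \<in> carrier R \<and> z \<in> I n}" for n
    by (simp_all add: I_def)
  have Ic: "z \<in> carrier R" if "z \<in> I n" for z n
    using that by (induction n arbitrary: z) (auto simp: I0 IS s)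
  have Iz: "\<zero> \<in> I n" for n
  proof (induction n)
    case (Suc n)
    have "\<zero> = \<zero> \<otimes> s n \<oplus> \<zero>" using s by simp
    then show ?case unfolding IS using Suc by blast
  qed (simp add: I0)
  have Iadd: "y \<oplus> z \<in> I n" if "y \<in> I n" "z \<in> I n" for y z n
    using that
  proof (induction n arbitrary: y z)
    case (Suc n)
    then obtain c y' d z' where *: "y = c \<otimes> s n \<oplus> y'" "z = d \<otimes> s n \<oplus> z'"
      "c \<in> carrier R" "d \<in> carrier R" "y' \<in> I n" "z' \<in> I n" unfolding IS by blast
    then have "y \<oplus> z = (c \<oplus> d) \<otimes> s n \<oplus> (y' \<oplus> z')"
      using s Ic[of y'] Ic[of z'] by (simp add: l_distr a_ac)
    then show ?case unfolding IS using * Suc.IH by blast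
  qed (simp add: I0)
  have Imult: "a \<otimes> z \<in> I n" if "z \<in> I n" "a \<in> carrier R" for a z n
    using that
  proof (induction n arbitrary: z)
    case (Suc n)
    then obtain d z' where *: "z = d \<otimes> s n \<oplus> z'" "d \<in> carrier R" "z' \<in> I n" unfolding IS by blast
    then have "a \<otimes> z = (a \<otimes> d) \<otimes> s n \<oplus> (a \<otimes> z')"
      using s Ic[of z'] Suc.prems by (simp add: r_distr m_assoc)
    then show ?case unfolding IS using * Suc by blast
  qed (simp add: I0)
  have Imono: "I n \<subseteq> I (Suc n)" for n
  proof
    fix z assume z: "z \<in> I n"
    then have "z = \<zero> \<otimes> s n \<oplus> z" using s Ic by simp
    then show "z \<in> I (Suc n)" unfolding IS using z by blast
  qed
  obtain n where n: "\<And>m. m \<ge> n \<Longrightarrow> I m = I n"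
    by (rule noetherian_inE[OF N, of I]) (use Ic Iz Iadd Imult Imono in \<open>auto simp: ideal_in_def\<close>)
  have "s n = \<one> \<otimes> s n \<oplus> \<zero>" using s by simp
  then have "s n \<in> I (Suc n)" unfolding IS using Iz by blast
  moreover have "I (Suc n) = I n" by (rule n) simp
  ultimately have sn: "s n \<in> I n" by simp
  have pow: "\<beta> [^] i \<otimes> s i = \<alpha> [^] i \<otimes> s 0" for i
  proof (induction i)
    case (Suc i)
    have "\<beta> [^] Suc i \<otimes> s (Suc i) = \<beta> [^] i \<otimes> (\<beta> \<otimes> s (Suc i))" using ab s by (simp add: m_assoc)
    also have "\<dots> = \<alpha> \<otimes> (\<beta> [^] i \<otimes> s i)" using ab s by (simp add: s(3)[symmetric] m_lcomm)
    also have "\<dots> = \<alpha> [^] Suc i \<otimes> s 0" using ab s by (simp add: Suc m_ac)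
    finally show ?case .
  qed (simp add: s)
  \<comment> \<open>For \<open>i < k\<close>, multiplication by \<beta>^k turns \<open>s i\<close>
    into \<beta>^(k-i) \<alpha>^i \<open>s 0\<close>, so the coefficient \<open>w\<close> has
    exactly the shape of \<open>homogeneous_form\<close>.\<close>
  have "\<exists>w. homogeneous_form \<alpha> \<beta> k w \<and> \<beta> [^] k \<otimes> z = w \<otimes> s 0" if "z \<in> I k" for k z
    using that
  proof (induction k arbitrary: z)
    case 0
    then show ?case using homogeneous_form.zero[of \<alpha> \<beta>] s by (intro exI[of _ \<zero>]) (auto simp: I0)
  next
    case (Suc k)
    then obtain c z' where *: "z = c \<otimes> s k \<oplus> z'" "c \<in> carrier R" "z' \<in> I k" unfolding IS by blast
    with Suc.IH obtain w where w: "homogeneous_form \<alpha> \<beta> k w" "\<beta> [^] k \<otimes> z' = w \<otimes> s 0" by blast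
    have wc: "w \<in> carrier R" using homogeneous_form_carrier w ab by blast
    have "\<beta> [^] Suc k \<otimes> z = \<beta> \<otimes> (c \<otimes> (\<beta> [^] k \<otimes> s k) \<oplus> \<beta> [^] k \<otimes> z')"
    proof -
      have "\<beta> [^] k \<in> carrier R" "s k \<in> carrier R" "z' \<in> carrier R" using ab s Ic * by auto
      then show ?thesis unfolding *(1) nat_pow_Suc using ab *(2) by algebra
    qed
    also have "\<dots> = \<beta> \<otimes> (c \<otimes> (\<alpha> [^] k \<otimes> s 0) \<oplus> w \<otimes> s 0)" using pow w by simp
    also have "\<dots> = \<beta> \<otimes> (c \<otimes> \<alpha> [^] k \<oplus> w) \<otimes> s 0"
      using ab s * wc by (simp add: l_distr m_assoc)
    finally show ?case using homogeneous_form.Suc[OF w(1) *(2)] by blast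
  qed
  from this[OF sn] obtain w where w: "homogeneous_form \<alpha> \<beta> n w" "\<beta> [^] n \<otimes> s n = w \<otimes> s 0" by blast
  have wc: "w \<in> carrier R" using homogeneous_form_carrier w ab by blast
  have "s 0 \<otimes> \<alpha> [^] n = s 0 \<otimes> w" using w pow[of n] s ab wc by (simp add: m_comm)
  then have "\<alpha> [^] n = w" using mult_cancelD s ab wc by (meson nat_pow_closed)
  then show ?thesis using w by blast
qed

section \<open>Arithmetic of fractions and integrality of a quotient\<close>

context domain
begin

lemma pow_nonzero: "x \<in> carrier R \<Longrightarrow> x \<noteq> \<zero> \<Longrightarrow> x [^] (n::nat) \<noteq> \<zero>"
  by (induction n) (auto simp: integral_iff)

lemma fraction_eq:
  assumes "a \<otimes> d = c \<otimes> b" "a \<in> carrier R" "b \<in> carrier R" "b \<noteq> \<zero>" "c \<in> carrier R" "d \<in> carrier R" "d \<noteq> \<zero>"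
  shows "fraction R a b = fraction R c d"
proof -
  have "a \<otimes> y = x \<otimes> b \<longleftrightarrow> c \<otimes> y = x \<otimes> d" if "x \<in> carrier R" "y \<in> carrier R" for x y
  proof -
    have "a \<otimes> y = x \<otimes> b \<longleftrightarrow> d \<otimes> (a \<otimes> y) = d \<otimes> (x \<otimes> b)"
      using assms that m_lcancel by simp
    also have "d \<otimes> (a \<otimes> y) = (c \<otimes> b) \<otimes> y" using assms that by (simp add: m_ac flip: assms(1))
    also have "(c \<otimes> b) \<otimes> y = d \<otimes> (x \<otimes> b) \<longleftrightarrow> b \<otimes> (c \<otimes> y) = b \<otimes> (x \<otimes> d)"
      using assms that by (simp add: m_ac)
    also have "\<dots> \<longleftrightarrow> c \<otimes> y = x \<otimes> d" using assms that m_lcancel by simp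
    finally show ?thesis .
  qed
  then show ?thesis unfolding fraction_def by auto
qed

lemma fraction_mem:
  "(x, y) \<in> fraction R a b \<longleftrightarrow> x \<in> carrier R \<and> y \<in> carrier R \<and> y \<noteq> \<zero> \<and> a \<otimes> y = x \<otimes> b"
  by (auto simp: fraction_def)

lemma fraction_eqD:
  assumes "fraction R a b = fraction R c d" "c \<in> carrier R" "d \<in> carrier R" "d \<noteq> \<zero>"
  shows "a \<otimes> d = c \<otimes> b"
proof -
  have "(c, d) \<in> fraction R a b" unfolding assms(1) fraction_mem using assms by simp
  then show ?thesis by (simp add: fraction_mem)
qed

text \<open>Operations on fractions are unions over all representatives; once every pair gives the
  same class, the union is that class.\<close>

lemma UN_UN_eqI:
  assumes "\<And>x y. x \<in> U \<Longrightarrow> y \<in> V \<Longrightarrow> f x y = Z" "u \<in> U" "v \<in> V"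
  shows "(\<Union>x\<in>U. \<Union>y\<in>V. f x y) = Z"
  using assms by blast

lemma fraction_mult_fraction:
  assumes "a \<in> carrier R" "b \<in> carrier R" "b \<noteq> \<zero>" "c \<in> carrier R" "d \<in> carrier R" "d \<noteq> \<zero>"
  shows "fraction_mult R (fraction R a b) (fraction R c d) = fraction R (a \<otimes> c) (b \<otimes> d)"
proof -
  have "fraction R (x \<otimes> z) (y \<otimes> w) = fraction R (a \<otimes> c) (b \<otimes> d)"
    if "(x, y) \<in> fraction R a b" "(z, w) \<in> fraction R c d" for x y z w
  proof (rule fraction_eq)
    have *: "a \<otimes> y = x \<otimes> b" "c \<otimes> w = z \<otimes> d" "x \<in> carrier R" "y \<in> carrier R" "z \<in> carrier R" "w \<in> carrier R"
      using that by (auto simp: fraction_mem)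
    have "x \<otimes> z \<otimes> (b \<otimes> d) = (x \<otimes> b) \<otimes> (z \<otimes> d)" using *(3-) assms by (simp add: m_ac)
    also have "\<dots> = (a \<otimes> y) \<otimes> (c \<otimes> w)" using * by simp
    also have "\<dots> = a \<otimes> c \<otimes> (y \<otimes> w)" using *(3-) assms by (simp add: m_ac)
    finally show "x \<otimes> z \<otimes> (b \<otimes> d) = a \<otimes> c \<otimes> (y \<otimes> w)" .
  qed (use that assms in \<open>auto simp: fraction_mem integral_iff\<close>)
  note * = this
  show ?thesis
    unfolding fraction_mult_def
  proof (rule UN_UN_eqI)
    show "(a, b) \<in> fraction R a b" "(c, d) \<in> fraction R c d"
      using assms by (auto simp: fraction_mem)
  qed (rule *, simp_all)
qed

lemma fraction_add_fraction:
  assumes "a \<in> carrier R" "b \<in> carrier R" "b \<noteq> \<zero>" "c \<in> carrier R" "d \<in> carrier R" "d \<noteq> \<zero>"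
  shows "fraction_add R (fraction R a b) (fraction R c d) = fraction R (a \<otimes> d \<oplus> c \<otimes> b) (b \<otimes> d)"
proof -
  have "fraction R (x \<otimes> w \<oplus> z \<otimes> y) (y \<otimes> w) = fraction R (a \<otimes> d \<oplus> c \<otimes> b) (b \<otimes> d)"
    if "(x, y) \<in> fraction R a b" "(z, w) \<in> fraction R c d" for x y z w
  proof (rule fraction_eq)
    have *: "a \<otimes> y = x \<otimes> b" "c \<otimes> w = z \<otimes> d" "x \<in> carrier R" "y \<in> carrier R" "z \<in> carrier R" "w \<in> carrier R"
      using that by (auto simp: fraction_mem)
    have "(x \<otimes> w \<oplus> z \<otimes> y) \<otimes> (b \<otimes> d) = (x \<otimes> b) \<otimes> (w \<otimes> d) \<oplus> (z \<otimes> d) \<otimes> (y \<otimes> b)"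
      using *(3-) assms by (simp add: m_ac l_distr r_distr)
    also have "\<dots> = (a \<otimes> y) \<otimes> (w \<otimes> d) \<oplus> (c \<otimes> w) \<otimes> (y \<otimes> b)" using * by simp
    also have "\<dots> = (a \<otimes> d \<oplus> c \<otimes> b) \<otimes> (y \<otimes> w)"
      using *(3-) assms by (simp add: m_ac l_distr r_distr)
    finally show "(x \<otimes> w \<oplus> z \<otimes> y) \<otimes> (b \<otimes> d) = (a \<otimes> d \<oplus> c \<otimes> b) \<otimes> (y \<otimes> w)" .
  qed (use that assms in \<open>auto simp: fraction_mem integral_iff\<close>)
  note * = this
  show ?thesis
    unfolding fraction_add_def
  proof (rule UN_UN_eqI)
    show "(a, b) \<in> fraction R a b" "(c, d) \<in> fraction R c d"
      using assms by (auto simp: fraction_mem)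
  qed (rule *, simp_all)
qed

lemma fraction_field_sel:
  "monoid.mult (fraction_field R) = fraction_mult R"
  "one (fraction_field R) = fraction R \<one> \<one>"
  "zero (fraction_field R) = fraction R \<zero> \<one>"
  "add (fraction_field R) = fraction_add R"
  by (simp_all add: fraction_field_def)

lemma fraction_cases:
  assumes "x \<in> carrier (fraction_field R)"
  obtains a b where "x = fraction R a b" "a \<in> carrier R" "b \<in> carrier R" "b \<noteq> \<zero>"
  using assms by (auto simp: fraction_field_def)

lemma fraction_closed:
  "a \<in> carrier R \<Longrightarrow> b \<in> carrier R \<Longrightarrow> b \<noteq> \<zero> \<Longrightarrow> fraction R a b \<in> carrier (fraction_field R)"
  by (auto simp: fraction_field_def)

lemmas fraction_simps = fraction_field_sel fraction_mult_fraction fraction_add_fraction integral_iff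

lemma fraction_field_ring: "ring (fraction_field R)"
proof (rule ringI)
  show "abelian_group (fraction_field R)"
  proof (rule abelian_groupI)
    fix x y z assume "x \<in> carrier (fraction_field R)" "y \<in> carrier (fraction_field R)" "z \<in> carrier (fraction_field R)"
    then show "x \<oplus>\<^bsub>fraction_field R\<^esub> y \<oplus>\<^bsub>fraction_field R\<^esub> z = x \<oplus>\<^bsub>fraction_field R\<^esub> (y \<oplus>\<^bsub>fraction_field R\<^esub> z)"
      by (elim fraction_cases) (simp add: fraction_simps l_distr r_distr m_ac a_ac)
  next
    fix x assume "x \<in> carrier (fraction_field R)"
    then obtain a b where x: "x = fraction R a b" "a \<in> carrier R" "b \<in> carrier R" "b \<noteq> \<zero>"
      by (rule fraction_cases)
    then have "fraction R (\<ominus> a) b \<oplus>\<^bsub>fraction_field R\<^esub> x = \<zero>\<^bsub>fraction_field R\<^esub>"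
      by (simp add: fraction_simps l_minus l_neg) (rule fraction_eq, auto simp: integral_iff)
    then show "\<exists>y\<in>carrier (fraction_field R). y \<oplus>\<^bsub>fraction_field R\<^esub> x = \<zero>\<^bsub>fraction_field R\<^esub>"
      using x by (intro bexI[of _ "fraction R (\<ominus> a) b"]) (auto intro: fraction_closed)
  qed (auto elim!: fraction_cases simp: fraction_simps fraction_closed m_comm a_comm)
  show "monoid (fraction_field R)"
    by (rule monoidI) (auto elim!: fraction_cases simp: fraction_simps fraction_closed m_assoc)
  fix x y z assume "x \<in> carrier (fraction_field R)" "y \<in> carrier (fraction_field R)" "z \<in> carrier (fraction_field R)"
  then obtain a b c d e f where *: "x = fraction R a b" "a \<in> carrier R" "b \<in> carrier R" "b \<noteq> \<zero>"
    "y = fraction R c d" "c \<in> carrier R" "d \<in> carrier R" "d \<noteq> \<zero>"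
    "z = fraction R e f" "e \<in> carrier R" "f \<in> carrier R" "f \<noteq> \<zero>"
    by (elim fraction_cases) blast
  from *(2-4,6-8,10-) show "(x \<oplus>\<^bsub>fraction_field R\<^esub> y) \<otimes>\<^bsub>fraction_field R\<^esub> z =
      x \<otimes>\<^bsub>fraction_field R\<^esub> z \<oplus>\<^bsub>fraction_field R\<^esub> y \<otimes>\<^bsub>fraction_field R\<^esub> z"
    unfolding *(1,5,9)
    by (simp add: fraction_simps) (rule fraction_eq, auto simp: integral_iff l_distr r_distr m_ac)
  from *(2-4,6-8,10-) show "z \<otimes>\<^bsub>fraction_field R\<^esub> (x \<oplus>\<^bsub>fraction_field R\<^esub> y) =
      z \<otimes>\<^bsub>fraction_field R\<^esub> x \<oplus>\<^bsub>fraction_field R\<^esub> z \<otimes>\<^bsub>fraction_field R\<^esub> y"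
    unfolding *(1,5,9)
    by (simp add: fraction_simps) (rule fraction_eq, auto simp: integral_iff l_distr r_distr m_ac)
qed

lemma fraction_pow:
  assumes "a \<in> carrier R" "b \<in> carrier R" "b \<noteq> \<zero>"
  shows "fraction R a b [^]\<^bsub>fraction_field R\<^esub> (n::nat) = fraction R (a [^] n) (b [^] n)"
proof -
  interpret F: ring "fraction_field R" by (rule fraction_field_ring)
  show ?thesis
  proof (induction n)
    case (Suc n)
    have "b [^] n \<noteq> \<zero>" using assms pow_nonzero by blast
    then show ?case using assms Suc by (simp add: fraction_simps)
  qed (simp add: fraction_field_sel)
qed

text \<open>The list \<open>p\<close> carries the coefficients \<open>c\<close> with the newest
  first, so it represents z / \<beta>^k as a polynomial of degree below \<open>k\<close> in \<alpha>
  / \<beta>. Its exact length is what later puts the leading coefficient \<open>\<one>\<close> in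
  degree \<open>k\<close>.\<close>

lemma homogeneous_form_eval:
  assumes "homogeneous_form \<alpha> \<beta> k z" "\<alpha> \<in> carrier R" "\<beta> \<in> carrier R" "\<beta> \<noteq> \<zero>"
  shows "\<exists>p. set p \<subseteq> carrier R \<and> length p = k \<and>
     ring.eval (fraction_field R) (map (to_fractions R) p) (fraction R \<alpha> \<beta>) = fraction R z (\<beta> [^] k)"
  using assms(1)
proof induction
  interpret F: ring "fraction_field R" by (rule fraction_field_ring)
  {
    case zero
    show ?case by (simp add: fraction_field_sel)
  next
    case (Suc k z c)
    then obtain p where p: "set p \<subseteq> carrier R" "length p = k"
      "F.eval (map (to_fractions R) p) (fraction R \<alpha> \<beta>) = fraction R z (\<beta> [^] k)" by blast
    have z: "z \<in> carrier R" using homogeneous_form_carrier Suc.hyps(1) assms by blast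
    have b: "\<beta> [^] n \<noteq> \<zero>" for n :: nat using assms pow_nonzero by blast
    have "F.eval (map (to_fractions R) (c # p)) (fraction R \<alpha> \<beta>) =
        fraction R (c \<otimes> \<alpha> [^] k \<otimes> \<beta> [^] k \<oplus> z \<otimes> \<beta> [^] k) (\<beta> [^] k \<otimes> \<beta> [^] k)"
      using p assms Suc.hyps z b by (simp add: to_fractions_def fraction_pow fraction_simps)
    also have "\<dots> = fraction R (\<beta> \<otimes> (c \<otimes> \<alpha> [^] k \<oplus> z)) (\<beta> [^] Suc k)"
    proof (rule fraction_eq)
      have *: "\<alpha> [^] k \<in> carrier R" "\<beta> [^] k \<in> carrier R" using assms by auto
      show "(c \<otimes> \<alpha> [^] k \<otimes> \<beta> [^] k \<oplus> z \<otimes> \<beta> [^] k) \<otimes> \<beta> [^] Suc k =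
          \<beta> \<otimes> (c \<otimes> \<alpha> [^] k \<oplus> z) \<otimes> (\<beta> [^] k \<otimes> \<beta> [^] k)"
        unfolding nat_pow_Suc using * assms Suc.hyps z by algebra
    qed (use assms Suc.hyps z b b[of "Suc k"] in \<open>auto simp: integral_iff simp del: nat_pow_Suc\<close>)
    finally show ?case using p Suc.hyps by (intro exI[of _ "c # p"]) auto
  }
qed

lemma normal_divides:
  assumes normal: "normal_domain R" and dep: "homogeneous_form \<alpha> \<beta> k (\<alpha> [^] k)"
    and ab: "\<alpha> \<in> carrier R" "\<beta> \<in> carrier R" "\<beta> \<noteq> \<zero>"
  shows "\<exists>r\<in>carrier R. \<alpha> = \<beta> \<otimes> r"
proof -
  interpret F: ring "fraction_field R" by (rule fraction_field_ring)
  obtain p where p: "set p \<subseteq> carrier R" "length p = k"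
    "F.eval (map (to_fractions R) p) (fraction R \<alpha> \<beta>) = fraction R (\<alpha> [^] k) (\<beta> [^] k)"
    using homogeneous_form_eval[OF dep ab] by blast
  have b: "\<beta> [^] n \<noteq> \<zero>" for n :: nat using ab pow_nonzero by blast
  \<comment> \<open>\<open>?q\<close> is X^k minus the polynomial of \<open>p\<close>: monic by its
    head, and zero at \<alpha> / \<beta> because \<open>p\<close> evaluates to (\<alpha> /
    \<beta>)^k there.\<close>
  let ?q = "to_fractions R \<one> # map (to_fractions R) (map (\<lambda>c. \<ominus> c) p)"
  have neg: "F.eval (map (to_fractions R) (map (\<lambda>c. \<ominus> c) q)) (fraction R \<alpha> \<beta>) =
      \<ominus>\<^bsub>fraction_field R\<^esub> (F.eval (map (to_fractions R) q) (fraction R \<alpha> \<beta>))"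
    if "set q \<subseteq> carrier R" for q
    using that
  proof (induction q)
    case (Cons c q)
    have c: "to_fractions R c \<in> carrier (fraction_field R)"
      using Cons.prems by (auto simp: to_fractions_def fraction_closed)
    have x: "fraction R \<alpha> \<beta> \<in> carrier (fraction_field R)" using ab fraction_closed by blast
    have "to_fractions R (\<ominus> c) \<oplus>\<^bsub>fraction_field R\<^esub> to_fractions R c = \<zero>\<^bsub>fraction_field R\<^esub>"
      using Cons.prems by (simp add: to_fractions_def fraction_simps l_neg)
    then have mc: "to_fractions R (\<ominus> c) = \<ominus>\<^bsub>fraction_field R\<^esub> to_fractions R c"
      using Cons.prems by (intro F.minus_equality[symmetric]) (auto simp: to_fractions_def fraction_closed)
    have "set (map (to_fractions R) q) \<subseteq> carrier (fraction_field R)"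
      using Cons.prems by (auto simp: to_fractions_def fraction_closed)
    then have e: "F.eval (map (to_fractions R) q) (fraction R \<alpha> \<beta>) \<in> carrier (fraction_field R)"
      using F.eval_in_carrier x by blast
    show ?case using Cons e c x mc by (simp add: F.l_minus F.minus_add)
  qed (simp add: F.minus_zero)
  have fk: "fraction R (\<alpha> [^] k) (\<beta> [^] k) \<in> carrier (fraction_field R)"
    using ab b by (intro fraction_closed) auto
  have "F.eval ?q (fraction R \<alpha> \<beta>) = \<zero>\<^bsub>fraction_field R\<^esub>"
  proof -
    have one: "to_fractions R \<one> = \<one>\<^bsub>fraction_field R\<^esub>" by (simp add: to_fractions_def fraction_field_sel)
    have "F.eval ?q (fraction R \<alpha> \<beta>) =
        fraction R (\<alpha> [^] k) (\<beta> [^] k) \<oplus>\<^bsub>fraction_field R\<^esub> \<ominus>\<^bsub>fraction_field R\<^esub> (fraction R (\<alpha> [^] k) (\<beta> [^] k))"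
      using neg[OF p(1)] p ab fk by (simp add: one fraction_pow)
    then show ?thesis using fk by (simp add: F.r_neg)
  qed
  moreover have "to_fractions R \<one> \<noteq> \<zero>\<^bsub>fraction_field R\<^esub>"
    using fraction_eqD[of \<one> \<one> \<zero> \<one>] by (auto simp: to_fractions_def fraction_field_sel)
  moreover have "set ?q \<subseteq> to_fractions R ` carrier R" using p(1) by auto
  moreover have "to_fractions R \<one> = \<one>\<^bsub>fraction_field R\<^esub>" by (simp add: to_fractions_def fraction_field_sel)
  ultimately have "integral_over (fraction_field R) (to_fractions R ` carrier R) (fraction R \<alpha> \<beta>)"
    unfolding integral_over_def polynomial_def by (intro exI[of _ ?q]) auto
  then have "fraction R \<alpha> \<beta> \<in> to_fractions R ` carrier R"
    using normal fraction_closed[OF ab] by (auto simp: normal_domain_def)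
  then obtain r where "r \<in> carrier R" "fraction R \<alpha> \<beta> = fraction R r \<one>" by (auto simp: to_fractions_def)
  then have "\<alpha> \<otimes> \<one> = r \<otimes> \<beta>" by (intro fraction_eqD) auto
  then show ?thesis using ab \<open>r \<in> carrier R\<close> by (intro bexI[of _ r]) (simp_all add: m_comm)
qed

end

section \<open>Homogeneous ideals\<close>

lemma (in cring) primeideal_one_notin:
  assumes "primeideal P R" shows "\<one> \<notin> P"
  using primeideal.I_notcarr[OF assms] ideal.one_imp_carrier[OF primeideal.axioms(1)[OF assms]] by auto

lemma (in cring) primeideal_pow_notin:
  assumes P: "primeideal P R" and w: "w \<in> carrier R" "w \<notin> P"
  shows "w [^] (n::nat) \<notin> P"
proof (induction n)
  case 0
  then show ?case using primeideal_one_notin[OF P] by simp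
next
  case (Suc n)
  then show ?case using primeideal.I_prime[OF P, of "w [^] n" w] w by auto
qed

lemma (in ring) ideal_finsum:
  assumes "ideal P R" "finite I" "\<And>i. i \<in> I \<Longrightarrow> f i \<in> P"
  shows "(\<Oplus>i\<in>I. f i) \<in> P"
  using assms(2,3)
proof (induction I rule: finite_induct)
  case empty
  then show ?case using assms(1) by (simp add: additive_subgroup.zero_closed ideal.axioms(1))
next
  case (insert x F)
  have "(\<Oplus>i\<in>insert x F. f i) = f x \<oplus> (\<Oplus>i\<in>F. f i)"
    using insert ideal.Icarr[OF assms(1)] by (intro finsum_insert) auto
  then show ?case
    using insert assms(1) by (simp add: additive_subgroup.a_closed ideal.axioms(1))
qed

context graded_domain
begin

lemma homogeneous_quotient:
  assumes "x \<in> G i" "y \<in> G j" "r \<in> carrier R" "y = x \<otimes> r"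
  shows "\<exists>r'\<in>G (j - i). y = x \<otimes> r'"
proof
  show "comp r (j - i) \<in> G (j - i)" using comp_G assms by blast
  have "y = comp (x \<otimes> r) j" using comp_homogeneous[OF assms(2)] assms(4) by simp
  then show "y = x \<otimes> comp r (j - i)" using comp_mult_homogeneous[OF assms(1,3)] by simp
qed

lemma ideal_comps:
  assumes "ideal P R" "b \<in> carrier R" "\<And>k. comp b k \<in> P"
  shows "b \<in> P"
proof -
  have "(\<Oplus>i\<in>{i. comp b i \<noteq> \<zero>}. comp b i) \<in> P"
    using assms finite_supp by (intro ideal_finsum) auto
  then show ?thesis using finsum_comp[OF assms(2)] by simp
qed

text \<open>The sign of \<sigma> lets one statement serve both ends: \<open>1\<close> singles out
  the highest and \<open>- 1\<close> the lowest degree whose component lies outside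
  \<open>P\<close>. Everything beyond that degree belongs to \<open>P\<close> and is collected in
  \<open>q\<close>.\<close>

lemma leading_decomposition:
  fixes \<sigma> :: int
  assumes P: "ideal P R" and a: "a \<in> carrier R" "a \<notin> P" and \<sigma>: "\<sigma> \<noteq> 0"
  obtains i h l q where "h \<in> G i" "h \<notin> P" "l \<in> span {k. \<sigma> * k < \<sigma> * i}" "q \<in> P" "a = h \<oplus> l \<oplus> q"
proof -
  let ?S = "{k. comp a k \<noteq> \<zero>}"
  let ?T = "{k. comp a k \<notin> P}"
  have "\<zero> \<in> P" using P by (simp add: additive_subgroup.zero_closed ideal.axioms(1))
  then have TS: "?T \<subseteq> ?S" by auto
  have fin: "finite ?S" using finite_supp a by auto
  have "?T \<noteq> {}" using ideal_comps[OF P a(1)] a(2) by auto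
  then have "finite ((\<lambda>k. \<sigma> * k) ` ?T)" "(\<lambda>k. \<sigma> * k) ` ?T \<noteq> {}"
    using finite_subset[OF TS fin] by auto
  note M = Max_in[OF this] Max_ge[OF this(1)]
  obtain i where i': "i \<in> ?T" "Max ((\<lambda>k. \<sigma> * k) ` ?T) = \<sigma> * i" using M(1) by (rule imageE) simp
  have i: "i \<in> ?T" "\<And>k. k \<in> ?T \<Longrightarrow> \<sigma> * k \<le> \<sigma> * i"
    using i'(1) M(2)[OF imageI] unfolding i'(2) by blast+
  define l where "l = (\<Oplus>k\<in>?S \<inter> {k. \<sigma> * k < \<sigma> * i}. comp a k)"
  define q where "q = (\<Oplus>k\<in>?S \<inter> {k. \<sigma> * k > \<sigma> * i}. comp a k)"
  have l: "l \<in> span {k. \<sigma> * k < \<sigma> * i}" unfolding l_def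
    by (intro span_finsum) (use fin comp_G[OF a(1)] G_subset_span in auto)
  have q: "q \<in> P" unfolding q_def
  proof (intro ideal_finsum[OF P])
    fix k assume "k \<in> ?S \<inter> {k. \<sigma> * k > \<sigma> * i}"
    then show "comp a k \<in> P" using i(2)[of k] by auto
  qed (use fin in auto)
  have S: "?S = insert i ((?S \<inter> {k. \<sigma> * k < \<sigma> * i}) \<union> (?S \<inter> {k. \<sigma> * k > \<sigma> * i}))" (is "_ = insert i (?L \<union> ?U)")
  proof -
    have "\<sigma> * k < \<sigma> * i \<or> \<sigma> * k > \<sigma> * i \<or> k = i" for k using \<sigma> by (auto simp: neq_iff)
    moreover have "i \<in> ?S" using i(1) TS by auto
    ultimately show ?thesis by auto
  qed
  have "a = (\<Oplus>k\<in>?S. comp a k)" using finsum_comp[OF a(1)] .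
  also have "\<dots> = (\<Oplus>k\<in>insert i (?L \<union> ?U). comp a k)" using S by simp
  also have "\<dots> = comp a i \<oplus> (\<Oplus>k\<in>?L \<union> ?U. comp a k)"
    using fin comp_carrier[OF a(1)] by (intro finsum_insert) auto
  also have "(\<Oplus>k\<in>?L \<union> ?U. comp a k) = l \<oplus> q" unfolding l_def q_def
    using fin comp_carrier[OF a(1)] by (intro finsum_Un_disjoint) auto
  finally have "a = comp a i \<oplus> l \<oplus> q"
    using comp_carrier[OF a(1)] l q ideal.Icarr[OF P] by (simp add: a_assoc span_carrier)
  then show thesis using that[of "comp a i" i l q] comp_G[OF a(1)] i(1) l q by blast
qed

lemma leading_product:
  fixes \<sigma> :: int
  assumes "h \<in> G i" "l \<in> span {k. \<sigma> * k < \<sigma> * i}" "h' \<in> G j" "l' \<in> span {k. \<sigma> * k < \<sigma> * j}"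
  shows "comp ((h \<oplus> l) \<otimes> (h' \<oplus> l')) (i + j) = h \<otimes> h'"
proof -
  let ?U = "span {k. \<sigma> * k < \<sigma> * (i + j)}"
  have c: "h \<in> carrier R" "l \<in> carrier R" "h' \<in> carrier R" "l' \<in> carrier R"
    using assms by auto
  have hs: "h \<in> span {i}" "h' \<in> span {j}" using assms G_subset_span by auto
  have "h \<otimes> l' \<in> ?U" by (rule span_mult[OF hs(1) assms(4)]) (auto simp: algebra_simps)
  moreover have "l \<otimes> h' \<in> ?U" by (rule span_mult[OF assms(2) hs(2)]) (auto simp: algebra_simps)
  moreover have "l \<otimes> l' \<in> ?U" by (rule span_mult[OF assms(2,4)]) (auto simp: algebra_simps)
  ultimately have U: "h \<otimes> l' \<oplus> l \<otimes> h' \<oplus> l \<otimes> l' \<in> ?U" using span_add by blast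
  then have z: "comp (h \<otimes> l' \<oplus> l \<otimes> h' \<oplus> l \<otimes> l') (i + j) = \<zero>" by (auto simp: span_def)
  have "(h \<oplus> l) \<otimes> (h' \<oplus> l') = h \<otimes> h' \<oplus> (h \<otimes> l' \<oplus> l \<otimes> h' \<oplus> l \<otimes> l')" using c by algebra
  then show ?thesis
    using z c U comp_add[of "h \<otimes> h'" "h \<otimes> l' \<oplus> l \<otimes> h' \<oplus> l \<otimes> l'" "i + j"]
      comp_homogeneous[OF G_mult[OF assms(1,3)]] by simp
qed

text \<open>Dropping the components in \<open>P\<close> beyond the leading ones changes a product
  only modulo \<open>P\<close>, and the product of the two leading terms is then a component of an
  element of \<open>P\<close>. So testing homogeneous factors suffices.\<close>

lemma homogeneous_primeI:
  assumes P: "ideal P R" and comps: "\<And>b k. b \<in> P \<Longrightarrow> comp b k \<in> P" and one: "\<one> \<notin> P"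
    and prime: "\<And>h i h' j. h \<in> G i \<Longrightarrow> h' \<in> G j \<Longrightarrow> h \<otimes> h' \<in> P \<Longrightarrow> h \<in> P \<or> h' \<in> P"
  shows "primeideal P R"
proof (rule primeidealI[OF P])
  show "cring R" by (rule cring_axioms)
  show "carrier R \<noteq> P" using one by auto
  fix a b assume ab: "a \<in> carrier R" "b \<in> carrier R" "a \<otimes> b \<in> P"
  show "a \<in> P \<or> b \<in> P"
  proof (rule ccontr)
    assume "\<not> ?thesis"
    then have "a \<notin> P" "b \<notin> P" by auto
    obtain i h l q where 1: "h \<in> G i" "h \<notin> P" "l \<in> span {k. 1 * k < 1 * i}" "q \<in> P" "a = h \<oplus> l \<oplus> q"
      by (rule leading_decomposition[OF P ab(1) \<open>a \<notin> P\<close>, of 1]) auto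
    obtain j h' l' q' where 2: "h' \<in> G j" "h' \<notin> P" "l' \<in> span {k. 1 * k < 1 * j}" "q' \<in> P" "b = h' \<oplus> l' \<oplus> q'"
      by (rule leading_decomposition[OF P ab(2) \<open>b \<notin> P\<close>, of 1]) auto
    have c: "h \<in> carrier R" "l \<in> carrier R" "h' \<in> carrier R" "l' \<in> carrier R" "q \<in> carrier R" "q' \<in> carrier R"
      using 1 2 ideal.Icarr[OF P] by auto
    have "(h \<oplus> l) \<otimes> (h' \<oplus> l') = a \<otimes> b \<oplus> \<ominus> ((h \<oplus> l) \<otimes> q' \<oplus> b \<otimes> q)"
      unfolding 1(5) 2(5) using c by algebra
    moreover have "\<ominus> ((h \<oplus> l) \<otimes> q' \<oplus> b \<otimes> q) \<in> P"
      using c ab 1(4) 2(4)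
      by (intro additive_subgroup.a_inv_closed[OF ideal.axioms(1)[OF P]]
          additive_subgroup.a_closed[OF ideal.axioms(1)[OF P]] ideal.I_l_closed[OF P]) auto
    ultimately have "(h \<oplus> l) \<otimes> (h' \<oplus> l') \<in> P"
      using ab(3) P by (simp add: additive_subgroup.a_closed ideal.axioms(1))
    then have "h \<otimes> h' \<in> P"
      using comps leading_product[OF 1(1,3) 2(1,3)] by metis
    then show False using prime 1 2 by blast
  qed
qed

text \<open>The elements with all components in \<open>I\<close> form an ideal, and it contains the
  homogeneous generators of \<open>I\<close>.\<close>

lemma homogeneous_ideal_comps:
  assumes I: "homogeneous_ideal R G I" and b: "b \<in> I"
  shows "comp b k \<in> I"
proof -
  obtain S where S: "S \<subseteq> (\<Union>i. G i)" "I = Idl S" using I by (auto simp: homogeneous_ideal_def)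
  have Sc: "S \<subseteq> carrier R" using S by auto
  have id: "ideal I R" using genideal_ideal[OF Sc] S by simp
  let ?J = "{b \<in> carrier R. \<forall>k. comp b k \<in> I}"
  have "ideal ?J R"
  proof (rule idealI)
    show "ring R" by (rule ring_axioms)
    have sub: "additive_subgroup I R" using id by (rule ideal.axioms)
    show "subgroup ?J (add_monoid R)"
    proof (rule add.subgroupI)
      have "\<zero> \<in> ?J" using additive_subgroup.zero_closed[OF sub] by simp
      then show "?J \<noteq> {}" by blast
    qed (auto simp: comp_add comp_minus additive_subgroup.a_closed[OF sub]
        additive_subgroup.a_inv_closed[OF sub])
    have *: "r \<otimes> b \<in> ?J" if b: "b \<in> ?J" and "r \<in> carrier R" for r b
      using \<open>r \<in> carrier R\<close>
    proof (induction rule: homogeneous_induct)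
      case (homogeneous i h)
      then show ?case
        using b by (auto simp: comp_mult_homogeneous G_carrier intro!: ideal.I_l_closed[OF id])
    next
      case (add r s)
      then show ?case
        using b id by (auto simp: l_distr comp_add additive_subgroup.a_closed ideal.axioms(1))
    qed
    then show "r \<otimes> b \<in> ?J" "b \<otimes> r \<in> ?J" if "b \<in> ?J" "r \<in> carrier R" for r b
      using that by (auto simp: m_comm)
  qed
  moreover have "S \<subseteq> ?J"
  proof
    fix s assume s: "s \<in> S"
    then obtain i where "s \<in> G i" using S by auto
    moreover have "s \<in> I" using s genideal_self[OF Sc] S by auto
    ultimately show "s \<in> ?J" using id
      by (auto simp: comp_homogeneous ideal.axioms(1) additive_subgroup.zero_closed)
  qed
  ultimately have "I \<subseteq> ?J" using genideal_minimal S(2) by blast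
  then show ?thesis using b by blast
qed

lemma homogeneous_idealI:
  assumes P: "ideal P R" and comps: "\<And>b k. b \<in> P \<Longrightarrow> comp b k \<in> P"
  shows "homogeneous_ideal R G P"
  unfolding homogeneous_ideal_def
proof (intro exI conjI)
  let ?S = "P \<inter> (\<Union>i. G i)"
  have Sc: "?S \<subseteq> carrier R" by auto
  show "P = Idl ?S"
  proof
    show "Idl ?S \<subseteq> P" by (rule genideal_minimal[OF P]) auto
    show "P \<subseteq> Idl ?S"
    proof
      fix b assume b: "b \<in> P"
      then have bc: "b \<in> carrier R" using ideal.Icarr[OF P] by auto
      have "comp b k \<in> ?S" for k using b comps comp_G[OF bc] by auto
      then show "b \<in> Idl ?S"
        using genideal_self[OF Sc] by (intro ideal_comps[OF genideal_ideal[OF Sc] bc]) blast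
    qed
  qed
qed auto

section \<open>Conductors and primes of height one\<close>

lemma height_one_primeI:
  assumes P: "primeideal P R" and x: "x \<in> P" "x \<noteq> \<zero>"
    and min: "\<And>Q. primeideal Q R \<Longrightarrow> Q \<subset> P \<Longrightarrow> Q = {\<zero>}"
  shows "height R P = 1"
proof -
  let ?X = "{enat n | n. \<exists>c :: nat \<Rightarrow> 'a set.
     (\<forall>i\<le>n. primeideal (c i) R) \<and> (\<forall>i<n. c i \<subset> c (Suc i)) \<and> c n = P}"
  have zero: "\<zero> \<in> Q" if "primeideal Q R" for Q
    using that by (simp add: additive_subgroup.zero_closed ideal.axioms(1) primeideal.axioms(1))
  have "enat 1 \<in> ?X"
    using P x zeroprimeideal zero[OF P]
    by (intro CollectI exI[of _ 1] conjI exI[of _ "\<lambda>i. if i = 0 then {\<zero>} else P"]) auto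
  from Sup_upper[OF this] have "1 \<le> Sup ?X" by (simp only: one_enat_def)
  moreover have "Sup ?X \<le> 1"
  proof (rule Sup_least)
    fix e assume "e \<in> ?X"
    then obtain n c where c: "e = enat n" "\<And>i. i \<le> n \<Longrightarrow> primeideal (c i) R"
      "\<And>i. i < n \<Longrightarrow> c i \<subset> c (Suc i)" "c n = P" by blast
    have "n \<le> 1"
    proof (rule ccontr)
      assume "\<not> n \<le> 1"
      then obtain m where m: "n = Suc (Suc m)" by (metis One_nat_def le_refl less_one linorder_not_less not0_implies_Suc zero_le)
      have "c (Suc m) = {\<zero>}" using c(2)[of "Suc m"] c(3)[of "Suc m"] c(4) m by (intro min) auto
      then have "c m \<subset> {\<zero>}" using c(3)[of m] m by auto
      moreover have "\<zero> \<in> c m" using zero c(2) m by auto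
      ultimately show False by auto
    qed
    then show "e \<le> 1" using c(1) by (simp add: one_enat_def)
  qed
  ultimately show ?thesis unfolding height_def by simp
qed

lemma height_one_primeD:
  assumes "height R P = 1" "primeideal P R" "primeideal Q R" "Q \<subseteq> P" "x \<in> Q" "x \<noteq> \<zero>"
  shows "Q = P"
proof (rule ccontr)
  let ?X = "{enat n | n. \<exists>c :: nat \<Rightarrow> 'a set.
     (\<forall>i\<le>n. primeideal (c i) R) \<and> (\<forall>i<n. c i \<subset> c (Suc i)) \<and> c n = P}"
  assume "Q \<noteq> P"
  have zero: "\<zero> \<in> Q"
    using assms by (simp add: additive_subgroup.zero_closed ideal.axioms(1) primeideal.axioms(1))
  define c where "c i = (if i = 0 then {\<zero>} else if i = 1 then Q else P)" for i :: nat
  have "\<forall>i<2. c i \<subset> c (Suc i)"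
  proof (intro allI impI)
    fix i :: nat assume "i < 2"
    then have "i = 0 \<or> i = 1" by auto
    then show "c i \<subset> c (Suc i)" using \<open>Q \<noteq> P\<close> assms zero by (auto simp: c_def)
  qed
  moreover have "\<forall>i\<le>2. primeideal (c i) R" using assms zeroprimeideal by (auto simp: c_def)
  moreover have "c 2 = P" by (simp add: c_def)
  ultimately have "enat 2 \<in> ?X" by blast
  from Sup_upper[OF this] have "enat 2 \<le> 1" using assms(1) unfolding height_def by (simp only:)
  then show False by (simp add: one_enat_def)
qed

text \<open>The ideal of denominators of the fraction \<open>a / x\<close>, equivalently the
  annihilator of \<open>a\<close> modulo \<open>x\<close>. For nonzero \<open>x\<close> it contains
  \<open>\<one>\<close> exactly when the fraction lies in the ring.\<close>

definition conductor :: "'a \<Rightarrow> 'a \<Rightarrow> 'a set" where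
  "conductor x a = {s \<in> carrier R. \<exists>r\<in>carrier R. s \<otimes> a = x \<otimes> r}"

lemma conductorI: "s \<in> carrier R \<Longrightarrow> r \<in> carrier R \<Longrightarrow> s \<otimes> a = x \<otimes> r \<Longrightarrow> s \<in> conductor x a"
  by (auto simp: conductor_def)

lemma conductor_ideal:
  assumes "x \<in> carrier R" "a \<in> carrier R"
  shows "ideal (conductor x a) R"
proof (rule idealI)
  show "ring R" by (rule ring_axioms)
  show "subgroup (conductor x a) (add_monoid R)"
  proof (rule add.subgroupI)
    show "conductor x a \<noteq> {}" using conductorI[of \<zero> \<zero> a x] assms by auto
    show "\<ominus> s \<in> conductor x a" if "s \<in> conductor x a" for s
    proof -
      obtain p where "s \<otimes> a = x \<otimes> p" "p \<in> carrier R" "s \<in> carrier R"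
        using \<open>s \<in> conductor x a\<close> by (auto simp: conductor_def)
      then show ?thesis using assms by (intro conductorI[of _ "\<ominus> p"]) (auto simp: l_minus r_minus)
    qed
    show "s \<oplus> t \<in> conductor x a" if "s \<in> conductor x a" "t \<in> conductor x a" for s t
    proof -
      obtain p q where "s \<otimes> a = x \<otimes> p" "t \<otimes> a = x \<otimes> q" "p \<in> carrier R" "q \<in> carrier R"
        "s \<in> carrier R" "t \<in> carrier R"
        using \<open>s \<in> conductor x a\<close> \<open>t \<in> conductor x a\<close> by (auto simp: conductor_def)
      then show ?thesis using assms by (intro conductorI[of _ "p \<oplus> q"]) (auto simp: l_distr r_distr)
    qed
  qed (auto simp: conductor_def)
  show *: "r \<otimes> s \<in> conductor x a" if "s \<in> conductor x a" "r \<in> carrier R" for r s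
  proof -
    obtain p where "s \<otimes> a = x \<otimes> p" "p \<in> carrier R" "s \<in> carrier R"
      using \<open>s \<in> conductor x a\<close> by (auto simp: conductor_def)
    then show ?thesis using assms that by (intro conductorI[of _ "r \<otimes> p"]) (auto simp: m_assoc m_lcomm)
  qed
  then show "s \<otimes> r \<in> conductor x a" if "s \<in> conductor x a" "r \<in> carrier R" for r s
    using that by (metis (no_types, lifting) conductor_def m_comm mem_Collect_eq)
qed

lemma conductor_comps:
  assumes "x \<in> G i" "a \<in> G j" "s \<in> conductor x a"
  shows "comp s k \<in> conductor x a"
proof -
  obtain r where r: "s \<otimes> a = x \<otimes> r" "r \<in> carrier R" "s \<in> carrier R"
    using assms(3) by (auto simp: conductor_def)
  have "comp s k \<otimes> a = a \<otimes> comp s (k + j - j)" using r assms by (simp add: m_comm comp_carrier G_carrier)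
  also have "\<dots> = comp (a \<otimes> s) (k + j)" using comp_mult_homogeneous[OF assms(2) r(3)] by metis
  also have "\<dots> = comp (x \<otimes> r) (k + j)" using r assms by (simp add: m_comm G_carrier flip: r(1))
  also have "\<dots> = x \<otimes> comp r (k + j - i)" using comp_mult_homogeneous[OF assms(1) r(2)] .
  finally show ?thesis using r by (intro conductorI[of _ "comp r (k + j - i)"]) auto
qed

lemma conductor_mult:
  assumes "x \<in> carrier R" "a \<in> carrier R" "b \<in> carrier R"
  shows "conductor x a \<subseteq> conductor x (a \<otimes> b)"
proof
  fix s assume "s \<in> conductor x a"
  then obtain r where r: "s \<otimes> a = x \<otimes> r" "r \<in> carrier R" "s \<in> carrier R" by (auto simp: conductor_def)
  then have "s \<otimes> (a \<otimes> b) = x \<otimes> (r \<otimes> b)" using assms by (simp flip: m_assoc)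
  then show "s \<in> conductor x (a \<otimes> b)" using r assms by (intro conductorI[of _ "r \<otimes> b"]) auto
qed

lemma conductor_mult_iff:
  assumes "x \<in> carrier R" "a \<in> carrier R" "b \<in> carrier R" "s \<in> carrier R"
  shows "s \<in> conductor x (a \<otimes> b) \<longleftrightarrow> s \<otimes> b \<in> conductor x a"
proof -
  have "s \<otimes> (a \<otimes> b) = s \<otimes> b \<otimes> a" using assms by (simp add: m_ac)
  then show ?thesis using assms by (simp add: conductor_def)
qed

lemma ideal_in_carrier: "ideal J R \<Longrightarrow> ideal_in (carrier R) J"
  by (auto simp: ideal_in_def ideal.Icarr ideal.axioms(1) additive_subgroup.zero_closed
      additive_subgroup.a_closed ideal.I_l_closed)

text \<open>A conductor maximal among those missing \<open>W\<close> is prime, by the argument for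
  maximal annihilators: replacing \<open>b\<close> by \<open>b \<otimes> v\<close> enlarges the
  conductor, so it is unchanged unless it meets \<open>W\<close>. The set \<open>W\<close> is
  \<open>{\<one>}\<close> for the use of normality, and all homogeneous elements outside a prime
  when only that prime matters.\<close>

lemma prime_conductor:
  assumes N: "noetherian_in (carrier R)" and x: "x \<in> G i" and a: "a \<in> G j"
    and W: "W \<subseteq> (\<Union>i. G i)" "\<one> \<in> W" "\<And>v w. v \<in> W \<Longrightarrow> w \<in> W \<Longrightarrow> v \<otimes> w \<in> W"
    and disj: "conductor x a \<inter> W = {}"
  obtains b k where "b \<in> G k" "primeideal (conductor x b) R" "conductor x b \<inter> W = {}"
    "conductor x a \<subseteq> conductor x b"
proof -
  define F where "F = {J. \<exists>b k. b \<in> G k \<and> J = conductor x b \<and> J \<inter> W = {} \<and> conductor x a \<subseteq> J}"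
  have "conductor x a \<in> F" using a disj by (auto simp: F_def)
  moreover have "ideal_in (carrier R) J" if "J \<in> F" for J
    using that x by (auto simp: F_def G_carrier intro!: ideal_in_carrier conductor_ideal)
  ultimately obtain M where M: "M \<in> F" "\<And>J. J \<in> F \<Longrightarrow> M \<subseteq> J \<Longrightarrow> J = M"
    using noetherian_in_maximal[OF N, of F] by metis
  then obtain b k where b: "b \<in> G k" "M = conductor x b" "M \<inter> W = {}" "conductor x a \<subseteq> M"
    by (auto simp: F_def)
  have xc: "x \<in> carrier R" and bc: "b \<in> carrier R" using x b by auto
  have grow: "conductor x (b \<otimes> c) = M" if "c \<in> G l" "conductor x (b \<otimes> c) \<inter> W = {}" for c l
  proof (rule M(2))
    show sub: "M \<subseteq> conductor x (b \<otimes> c)" using conductor_mult[OF xc bc] that b by auto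
    show "conductor x (b \<otimes> c) \<in> F"
      unfolding F_def using that(2) G_mult[OF b(1) that(1)] sub b(4) by blast
  qed
  have "primeideal M R"
  proof (rule homogeneous_primeI)
    show "ideal M R" using conductor_ideal xc bc b by simp
    show "comp s l \<in> M" if "s \<in> M" for s l using conductor_comps x b that by metis
    show "\<one> \<notin> M" using b W by auto
    fix u p v q assume u: "u \<in> G p" and v: "v \<in> G q" and uv: "u \<otimes> v \<in> M"
    show "u \<in> M \<or> v \<in> M"
    proof (cases "conductor x (b \<otimes> v) \<inter> W = {}")
      case True
      then have "conductor x (b \<otimes> v) = M" using grow v by blast
      then show ?thesis using conductor_mult_iff[OF xc bc, of v u] u v uv b by auto
    next
      case False
      \<comment> \<open>\<open>w\<close> moves \<open>v\<close> into \<open>M\<close>. Closure of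
        \<open>W\<close> under products keeps the conductor for \<open>b \<otimes> w\<close> away
        from \<open>W\<close>, so maximality identifies it with \<open>M\<close>, and it contains
        \<open>v\<close>.\<close>
      then obtain w where w: "w \<in> W" "w \<in> conductor x (b \<otimes> v)" by auto
      then obtain l where wl: "w \<in> G l" using W by auto
      have wv: "w \<otimes> v \<in> M" using w(2) conductor_mult_iff[OF xc bc, of v w] v wl b by auto
      have "z \<notin> conductor x (b \<otimes> w)" if "z \<in> W" for z
      proof
        assume "z \<in> conductor x (b \<otimes> w)"
        moreover have "z \<in> carrier R" using that W by auto
        ultimately have "z \<otimes> w \<in> M" using conductor_mult_iff[OF xc bc, of w z] wl b by auto
        then show False using W(3)[OF that w(1)] b by auto
      qed
      then have "conductor x (b \<otimes> w) = M" using grow wl by blast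
      then have "v \<in> M" using conductor_mult_iff[OF xc bc, of w v] wl v wv b by (auto simp: m_comm G_carrier)
      then show ?thesis ..
    qed
  qed
  then show thesis using that[of b k] b by simp
qed

text \<open>Dependent choice inside a set \<open>T\<close> of nonzero elements closed under
  multiplication by \<alpha> / \<beta> produces the sequence of
  \<open>geometric_sequence_integral\<close>.\<close>

lemma divisibility_chain:
  assumes N: "noetherian_in (carrier R)" and ab: "\<alpha> \<in> carrier R" "\<beta> \<in> carrier R"
    and T: "T \<subseteq> carrier R" "\<zero> \<notin> T" "\<And>s. s \<in> T \<Longrightarrow> \<exists>r\<in>T. \<alpha> \<otimes> s = \<beta> \<otimes> r" and "s0 \<in> T"
  shows "\<exists>k. homogeneous_form \<alpha> \<beta> k (\<alpha> [^] k)"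
proof -
  obtain g where g: "\<And>s. s \<in> T \<Longrightarrow> g s \<in> T \<and> \<alpha> \<otimes> s = \<beta> \<otimes> g s" using T(3) by metis
  define s where "s = rec_nat s0 (\<lambda>_. g)"
  have s: "s 0 = s0" "\<And>n. s (Suc n) = g (s n)" by (simp_all add: s_def)
  have mem: "s n \<in> T" for n by (induction n) (auto simp: s g \<open>s0 \<in> T\<close>)
  show ?thesis
  proof (rule geometric_sequence_integral[OF N ab, of s])
    show "s n \<in> carrier R" "s n \<noteq> \<zero>" for n using mem[of n] T by auto
    show "\<alpha> \<otimes> s n = \<beta> \<otimes> s (Suc n)" for n using g[OF mem[of n]] s(2) by metis
  qed
qed

text \<open>If \<open>b / x\<close> carried every homogeneous element of its conductor back into the
  conductor, it would be integral and \<open>x\<close> would divide \<open>b\<close> by normality,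
  contrary to \<open>one\<close>. So some \<open>t\<close> in the conductor is sent to a
  \<open>u\<close> outside it.\<close>

lemma conductor_uniformizer:
  assumes N: "noetherian_in (carrier R)" and normal: "normal_domain R"
    and x: "x \<in> G i" "x \<noteq> \<zero>" and b: "b \<in> G k" and one: "\<one> \<notin> conductor x b"
  obtains t u l where "t \<in> G l" "t \<in> conductor x b" "u \<in> G (l + k - i)" "u \<notin> conductor x b" "t \<otimes> b = x \<otimes> u"
proof (rule ccontr)
  assume "\<not> thesis"
  with that have none: "u \<in> conductor x b"
    if "t \<in> G l" "t \<in> conductor x b" "u \<in> G (l + k - i)" "t \<otimes> b = x \<otimes> u" for t u l
    using that by metis
  have c: "x \<in> carrier R" "b \<in> carrier R" using x b by auto
  have bnz: "b \<noteq> \<zero>" using one conductorI[of \<one> \<zero> b x] c by auto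
  let ?T = "{s \<in> conductor x b. s \<noteq> \<zero> \<and> (\<exists>l. s \<in> G l)}"
  have "\<exists>m. homogeneous_form b x m (b [^] m)"
  proof (rule divisibility_chain[OF N c(2,1), of ?T x])
    show "?T \<subseteq> carrier R" by auto
    show "x \<in> ?T" using x b conductorI[of x b b x] by auto
    fix s assume "s \<in> ?T"
    then obtain l r where s: "s \<in> conductor x b" "s \<noteq> \<zero>" "s \<in> G l" "r \<in> carrier R" "s \<otimes> b = x \<otimes> r"
      by (auto simp: conductor_def)
    obtain u where u: "u \<in> G (l + k - i)" "s \<otimes> b = x \<otimes> u"
      using homogeneous_quotient[OF x(1) G_mult[OF s(3) b] s(4,5)] by blast
    have "u \<in> conductor x b" using none s u by blast
    moreover have "u \<noteq> \<zero>" using u s bnz c by (metis G_carrier integral r_null)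
    moreover have "b \<otimes> s = x \<otimes> u" using u s c by (simp add: m_comm G_carrier)
    ultimately show "\<exists>r\<in>?T. b \<otimes> s = x \<otimes> r" using u by blast
  qed auto
  then obtain r where "r \<in> carrier R" "b = x \<otimes> r" using normal_divides[OF normal _ c(2,1) x(2)] by blast
  then show False using one conductorI[of \<one> r b x] c by auto
qed

text \<open>From u = t b / x one gets u p = t (p b / x), and p b / x lies in the ring. Thus every
  element of the conductor becomes a multiple of \<open>t\<close> once \<open>u\<close> is
  inverted.\<close>

lemma uniformizer_divides:
  assumes c: "x \<in> carrier R" "x \<noteq> \<zero>" "b \<in> carrier R" "t \<in> carrier R" "u \<in> carrier R"
    and tu: "t \<otimes> b = x \<otimes> u" and p: "p \<in> conductor x b"
  shows "\<exists>r\<in>carrier R. u \<otimes> p = t \<otimes> r"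
proof -
  obtain r where r: "p \<otimes> b = x \<otimes> r" "r \<in> carrier R" "p \<in> carrier R" using p by (auto simp: conductor_def)
  have "x \<otimes> (u \<otimes> p) = (t \<otimes> b) \<otimes> p" using c r by (simp add: tu m_assoc)
  also have "\<dots> = t \<otimes> (p \<otimes> b)" using c r(2,3) by (simp add: m_ac)
  also have "\<dots> = x \<otimes> (t \<otimes> r)" unfolding r(1) using c r(2) by (simp add: m_lcomm)
  finally show ?thesis using c r mult_cancelD by (intro bexI[of _ r]) auto
qed

text \<open>An element of the prime \<open>P\<close> that could be divided by \<open>t / u\<close> indefinitely would make \<open>u / t\<close>
  integral, forcing \<open>u \<in> P\<close>.\<close>

lemma no_infinite_division:
  assumes N: "noetherian_in (carrier R)" and P: "primeideal P R"
    and t: "t \<in> P" and u: "u \<in> carrier R" "u \<notin> P"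
    and T: "T \<subseteq> carrier R" "\<zero> \<notin> T" "\<And>s. s \<in> T \<Longrightarrow> \<exists>r\<in>T. u \<otimes> s = t \<otimes> r"
  shows "T = {}"
proof (rule ccontr)
  assume "T \<noteq> {}"
  then obtain s0 where "s0 \<in> T" by auto
  have id: "ideal P R" using P by (rule primeideal.axioms)
  have tc: "t \<in> carrier R" using ideal.Icarr[OF id t] .
  obtain k where "homogeneous_form u t k (u [^] k)"
    using divisibility_chain[OF N u(1) tc T \<open>s0 \<in> T\<close>] by blast
  then have "u [^] k \<in> P" using homogeneous_form_ideal u t id by blast
  moreover have "u [^] k \<notin> P" by (rule primeideal_pow_notin[OF P u])
  ultimately show False by blast
qed

text \<open>A prime \<open>Q\<close> strictly inside \<open>P\<close> cannot contain
  \<open>t\<close>, since \<open>t\<close> generates \<open>P\<close> up to the factor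
  \<open>u\<close>. Hence a nonzero element of \<open>Q\<close> could be divided by t / u within
  \<open>Q\<close> for ever.\<close>

lemma uniformizer_height_one:
  assumes N: "noetherian_in (carrier R)" and P: "primeideal P R"
    and t: "t \<in> P" and u: "u \<in> carrier R" "u \<notin> P" and x: "x \<in> P" "x \<noteq> \<zero>"
    and dvd: "\<And>p. p \<in> P \<Longrightarrow> \<exists>r\<in>carrier R. u \<otimes> p = t \<otimes> r"
  shows "height R P = 1"
proof (rule height_one_primeI[OF P x])
  fix Q assume Q: "primeideal Q R" and QP: "Q \<subset> P"
  have id: "ideal Q R" using Q by (rule primeideal.axioms)
  have idP: "ideal P R" using P by (rule primeideal.axioms)
  have tc: "t \<in> carrier R" using ideal.Icarr[OF idP t] .
  have unz: "u \<noteq> \<zero>" using u additive_subgroup.zero_closed ideal.axioms(1)[OF idP] by metis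
  have "t \<notin> Q"
  proof
    assume "t \<in> Q"
    have "p \<in> Q" if "p \<in> P" for p
    proof -
      obtain r where "r \<in> carrier R" "u \<otimes> p = t \<otimes> r" using dvd \<open>p \<in> P\<close> by blast
      then have "u \<otimes> p \<in> Q" using ideal.I_r_closed[OF id \<open>t \<in> Q\<close>] by simp
      then show ?thesis using primeideal.I_prime[OF Q u(1)] ideal.Icarr[OF idP that] QP u(2) by blast
    qed
    then show False using QP by blast
  qed
  have "Q - {\<zero>} = {}"
  proof (rule no_infinite_division[OF N P t u])
    show "Q - {\<zero>} \<subseteq> carrier R" using ideal.Icarr[OF id] by auto
    fix s assume s: "s \<in> Q - {\<zero>}"
    then have sc: "s \<in> carrier R" using ideal.Icarr[OF id] by auto
    obtain r where r: "r \<in> carrier R" "u \<otimes> s = t \<otimes> r" using dvd s QP by blast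
    have "t \<otimes> r \<in> Q" using ideal.I_l_closed[OF id, of s u] s u r by auto
    then have "r \<in> Q" using primeideal.I_prime[OF Q tc r(1)] \<open>t \<notin> Q\<close> by blast
    moreover have "r \<noteq> \<zero>" using r sc s u unz tc integral_iff[of u s] by auto
    ultimately show "\<exists>r\<in>Q - {\<zero>}. u \<otimes> s = t \<otimes> r" using r by blast
  qed simp
  then show "Q = {\<zero>}" using additive_subgroup.zero_closed[OF ideal.axioms(1)[OF id]] by blast
qed

text \<open>Used in contrapositive form: one denominator of \<open>a / x\<close> outside each of
  these primes shows that \<open>x\<close> divides \<open>a\<close>.\<close>

lemma non_divisible_height_one:
  assumes N: "noetherian_in (carrier R)" and normal: "normal_domain R"
    and x: "x \<in> G i" "x \<noteq> \<zero>" and a: "a \<in> G j" and nd: "\<not> (\<exists>r\<in>carrier R. a = x \<otimes> r)"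
  obtains P where "P \<in> height_one_homogeneous_primes R G" "conductor x a \<subseteq> P"
proof -
  have c: "x \<in> carrier R" "a \<in> carrier R" using x a by auto
  have disj: "conductor x a \<inter> {\<one>} = {}" using nd c by (auto simp: conductor_def)
  obtain b k where b: "b \<in> G k" "primeideal (conductor x b) R" "conductor x b \<inter> {\<one>} = {}"
    "conductor x a \<subseteq> conductor x b"
    by (rule prime_conductor[OF N x(1) a _ _ _ disj]) (use one_G0 in auto)
  let ?P = "conductor x b"
  have id: "ideal ?P R" using b by (simp add: primeideal.axioms)
  have "\<one> \<notin> ?P" using b(3) by simp
  then obtain t u l where tu: "t \<in> G l" "t \<in> ?P" "u \<in> G (l + k - i)" "u \<notin> ?P" "t \<otimes> b = x \<otimes> u"
    by (rule conductor_uniformizer[OF N normal x b(1)])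
  have "x \<in> ?P" using conductorI[of x b b x] c b by auto
  then have "height R ?P = 1"
    by (rule uniformizer_height_one[OF N b(2) tu(2) G_carrier[OF tu(3)] tu(4) _ x(2)])
      (rule uniformizer_divides[OF c(1) x(2) G_carrier[OF b(1)] G_carrier[OF tu(1)] G_carrier[OF tu(3)] tu(5)])
  moreover have "homogeneous_ideal R G ?P"
    using id conductor_comps[OF x(1) b(1)] by (rule homogeneous_idealI)
  ultimately show thesis using that[of ?P] b by (auto simp: height_one_homogeneous_primes_def)
qed

end

section \<open>The degree function of a locally nilpotent derivation\<close>

lemma (in ring) add_pow_one_mult: "x \<in> carrier R \<Longrightarrow> [(n::nat)] \<cdot> x = ([n] \<cdot> \<one>) \<otimes> x"
  using add_pow_ldistr[of \<one> x n] by simp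

lemma (in domain) add_pow_nonzero:
  assumes "char_zero R" "x \<in> carrier R" "x \<noteq> \<zero>" "n > 0"
  shows "[(n::nat)] \<cdot> x \<noteq> \<zero>"
  using assms by (simp add: add_pow_one_mult[of x] integral_iff char_zero_def)

lemma (in domain) add_pow_cancel:
  assumes "char_zero R" "x \<in> carrier R" "y \<in> carrier R" "n > 0" "[(n::nat)] \<cdot> x = [n] \<cdot> y"
  shows "x = y"
  using assms mult_cancelD[of "[n] \<cdot> \<one>" x y]
  by (simp add: add_pow_one_mult[of x] add_pow_one_mult[of y] char_zero_def)

locale subring_derivation = domain R for R (structure) +
  fixes A :: "'a set" and D :: "'a \<Rightarrow> 'a"
  assumes subring: "subring A R" and derivation: "derivation (R\<lparr>carrier := A\<rparr>) D"
begin

lemma A_carrier [intro]: "x \<in> A \<Longrightarrow> x \<in> carrier R"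
  using subringE(1)[OF subring] by auto

lemma A_zero: "\<zero> \<in> A" and A_one: "\<one> \<in> A"
  and A_add: "x \<in> A \<Longrightarrow> y \<in> A \<Longrightarrow> x \<oplus> y \<in> A"
  and A_mult: "x \<in> A \<Longrightarrow> y \<in> A \<Longrightarrow> x \<otimes> y \<in> A"
  using subringE[OF subring] by auto

lemma A_pow: "x \<in> A \<Longrightarrow> x [^] (n::nat) \<in> A"
  by (induction n) (auto simp: A_one A_mult)

lemma D_closed [intro]: "x \<in> A \<Longrightarrow> D x \<in> A"
  and D_add: "x \<in> A \<Longrightarrow> y \<in> A \<Longrightarrow> D (x \<oplus> y) = D x \<oplus> D y"
  and D_mult: "x \<in> A \<Longrightarrow> y \<in> A \<Longrightarrow> D (x \<otimes> y) = D x \<otimes> y \<oplus> x \<otimes> D y"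
  using derivation unfolding derivation_def by auto

lemma D_carrier [intro]: "x \<in> A \<Longrightarrow> D x \<in> carrier R"
  using D_closed by blast

lemma D_zero [simp]: "D \<zero> = \<zero>"
proof -
  have "D \<zero> \<oplus> D \<zero> = D \<zero>" using D_add[OF A_zero A_zero] by simp
  then show ?thesis using D_carrier[OF A_zero] by (metis r_zero add.l_cancel zero_closed)
qed

lemma D_one [simp]: "D \<one> = \<zero>"
proof -
  have "D \<one> = D \<one> \<oplus> D \<one>" using D_mult[OF A_one A_one] D_carrier[OF A_one] by simp
  then show ?thesis using D_carrier[OF A_one] by (metis r_zero add.l_cancel zero_closed)
qed

lemma D_pow: "x \<in> A \<Longrightarrow> D (x [^] Suc n) = [(Suc n)] \<cdot> (x [^] n \<otimes> D x)"
proof (induction n)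
  case 0
  then show ?case using D_carrier[OF 0] by (simp add: A_carrier)
next
  case (Suc n)
  note c = A_carrier[OF Suc.prems] D_carrier[OF Suc.prems]
  have "D (x [^] Suc (Suc n)) = D (x [^] Suc n) \<otimes> x \<oplus> x [^] Suc n \<otimes> D x"
    using D_mult[OF A_pow[OF Suc.prems, of "Suc n"] Suc.prems] by simp
  also have "D (x [^] Suc n) \<otimes> x = [(Suc n)] \<cdot> (x [^] Suc n \<otimes> D x)"
    unfolding Suc.IH[OF Suc.prems] using c by (subst add_pow_ldistr) (auto simp: m_ac)
  finally show ?case using c by simp
qed

lemma funpow_closed: "x \<in> A \<Longrightarrow> (D ^^ n) x \<in> A"
  by (induction n) auto

lemma funpow_zero [simp]: "(D ^^ n) \<zero> = \<zero>"
  by (induction n) auto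

lemma funpow_add_dist: "x \<in> A \<Longrightarrow> y \<in> A \<Longrightarrow> (D ^^ n) (x \<oplus> y) = (D ^^ n) x \<oplus> (D ^^ n) y"
  by (induction n) (auto simp: D_add funpow_closed)

lemma D_add_pow: "x \<in> A \<Longrightarrow> [(n::nat)] \<cdot> x \<in> A \<and> D ([n] \<cdot> x) = [n] \<cdot> D x"
  by (induction n) (auto simp: A_zero A_add D_add)

lemma funpow_vanish_mono: "(D ^^ m) x = \<zero> \<Longrightarrow> m \<le> n \<Longrightarrow> (D ^^ n) x = \<zero>"
  by (metis add.commute funpow_add funpow_zero le_Suc_ex o_apply)

text \<open>In the Leibniz expansion only the term with \<open>p\<close> derivatives on
  \<open>x\<close> and \<open>q\<close> on \<open>y\<close> survives. The induction on
  \<open>p + q\<close> differentiates once and joins the two contributions by Pascal's rule.\<close>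

lemma leibniz_top:
  assumes "x \<in> A" "y \<in> A" "(D ^^ Suc p) x = \<zero>" "(D ^^ Suc q) y = \<zero>"
  shows "(D ^^ (p + q)) (x \<otimes> y) = [((p + q) choose p)] \<cdot> ((D ^^ p) x \<otimes> (D ^^ q) y)"
  using assms
proof (induction "p + q" arbitrary: p q x y)
  case 0
  then show ?case by (simp add: A_carrier)
next
  case (Suc n)
  have c: "x \<in> carrier R" "y \<in> carrier R" "\<And>k. (D ^^ k) x \<in> carrier R" "\<And>k. (D ^^ k) y \<in> carrier R"
    using Suc.prems funpow_closed by blast+
  have s: "(D ^^ k) (D z) = (D ^^ Suc k) z" for k z by (simp add: funpow_swap1)
  have split: "(D ^^ Suc n) (x \<otimes> y) = (D ^^ n) (D x \<otimes> y) \<oplus> (D ^^ n) (x \<otimes> D y)"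
    using Suc.prems
    by (simp add: s[symmetric] D_mult funpow_add_dist A_mult D_closed del: funpow.simps(2))
  consider (1) q' where "p = 0" "q = Suc q'" | (2) p' where "p = Suc p'" "q = 0"
    | (3) p' q' where "p = Suc p'" "q = Suc q'"
    using Suc.hyps(2) by (cases p; cases q) auto
  then show ?case
  proof cases
    case 1
    then have "D x = \<zero>" using Suc.prems by simp
    moreover have "(D ^^ (0 + q')) (x \<otimes> D y) = [((0 + q') choose 0)] \<cdot> ((D ^^ 0) x \<otimes> (D ^^ q') (D y))"
      using Suc 1 by (intro Suc.hyps(1)) (auto simp: s simp del: funpow.simps(2))
    ultimately show ?thesis using 1 c Suc.hyps(2) split by (simp add: s del: funpow.simps(2))
  next
    case 2
    then have "D y = \<zero>" using Suc.prems by simp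
    moreover have "(D ^^ (p' + 0)) (D x \<otimes> y) = [((p' + 0) choose p')] \<cdot> ((D ^^ p') (D x) \<otimes> (D ^^ 0) y)"
      using Suc 2 by (intro Suc.hyps(1)) (auto simp: s simp del: funpow.simps(2))
    ultimately show ?thesis using 2 c Suc.hyps(2) split by (simp add: s del: funpow.simps(2))
  next
    case 3
    have 1: "(D ^^ (p' + q)) (D x \<otimes> y) = [((p' + q) choose p')] \<cdot> ((D ^^ p') (D x) \<otimes> (D ^^ q) y)"
      using Suc 3 by (intro Suc.hyps(1)) (auto simp: s simp del: funpow.simps(2))
    have 2: "(D ^^ (p + q')) (x \<otimes> D y) = [((p + q') choose p)] \<cdot> ((D ^^ p) x \<otimes> (D ^^ q') (D y))"
      using Suc 3 by (intro Suc.hyps(1)) (auto simp: s simp del: funpow.simps(2))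
    have n: "p' + q = n" "p + q' = n" "p + q = Suc n" "Suc p' = p" "Suc q' = q" using 3 Suc.hyps(2) by auto
    have "(D ^^ Suc n) (x \<otimes> y) = [(n choose p')] \<cdot> ((D ^^ p) x \<otimes> (D ^^ q) y) \<oplus> [(n choose p)] \<cdot> ((D ^^ p) x \<otimes> (D ^^ q) y)"
      using 1 2 unfolding s n split by simp
    also have "\<dots> = [((n choose p') + (n choose p))] \<cdot> ((D ^^ p) x \<otimes> (D ^^ q) y)"
      using c by (intro add.nat_pow_mult) auto
    also have "(n choose p') + (n choose p) = (Suc n choose p)" using n(4) by auto
    finally show ?thesis using n by simp
  qed
qed

text \<open>The degree function of a locally nilpotent derivation, kept as a relation so that
  \<open>\<zero>\<close> simply has no degree.\<close>

definition has_degree :: "'a \<Rightarrow> nat \<Rightarrow> bool" where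
  "has_degree x n \<longleftrightarrow> x \<in> A \<and> (D ^^ n) x \<noteq> \<zero> \<and> (D ^^ Suc n) x = \<zero>"

lemma has_degree_unique: "has_degree x m \<Longrightarrow> has_degree x n \<Longrightarrow> m = n"
  using funpow_vanish_mono[of "Suc m" x n] funpow_vanish_mono[of "Suc n" x m]
  unfolding has_degree_def by (metis Suc_leI linorder_neqE_nat)

text \<open>Characteristic zero keeps the binomial coefficient of \<open>leibniz_top\<close> from
  vanishing, so degrees add exactly.\<close>

lemma has_degree_mult:
  assumes "char_zero R" "has_degree x m" "has_degree y n"
  shows "has_degree (x \<otimes> y) (m + n)"
proof -
  have x: "x \<in> A" "y \<in> A" using assms by (auto simp: has_degree_def)
  let ?z = "(D ^^ m) x \<otimes> (D ^^ n) y"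
  have e: "(D ^^ (m + n)) (x \<otimes> y) = [((m + n) choose m)] \<cdot> ?z"
    using assms x by (intro leibniz_top) (auto simp: has_degree_def)
  have z: "?z \<in> A" "?z \<noteq> \<zero>" using assms x funpow_closed integral_iff
    by (auto simp: has_degree_def A_mult A_carrier)
  have "D ?z = \<zero>" using assms x funpow_closed
    by (subst D_mult) (auto simp: has_degree_def A_carrier)
  then have "D ([((m + n) choose m)] \<cdot> ?z) = \<zero>" using D_add_pow[OF z(1)] by simp
  then show ?thesis
    using e add_pow_nonzero[OF assms(1) A_carrier[OF z(1)] z(2), of "(m + n) choose m"] x
    by (simp add: has_degree_def A_mult zero_less_binomial)
qed

lemma has_degree_pow:
  assumes "char_zero R" "has_degree x m"
  shows "has_degree (x [^] n) (n * m)"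
proof (induction n)
  case 0
  then show ?case by (simp add: has_degree_def A_one)
next
  case (Suc n)
  then show ?case using has_degree_mult[OF assms(1) Suc assms(2)] by (simp add: add.commute)
qed

lemma has_degree_exists:
  assumes "locally_nilpotent (R\<lparr>carrier := A\<rparr>) D" "x \<in> A" "x \<noteq> \<zero>"
  shows "\<exists>n. has_degree x n"
proof -
  let ?n = "LEAST n. (D ^^ n) x = \<zero>"
  obtain n where "(D ^^ n) x = \<zero>" using assms by (auto simp: locally_nilpotent_def)
  then have 1: "(D ^^ ?n) x = \<zero>" by (rule LeastI)
  then obtain m where m: "?n = Suc m" using assms(3) by (cases ?n) auto
  then have "(D ^^ m) x \<noteq> \<zero>" using not_less_Least[of m "\<lambda>n. (D ^^ n) x = \<zero>"] by auto
  then show ?thesis using 1 m assms(2) by (auto simp: has_degree_def)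
qed

lemma has_degree_D: "has_degree x (Suc n) \<Longrightarrow> has_degree (D x) n"
  by (auto simp: has_degree_def funpow_swap1)

lemma locally_nilpotentI:
  assumes "\<And>x. x \<in> A \<Longrightarrow> \<exists>n. (D ^^ n) x = \<zero>"
  shows "locally_nilpotent (R\<lparr>carrier := A\<rparr>) D"
  unfolding locally_nilpotent_def
proof
  fix x assume "x \<in> carrier (R\<lparr>carrier := A\<rparr>)"
  then obtain n where "(D ^^ n) x = \<zero>" using assms by auto
  then have "(D ^^ Suc n) x = \<zero>" by simp
  then show "\<exists>n>0. (D ^^ n) x = \<zero>\<^bsub>R\<lparr>carrier := A\<rparr>\<^esub>" by (intro exI[of _ "Suc n"]) simp
qed

lemma nilpotent_add:
  assumes "x \<in> A" "y \<in> A" "\<exists>n. (D ^^ n) x = \<zero>" "\<exists>n. (D ^^ n) y = \<zero>"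
  shows "\<exists>n. (D ^^ n) (x \<oplus> y) = \<zero>"
proof -
  obtain m n where *: "(D ^^ m) x = \<zero>" "(D ^^ n) y = \<zero>" using assms by auto
  have "(D ^^ max m n) (x \<oplus> y) = \<zero>"
    using assms funpow_vanish_mono[OF *(1), of "max m n"] funpow_vanish_mono[OF *(2), of "max m n"]
    by (simp add: funpow_add_dist)
  then show ?thesis by blast
qed

end

section \<open>Derivations defined on homogeneous elements\<close>

context graded_domain
begin

text \<open>The degree is an argument of \<phi> because one of the two derivations built this way
  multiplies by the degree.\<close>

definition extend :: "(int \<Rightarrow> 'a \<Rightarrow> 'a) \<Rightarrow> 'a \<Rightarrow> 'a" where
  "extend \<phi> b = (\<Oplus>k\<in>{k. comp b k \<noteq> \<zero>}. \<phi> k (comp b k))"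

context
  fixes S :: "int set" and \<phi> :: "int \<Rightarrow> 'a \<Rightarrow> 'a"
  assumes \<phi>_closed: "\<And>k x. k \<in> S \<Longrightarrow> x \<in> G k \<Longrightarrow> \<phi> k x \<in> span S"
    and \<phi>_add: "\<And>k x y. k \<in> S \<Longrightarrow> x \<in> G k \<Longrightarrow> y \<in> G k \<Longrightarrow> \<phi> k (x \<oplus> y) = \<phi> k x \<oplus> \<phi> k y"
begin

lemma extend_summand_zero: "k \<in> S \<Longrightarrow> \<phi> k \<zero> = \<zero>"
proof -
  assume k: "k \<in> S"
  have "\<phi> k \<zero> \<oplus> \<phi> k \<zero> = \<phi> k \<zero>" using \<phi>_add[OF k G_zero G_zero] by simp
  then show ?thesis using \<phi>_closed[OF k G_zero] by (metis r_zero add.l_cancel zero_closed span_carrier)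
qed

lemma extend_superset:
  assumes "b \<in> span S" "finite F" "F \<subseteq> S" "\<And>k. comp b k \<noteq> \<zero> \<Longrightarrow> k \<in> F"
  shows "extend \<phi> b = (\<Oplus>k\<in>F. \<phi> k (comp b k))"
proof -
  have b: "b \<in> carrier R" using assms by auto
  have "\<phi> k (comp b k) \<in> carrier R" if "k \<in> F" for k
    using \<phi>_closed comp_G[OF b] assms(3) that by blast
  moreover have "\<phi> k (comp b k) = \<zero>" if "k \<in> F" "comp b k = \<zero>" for k
    using that extend_summand_zero assms(3) by auto
  ultimately show ?thesis unfolding extend_def
    using assms by (intro add.finprod_mono_neutral_cong_left) auto
qed

lemma extend_homogeneous:
  assumes "k \<in> S" "x \<in> G k"
  shows "extend \<phi> x = \<phi> k x"
proof -
  have "extend \<phi> x = (\<Oplus>k\<in>{k}. \<phi> k (comp x k))"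
    using assms by (intro extend_superset) (auto simp: comp_homogeneous G_subset_span split: if_splits)
  moreover have "\<phi> k x \<in> carrier R" using span_carrier[OF \<phi>_closed[OF assms]] .
  ultimately show ?thesis using assms by (simp add: comp_homogeneous)
qed

lemma extend_add:
  assumes "a \<in> span S" "b \<in> span S"
  shows "extend \<phi> (a \<oplus> b) = extend \<phi> a \<oplus> extend \<phi> b"
proof -
  let ?F = "{k. comp a k \<noteq> \<zero>} \<union> {k. comp b k \<noteq> \<zero>}"
  have c: "a \<in> carrier R" "b \<in> carrier R" using assms by auto
  have F: "finite ?F" using finite_supp c by auto
  have FS: "?F \<subseteq> S" using assms by (auto simp: span_def)
  have cl: "\<phi> k (comp a k) \<in> carrier R" "\<phi> k (comp b k) \<in> carrier R" if "k \<in> ?F" for k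
    using \<phi>_closed comp_G c FS that by blast+
  have "extend \<phi> (a \<oplus> b) = (\<Oplus>k\<in>?F. \<phi> k (comp (a \<oplus> b) k))"
    using assms F FS c by (intro extend_superset) (auto simp: span_add comp_add)
  also have "\<dots> = (\<Oplus>k\<in>?F. \<phi> k (comp a k) \<oplus> \<phi> k (comp b k))"
  proof (rule finsum_cong')
    fix k assume "k \<in> ?F"
    then have "k \<in> S" using FS by blast
    then show "\<phi> k (comp (a \<oplus> b) k) = \<phi> k (comp a k) \<oplus> \<phi> k (comp b k)"
      using \<phi>_add comp_G c by (simp add: comp_add)
  qed (use cl in auto)
  also have "\<dots> = (\<Oplus>k\<in>?F. \<phi> k (comp a k)) \<oplus> (\<Oplus>k\<in>?F. \<phi> k (comp b k))"
    using cl by (intro finsum_addf) auto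
  also have "(\<Oplus>k\<in>?F. \<phi> k (comp a k)) = extend \<phi> a"
    using assms F FS by (intro extend_superset[symmetric]) auto
  also have "(\<Oplus>k\<in>?F. \<phi> k (comp b k)) = extend \<phi> b"
    using assms F FS by (intro extend_superset[symmetric]) auto
  finally show ?thesis .
qed

lemma extend_closed:
  assumes "b \<in> span S" shows "extend \<phi> b \<in> span S"
  using assms
proof (induction rule: span_induct)
  case zero
  then show ?case by (simp add: extend_def)
next
  case (homogeneous i h)
  then show ?case using \<phi>_closed by (simp add: extend_homogeneous)
next
  case (add a b)
  then show ?case by (simp add: extend_add span_add)
qed

lemma extend_derivation:
  assumes S: "\<And>i j. i \<in> S \<Longrightarrow> j \<in> S \<Longrightarrow> i + j \<in> S"
    and mult: "\<And>i j x y. i \<in> S \<Longrightarrow> j \<in> S \<Longrightarrow> x \<in> G i \<Longrightarrow> y \<in> G j \<Longrightarrow>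
        \<phi> (i + j) (x \<otimes> y) = \<phi> i x \<otimes> y \<oplus> x \<otimes> \<phi> j y"
  shows "derivation (R\<lparr>carrier := span S\<rparr>) (extend \<phi>)"
proof -
  have SS: "x \<otimes> y \<in> span S" if "x \<in> span S" "y \<in> span S" for x y
    using span_mult[OF that S] .
  have leib: "extend \<phi> (a \<otimes> b) = extend \<phi> a \<otimes> b \<oplus> a \<otimes> extend \<phi> b" if "a \<in> span S" "b \<in> span S" for a b
    using that(1)
  proof (induction rule: span_induct)
    case zero
    then show ?case using that(2) extend_closed[OF that(2)] by (simp add: extend_def span_carrier)
  next
    case (homogeneous i h)
    note hs = G_subset_span[OF homogeneous]
    show ?case using that(2)
    proof (induction rule: span_induct)
      case zero
      then show ?case using hs extend_closed[OF hs] by (simp add: extend_def span_carrier)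
    next
      case (homogeneous j g)
      have "extend \<phi> (h \<otimes> g) = \<phi> (i + j) (h \<otimes> g)"
        using S[OF \<open>i \<in> S\<close> \<open>j \<in> S\<close>] G_mult[OF \<open>h \<in> G i\<close> \<open>g \<in> G j\<close>] by (rule extend_homogeneous)
      then show ?case using homogeneous \<open>i \<in> S\<close> \<open>h \<in> G i\<close> mult by (simp add: extend_homogeneous)
    next
      case (add b c)
      have *: "extend \<phi> h \<in> carrier R" "extend \<phi> b \<in> carrier R" "extend \<phi> c \<in> carrier R"
        "h \<in> carrier R" "b \<in> carrier R" "c \<in> carrier R"
        using hs add extend_closed by (auto intro!: span_carrier)
      have "extend \<phi> (h \<otimes> (b \<oplus> c)) = extend \<phi> (h \<otimes> b) \<oplus> extend \<phi> (h \<otimes> c)"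
        using * SS[OF hs] add extend_add by (simp add: r_distr)
      also have "\<dots> = extend \<phi> h \<otimes> (b \<oplus> c) \<oplus> h \<otimes> (extend \<phi> b \<oplus> extend \<phi> c)"
        unfolding add.IH using * by algebra
      finally show ?case using add by (simp add: extend_add)
    qed
  next
    case (add a c)
    have *: "extend \<phi> b \<in> carrier R" "extend \<phi> a \<in> carrier R" "extend \<phi> c \<in> carrier R"
      "a \<in> carrier R" "b \<in> carrier R" "c \<in> carrier R"
      using that add extend_closed by (auto intro!: span_carrier)
    have "extend \<phi> ((a \<oplus> c) \<otimes> b) = extend \<phi> (a \<otimes> b) \<oplus> extend \<phi> (c \<otimes> b)"
      using * SS that add extend_add by (simp add: l_distr)
    also have "\<dots> = (extend \<phi> a \<oplus> extend \<phi> c) \<otimes> b \<oplus> (a \<oplus> c) \<otimes> extend \<phi> b"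
      unfolding add.IH using * by algebra
    finally show ?case using add by (simp add: extend_add)
  qed
  show ?thesis unfolding derivation_def using extend_closed extend_add leib by auto
qed

end

end

section \<open>Extending locally nilpotent derivations between Veronese subrings\<close>

context graded_domain
begin

lemma nilpotent_on_homogeneous:
  assumes "derivation (R\<lparr>carrier := span S\<rparr>) D" "subring (span S) R"
    and nil: "\<And>k h. k \<in> S \<Longrightarrow> h \<in> G k \<Longrightarrow> \<exists>n. (D ^^ n) h = \<zero>"
  shows "locally_nilpotent (R\<lparr>carrier := span S\<rparr>) D"
proof -
  interpret D: subring_derivation R "span S" D
    by (intro subring_derivation.intro domain_axioms subring_derivation_axioms.intro assms(1,2))
  show ?thesis
  proof (rule D.locally_nilpotentI)
    fix x assume "x \<in> span S"
    then show "\<exists>n. (D ^^ n) x = \<zero>"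
    proof (induction rule: span_induct)
      case zero
      show ?case by (intro exI[of _ 0]) simp
    qed (use nil D.nilpotent_add in auto)
  qed
qed

text \<open>With \<open>d = Suc n\<close>, the exponent \<open>d - 1\<close> is \<open>n\<close>.
  The assumption \<open>dvd\<close> isolates what normality has to provide; what follows from it is
  algebra in a graded domain of characteristic zero.\<close>

context
  fixes D :: "'a \<Rightarrow> 'a" and n :: nat and e :: nat
  assumes char0: "char_zero R"
    and D: "derivation (R\<lparr>carrier := veronese R G (Suc n)\<rparr>) D"
    and D_nil: "locally_nilpotent (R\<lparr>carrier := veronese R G (Suc n)\<rparr>) D"
    and e: "e dvd Suc n"
    and dvd: "\<And>i b. int e dvd i \<Longrightarrow> b \<in> G i \<Longrightarrow> \<exists>c\<in>carrier R. D (b [^] Suc n) = b [^] n \<otimes> c"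
begin

interpretation D: subring_derivation R "veronese R G (Suc n)" D
  by (intro subring_derivation.intro domain_axioms subring_derivation_axioms.intro D veronese_subring)

text \<open>For homogeneous \<open>b \<noteq> 0\<close> and \<open>d = n + 1\<close>, the quotient \<open>D (b\<^sup>d) / b\<^sup>d\<^sup>-\<^sup>1\<close> is
  \<open>d\<close> times the only possible value at \<open>b\<close> of an extension of \<open>D\<close>.\<close>

definition root_derivation :: "'a \<Rightarrow> 'a" where
  "root_derivation b = (if b = \<zero> then \<zero> else SOME c. c \<in> carrier R \<and> D (b [^] Suc n) = b [^] n \<otimes> c)"

private abbreviation (input) \<phi> where "\<phi> \<equiv> root_derivation"

lemma root_derivation_props:
  assumes "int e dvd i" "b \<in> G i"
  shows root_derivation_carrier: "\<phi> b \<in> carrier R" and root_derivation_eq: "D (b [^] Suc n) = b [^] n \<otimes> \<phi> b"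
proof -
  have "\<phi> b \<in> carrier R \<and> D (b [^] Suc n) = b [^] n \<otimes> \<phi> b"
  proof (cases "b = \<zero>")
    case True
    then show ?thesis by (simp add: root_derivation_def)
  next
    case False
    then show ?thesis unfolding root_derivation_def
      using someI_ex[of "\<lambda>c. c \<in> carrier R \<and> D (b [^] Suc n) = b [^] n \<otimes> c"] dvd[OF assms] by auto
  qed
  then show "\<phi> b \<in> carrier R" "D (b [^] Suc n) = b [^] n \<otimes> \<phi> b" by auto
qed

lemma homogeneous_veronese: "h \<in> G k \<Longrightarrow> int (Suc n) dvd k \<Longrightarrow> h \<in> veronese R G (Suc n)"
  unfolding veronese_span by (rule G_subset_span) auto

lemma homogeneous_pow_veronese: "b \<in> G i \<Longrightarrow> b [^] Suc n \<in> veronese R G (Suc n)"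
  by (rule homogeneous_veronese[OF G_power[of _ i]]) (assumption, rule dvd_triv_left)

text \<open>\<open>D\<close> need not be homogeneous, but its values have degrees divisible by
  \<open>d\<close>. Since b^n has degree n i, which is - i modulo \<open>d\<close>, the factor
  \<open>\<phi> b\<close> lies in the class of \<open>i\<close>.\<close>

lemma root_derivation_range:
  assumes "int e dvd i" "b \<in> G i"
  shows "\<phi> b \<in> span {k. int (Suc n) dvd k - i}"
proof (cases "b = \<zero>")
  case True
  then show ?thesis by (simp add: root_derivation_def)
next
  case False
  have b: "b \<in> carrier R" using assms by auto
  have "int (Suc n) dvd k - i" if "comp (\<phi> b) k \<noteq> \<zero>" for k
  proof -
    have c: "comp (\<phi> b) k \<in> carrier R" using root_derivation_carrier assms by blast
    have "D (b [^] Suc n) \<in> span {k. int (Suc n) dvd k}"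
      using D.D_closed[OF homogeneous_pow_veronese[OF assms(2)]] by (simp add: veronese_span)
    moreover have "comp (D (b [^] Suc n)) (k + int n * i) = b [^] n \<otimes> comp (\<phi> b) k"
      unfolding root_derivation_eq[OF assms] using comp_mult_homogeneous[OF G_power[OF assms(2)] root_derivation_carrier[OF assms]] by simp
    moreover have "b [^] n \<otimes> comp (\<phi> b) k \<noteq> \<zero>"
      using that c pow_nonzero[OF b False] b by (simp add: integral_iff)
    ultimately have "int (Suc n) dvd k + int n * i" by (auto simp: span_def)
    moreover have "k - i = (k + int n * i) - int (Suc n) * i" by (simp add: algebra_simps)
    ultimately show ?thesis by (metis dvd_diff dvd_triv_left)
  qed
  then show ?thesis using root_derivation_carrier[OF assms] by (simp add: span_def)
qed

text \<open>The right-hand side is visibly additive in \<open>b\<close>.\<close>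

lemma root_derivation_linear_formula:
  assumes i: "int e dvd i" and b: "b \<in> G i" and w: "w \<in> G j" and ij: "int (Suc n) dvd i + j"
  shows "w [^] Suc n \<otimes> \<phi> b = ([(Suc n)] \<cdot> \<one>) \<otimes> (w [^] n \<otimes> D (b \<otimes> w)) \<ominus> b \<otimes> D (w [^] Suc n)"
proof (cases "b = \<zero>")
  case True
  have "D (w [^] Suc n) \<in> carrier R" using D.D_carrier homogeneous_pow_veronese w by blast
  then show ?thesis using True w by (simp add: root_derivation_def G_carrier minus_eq)
next
  case False
  have c: "b \<in> carrier R" "w \<in> carrier R" using b w by auto
  have bw: "b \<otimes> w \<in> veronese R G (Suc n)" using homogeneous_veronese[OF G_mult[OF b w] ij] .
  have pw: "b [^] Suc n \<in> veronese R G (Suc n)" "w [^] Suc n \<in> veronese R G (Suc n)"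
    using homogeneous_pow_veronese b w by blast+
  have cD: "D (b \<otimes> w) \<in> carrier R" "D (w [^] Suc n) \<in> carrier R" "D (b [^] Suc n) \<in> carrier R"
    using bw pw by auto
  have cp: "b [^] n \<in> carrier R" "w [^] n \<in> carrier R" "\<phi> b \<in> carrier R" "[(Suc n)] \<cdot> \<one> \<in> carrier R"
    using c root_derivation_carrier[OF i b] by auto
  \<comment> \<open>\<open>D\<close> is computed at (b w)^d in two ways: by the power rule, as
    \<open>b \<otimes> w\<close> is in the Veronese subring, and by the Leibniz rule for b^d and
    w^d.\<close>
  have "[(Suc n)] \<cdot> \<one> \<otimes> (b [^] n \<otimes> w [^] n \<otimes> D (b \<otimes> w)) = D ((b \<otimes> w) [^] Suc n)"
    using c cD unfolding D.D_pow[OF bw] by (subst (2) add_pow_one_mult) (auto simp: nat_pow_distrib)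
  also have "\<dots> = D (b [^] Suc n \<otimes> w [^] Suc n)" using c by (simp only: nat_pow_distrib)
  also have "\<dots> = D (b [^] Suc n) \<otimes> w [^] Suc n \<oplus> b [^] Suc n \<otimes> D (w [^] Suc n)"
    using D.D_mult[OF pw] .
  finally have eq: "[(Suc n)] \<cdot> \<one> \<otimes> (b [^] n \<otimes> w [^] n \<otimes> D (b \<otimes> w)) =
      (b [^] n \<otimes> \<phi> b) \<otimes> w [^] Suc n \<oplus> (b [^] n \<otimes> b) \<otimes> D (w [^] Suc n)"
    by (simp only: root_derivation_eq[OF i b, unfolded nat_pow_Suc] nat_pow_Suc[of b])
  have ws: "w [^] Suc n \<in> carrier R" using c by auto
  let ?rhs = "([(Suc n)] \<cdot> \<one>) \<otimes> (w [^] n \<otimes> D (b \<otimes> w)) \<ominus> b \<otimes> D (w [^] Suc n)"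
  have "b [^] n \<otimes> ?rhs = ([(Suc n)] \<cdot> \<one>) \<otimes> (b [^] n \<otimes> w [^] n \<otimes> D (b \<otimes> w)) \<ominus> (b [^] n \<otimes> b) \<otimes> D (w [^] Suc n)"
    using cp cD(1,2) c(1) by algebra
  also have "\<dots> = b [^] n \<otimes> (w [^] Suc n \<otimes> \<phi> b)"
    unfolding eq using cp cD(1,2) c(1) ws by algebra
  finally have "b [^] n \<otimes> (w [^] Suc n \<otimes> \<phi> b) = b [^] n \<otimes> ?rhs" by simp
  then show ?thesis
    by (rule mult_cancelD[OF _ pow_nonzero[OF c(1) False] cp(1)])
      (intro m_closed minus_closed cp cD(1,2) c ws)+
qed

lemma root_derivation_additive:
  assumes i: "int e dvd i" and x: "x \<in> G i" and y: "y \<in> G i"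
  shows "\<phi> (x \<oplus> y) = \<phi> x \<oplus> \<phi> y"
proof (cases "x = \<zero> \<and> y = \<zero>")
  case True
  then show ?thesis by (simp add: root_derivation_def)
next
  case False
  then obtain z where z: "z \<in> G i" "z \<noteq> \<zero>" using x y by blast
  \<comment> \<open>The exponent \<open>n = d - 1\<close> gives \<open>x \<otimes> w\<close> and
    \<open>y \<otimes> w\<close> the degree d i, so both lie in the domain of
    \<open>D\<close>.\<close>
  define w where "w = z [^] n"
  have w: "w \<in> G (int n * i)" "w \<noteq> \<zero>" 
    unfolding w_def using G_power[OF z(1)] pow_nonzero[OF G_carrier[OF z(1)] z(2)] by auto
  have deg: "int (Suc n) dvd i + int n * i"
    using dvd_triv_left[of "int (Suc n)" i] by (simp add: algebra_simps)
  have xy: "x \<oplus> y \<in> G i" using x y by auto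
  have c: "x \<in> carrier R" "y \<in> carrier R" "w \<in> carrier R" using x y w by auto
  have v: "x \<otimes> w \<in> veronese R G (Suc n)" "y \<otimes> w \<in> veronese R G (Suc n)"
    using homogeneous_veronese[OF G_mult[OF x w(1)] deg] homogeneous_veronese[OF G_mult[OF y w(1)] deg] .
  have cD: "D (x \<otimes> w) \<in> carrier R" "D (y \<otimes> w) \<in> carrier R" "D (w [^] Suc n) \<in> carrier R"
    using v homogeneous_pow_veronese[OF w(1)] by auto
  have cp: "w [^] n \<in> carrier R" "[(Suc n)] \<cdot> \<one> \<in> carrier R" using c by auto
  have "D ((x \<oplus> y) \<otimes> w) = D (x \<otimes> w) \<oplus> D (y \<otimes> w)" using c D.D_add[OF v] by (simp add: l_distr)
  note F = root_derivation_linear_formula[OF i xy w(1) deg, unfolded this]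
    root_derivation_linear_formula[OF i x w(1) deg] root_derivation_linear_formula[OF i y w(1) deg]
  have "w [^] Suc n \<otimes> \<phi> (x \<oplus> y) = w [^] Suc n \<otimes> \<phi> x \<oplus> w [^] Suc n \<otimes> \<phi> y"
    unfolding F using c(1,2) cp cD by algebra
  also have "\<dots> = w [^] Suc n \<otimes> (\<phi> x \<oplus> \<phi> y)"
    using c root_derivation_carrier[OF i x] root_derivation_carrier[OF i y] by (simp add: r_distr)
  finally show ?thesis
    using mult_cancelD pow_nonzero[OF c(3) w(2)] c root_derivation_carrier[OF i x] root_derivation_carrier[OF i y] root_derivation_carrier[OF i xy]
    by (meson a_closed nat_pow_closed)
qed

text \<open>Expand \<open>D\<close> at x^d y^d and cancel (x y)^n.\<close>

lemma root_derivation_leibniz: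
  assumes i: "int e dvd i" and j: "int e dvd j" and x: "x \<in> G i" and y: "y \<in> G j"
  shows "\<phi> (x \<otimes> y) = \<phi> x \<otimes> y \<oplus> x \<otimes> \<phi> y"
proof (cases "x = \<zero> \<or> y = \<zero>")
  case True
  then show ?thesis using x y root_derivation_carrier[OF i x] root_derivation_carrier[OF j y] by (auto simp: root_derivation_def G_carrier)
next
  case False
  have c: "x \<in> carrier R" "y \<in> carrier R" using x y by auto
  have ij: "int e dvd i + j" using i j by simp
  note cp = root_derivation_carrier[OF i x] root_derivation_carrier[OF j y] root_derivation_carrier[OF ij G_mult[OF x y]]
  have cpow: "x [^] n \<in> carrier R" "y [^] n \<in> carrier R" using c by auto
  have "(x \<otimes> y) [^] n \<otimes> \<phi> (x \<otimes> y) = D (x [^] Suc n \<otimes> y [^] Suc n)"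
    unfolding root_derivation_eq[OF ij G_mult[OF x y], symmetric] using c by (simp only: nat_pow_distrib)
  also have "\<dots> = (x [^] n \<otimes> \<phi> x) \<otimes> (y [^] n \<otimes> y) \<oplus> (x [^] n \<otimes> x) \<otimes> (y [^] n \<otimes> \<phi> y)"
    using D.D_mult[OF homogeneous_pow_veronese[OF x] homogeneous_pow_veronese[OF y]] 
    by (simp only: nat_pow_Suc root_derivation_eq[OF i x, unfolded nat_pow_Suc] root_derivation_eq[OF j y, unfolded nat_pow_Suc])
  also have "\<dots> = (x [^] n \<otimes> y [^] n) \<otimes> (\<phi> x \<otimes> y \<oplus> x \<otimes> \<phi> y)"
    using c cp(1,2) cpow by algebra
  also have "x [^] n \<otimes> y [^] n = (x \<otimes> y) [^] n" using c by (simp add: nat_pow_distrib)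
  finally have eq: "(x \<otimes> y) [^] n \<otimes> \<phi> (x \<otimes> y) = (x \<otimes> y) [^] n \<otimes> (\<phi> x \<otimes> y \<oplus> x \<otimes> \<phi> y)" .
  have "x \<otimes> y \<noteq> \<zero>" using False c by (simp add: integral_iff)
  then have "(x \<otimes> y) [^] n \<noteq> \<zero>" using c by (intro pow_nonzero) auto
  with eq show ?thesis by (rule mult_cancelD) (use c cp in auto)
qed

private abbreviation (input) "S \<equiv> {k. int e dvd k}"
private abbreviation (input) "D' \<equiv> extend (\<lambda>_. root_derivation)"

lemma residue_span_subset: "int e dvd i \<Longrightarrow> span {k. int (Suc n) dvd k - i} \<subseteq> span S"
proof (rule span_mono, safe)
  fix k assume "int e dvd i" "int (Suc n) dvd k - i"
  moreover have "int e dvd int (Suc n)" using e by (simp only: int_dvd_int_iff)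
  ultimately have "int e dvd (k - i) + i" using dvd_trans dvd_add by blast
  then show "int e dvd k" by simp
qed

lemma root_extension_facts:
  shows root_extension_homogeneous: "int e dvd k \<Longrightarrow> x \<in> G k \<Longrightarrow> D' x = \<phi> x"
    and root_extension_derivation: "derivation (R\<lparr>carrier := span S\<rparr>) D'"
proof -
  have 1: "\<phi> x \<in> span S" if "k \<in> S" "x \<in> G k" for k x
    using residue_span_subset[of k] root_derivation_range[of k x] that by auto
  have 2: "\<phi> (x \<oplus> y) = \<phi> x \<oplus> \<phi> y" if "k \<in> S" "x \<in> G k" "y \<in> G k" for k x y
    using root_derivation_additive that by auto
  show "int e dvd k \<Longrightarrow> x \<in> G k \<Longrightarrow> D' x = \<phi> x"
    using extend_homogeneous[of S "\<lambda>_. \<phi>", OF 1 2] by auto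
  show "derivation (R\<lparr>carrier := span S\<rparr>) D'"
    by (rule extend_derivation[of S "\<lambda>_. \<phi>", OF 1 2]) (use root_derivation_leibniz in auto)
qed

interpretation D': subring_derivation R "span S" D'
  by (intro subring_derivation.intro domain_axioms subring_derivation_axioms.intro root_extension_derivation
      veronese_subring[of e, unfolded veronese_span])

text \<open>On a homogeneous \<open>h\<close> of the Veronese subring the power rule gives D(h^d) =
  d h^n D(h), so the extension restricts to \<open>d\<close> times \<open>D\<close>. In
  characteristic zero this is nonzero wherever \<open>D\<close> is.\<close>

lemma root_extension_restrict:
  assumes "x \<in> veronese R G (Suc n)"
  shows "x \<in> span S \<and> D' x = [(Suc n)] \<cdot> D x"
  using assms unfolding veronese_span
proof (induction rule: span_induct)
  case zero
  then show ?case by simp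
next
  case (homogeneous i h)
  then have i: "int e dvd i" using e dvd_trans by (metis int_dvd_int_iff mem_Collect_eq)
  have h: "h \<in> veronese R G (Suc n)" using homogeneous homogeneous_veronese by auto
  have "\<phi> h = [(Suc n)] \<cdot> D h"
  proof (cases "h = \<zero>")
    case False
    have c: "h \<in> carrier R" "D h \<in> carrier R" using homogeneous h by auto
    have "h [^] n \<otimes> \<phi> h = [(Suc n)] \<cdot> (h [^] n \<otimes> D h)"
      using root_derivation_eq[OF i homogeneous(2)] D.D_pow[OF h, of n] by simp
    also have "\<dots> = h [^] n \<otimes> [(Suc n)] \<cdot> D h" using c by (subst add_pow_rdistr) auto
    finally show ?thesis
      using mult_cancelD c root_derivation_carrier[OF i homogeneous(2)] pow_nonzero[OF c(1) False]
      by (meson nat_pow_closed add.nat_pow_closed)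
  qed (simp add: root_derivation_def)
  then show ?case using root_extension_homogeneous[OF i homogeneous(2)] G_subset_span i homogeneous by auto
next
  case (add a b)
  then have "a \<in> veronese R G (Suc n)" "b \<in> veronese R G (Suc n)" by (auto simp: veronese_span)
  then have "D (a \<oplus> b) = D a \<oplus> D b" "D a \<in> carrier R" "D b \<in> carrier R" using D.D_add by auto
  then show ?case using add D'.D_add[of a b] add.nat_pow_distrib[of "D a" "D b" "Suc n"]
    by (simp only: span_add)
qed

text \<open>Images of homogeneous elements under the extension may have several components, so the
  nilpotency argument has to run over a whole class of degrees modulo \<open>d\<close>.\<close>

lemma root_extension_class:
  assumes i: "int e dvd i" and "x \<in> span {k. int (Suc n) dvd k - i}"
  shows "D' x \<in> span {k. int (Suc n) dvd k - i}"
  using assms(2)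
proof (induction rule: span_induct)
  case zero
  then show ?case by simp
next
  case (homogeneous j h)
  have "int e dvd int (Suc n)" using e by (simp only: int_dvd_int_iff)
  also have "\<dots> dvd j - i" using homogeneous by simp
  finally have "int e dvd (j - i) + i" using i by (rule dvd_add)
  then have j: "int e dvd j" by simp
  have "{k. int (Suc n) dvd k - j} \<subseteq> {k. int (Suc n) dvd k - i}"
  proof safe
    fix k assume "int (Suc n) dvd k - j"
    then have "int (Suc n) dvd (k - j) + (j - i)" using homogeneous by (intro dvd_add) auto
    then show "int (Suc n) dvd k - i" by simp
  qed
  then show ?case using root_derivation_range[OF j homogeneous(2)] span_mono root_extension_homogeneous[OF j homogeneous(2)] by auto
next
  case (add a b)
  then show ?case using D'.D_add residue_span_subset[OF i] by (auto simp: span_add subset_iff)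
qed

text \<open>For \<open>x\<close> in a class of degrees modulo \<open>d\<close> one has \<open>x\<^sup>d\<^sup>-\<^sup>1 D' x = D (x\<^sup>d)\<close>, so passing from \<open>x\<close>
  to \<open>D' x\<close> lowers the \<open>D\<close>-degree of the \<open>d\<close>-th power by exactly \<open>d\<close>.\<close>

lemma root_extension_nilpotent_class:
  assumes i: "int e dvd i" and x: "x \<in> span {k. int (Suc n) dvd k - i}" and deg: "D.has_degree (x [^] Suc n) N"
  shows "\<exists>k. (D' ^^ k) x = \<zero>"
  using x deg
proof (induction N arbitrary: x rule: less_induct)
  case (less N)
  have xS: "x \<in> span S" using residue_span_subset[OF i] less.prems by auto
  \<comment> \<open>Degree classes add in products, so a \<open>d\<close>-th power falls into the
    class of d i, which is the class of 0.\<close>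
  have powV: "y [^] Suc n \<in> veronese R G (Suc n)" if y: "y \<in> span {k. int (Suc n) dvd k - i}" for y
  proof -
    have "y [^] m \<in> span {k. int (Suc n) dvd k - int m * i}" for m
    proof (induction m)
      case 0
      show ?case using G_subset_span[OF _ one_G0] by simp
    next
      case (Suc m)
      show ?case unfolding nat_pow_Suc
      proof (rule span_mult[OF Suc y])
        fix s t assume "s \<in> {k. int (Suc n) dvd k - int m * i}" "t \<in> {k. int (Suc n) dvd k - i}"
        then have "int (Suc n) dvd (s - int m * i) + (t - i)" by (intro dvd_add) auto
        then show "s + t \<in> {k. int (Suc n) dvd k - int (Suc m) * i}" by (simp add: algebra_simps)
      qed
    qed
    from this[of "Suc n"] have "y [^] Suc n \<in> span {k. int (Suc n) dvd k - int (Suc n) * i}" .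
    also have "{k. int (Suc n) dvd k - int (Suc n) * i} = {k. int (Suc n) dvd k}"
      by (auto simp only: dvd_diff_right_iff dvd_triv_left dvd_diff_left_iff)
    finally show ?thesis by (simp only: veronese_span)
  qed
  have c: "x \<in> carrier R" "D' x \<in> carrier R" using xS by auto
  have xV: "x [^] Suc n \<in> veronese R G (Suc n)" using powV less.prems by blast
  \<comment> \<open>Both sides are the value of the extension at x^d; the common factor
    \<open>d\<close> cancels in characteristic zero.\<close>
  have "[(Suc n)] \<cdot> (x [^] n \<otimes> D' x) = [(Suc n)] \<cdot> D (x [^] Suc n)"
    using D'.D_pow[OF xS, of n] root_extension_restrict[OF xV] by simp
  then have key: "x [^] n \<otimes> D' x = D (x [^] Suc n)"
    using add_pow_cancel[OF char0] c D.D_carrier[OF xV] by (metis m_closed nat_pow_closed zero_less_Suc)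
  have xnz: "x \<noteq> \<zero>" using less.prems(2) by (auto simp: D.has_degree_def)
  show ?case
  proof (cases "D' x = \<zero>")
    case True
    then show ?thesis by (intro exI[of _ 1]) simp
  next
    case False
    have y: "D' x \<in> span {k. int (Suc n) dvd k - i}" using root_extension_class[OF i less.prems(1)] .
    have "(D' x) [^] Suc n \<noteq> \<zero>" using pow_nonzero c False by blast
    then obtain M where M: "D.has_degree ((D' x) [^] Suc n) M"
      using D.has_degree_exists[OF D_nil powV[OF y]] by blast
    have "N \<noteq> 0"
    proof
      assume "N = 0"
      then have "x [^] n \<otimes> D' x = \<zero>" using less.prems(2) key by (simp add: D.has_degree_def)
      then show False using c False xnz pow_nonzero integral by (metis nat_pow_closed)
    qed
    then obtain N' where N': "N = Suc N'" by (cases N) auto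
    \<comment> \<open>Comparing degrees in the \<open>d\<close>-th power of \<open>key\<close> gives
      n N + M = d (N - 1), that is, M = N - d.\<close>
    have "(x [^] Suc n) [^] n \<otimes> (D' x) [^] Suc n = D (x [^] Suc n) [^] Suc n"
      unfolding key[symmetric] using c
      by (simp only: nat_pow_distrib nat_pow_closed nat_pow_pow mult.commute)
    then have "n * N + M = Suc n * N'"
      using D.has_degree_mult[OF char0 D.has_degree_pow[OF char0 less.prems(2), of n] M]
        D.has_degree_pow[OF char0 D.has_degree_D[OF less.prems(2)[unfolded N']], of "Suc n"]
        D.has_degree_unique by metis
    then have "M < N" using N' by simp
    then obtain k where "(D' ^^ k) (D' x) = \<zero>" using less.IH y M by blast
    then have "(D' ^^ Suc k) x = \<zero>" by (simp add: funpow_swap1)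
    then show ?thesis by blast
  qed
qed

lemma root_extension_nilpotent: "locally_nilpotent (R\<lparr>carrier := span S\<rparr>) D'"
proof (rule nilpotent_on_homogeneous[OF root_extension_derivation])
  show "subring (span S) R" using veronese_subring[of e] by (simp add: veronese_span)
  fix k h assume k: "k \<in> S" and h: "h \<in> G k"
  show "\<exists>n. (D' ^^ n) h = \<zero>"
  proof (cases "h = \<zero>")
    case True
    then show ?thesis by (intro exI[of _ 0]) simp
  next
    case False
    then have "h [^] Suc n \<noteq> \<zero>" using pow_nonzero h by blast
    then obtain N where "D.has_degree (h [^] Suc n) N"
      using D.has_degree_exists[OF D_nil homogeneous_pow_veronese[OF h]] by blast
    moreover have "h \<in> span {j. int (Suc n) dvd j - k}" using h by (intro G_subset_span) auto
    ultimately show ?thesis using k by (intro root_extension_nilpotent_class[of k]) auto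
  qed
qed

lemma nonrigid_extension:
  assumes "x \<in> veronese R G (Suc n)" "D x \<noteq> \<zero>"
  shows "\<not> rigid (R\<lparr>carrier := veronese R G e\<rparr>)"
proof
  assume "rigid (R\<lparr>carrier := veronese R G e\<rparr>)"
  moreover have "D' x \<noteq> \<zero>" "x \<in> span S"
    using root_extension_restrict[OF assms(1)] add_pow_nonzero[OF char0 D.D_carrier[OF assms(1)] assms(2), of "Suc n"] by auto
  ultimately show False using root_extension_derivation root_extension_nilpotent by (auto simp: rigid_def veronese_span)
qed

end

end

section \<open>Primes with quotient concentrated in degree zero\<close>

context graded_domain
begin

text \<open>\<phi> is the Euler derivation, multiplication by the degree, times the fraction u / t.
  It sends \<open>t\<close> to l u, so it is a multiple of the derivative with respect to
  \<open>t\<close>. The factor \<open>k\<close> vanishes in degree 0, which is why divisibility by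
  \<open>t\<close> is only asked for in the other degrees.\<close>

lemma nonrigid_of_uniformizer:
  assumes t: "t \<in> G l" "t \<noteq> \<zero>" and u: "u \<in> G 0" "u \<noteq> \<zero>" and l: "l \<noteq> 0" and char0: "char_zero R"
    and dvd: "\<And>k h. k \<noteq> 0 \<Longrightarrow> h \<in> G k \<Longrightarrow> \<exists>r\<in>carrier R. u \<otimes> h = t \<otimes> r"
    and deg: "\<And>k h. h \<in> G k \<Longrightarrow> h \<noteq> \<zero> \<Longrightarrow> \<exists>n::nat. k = int n * l"
  shows "\<not> rigid (R\<lparr>carrier := veronese R G 1\<rparr>)"
proof -
  define \<kappa> where "\<kappa> k = [(k::int)] \<cdot> \<one>" for k
  have \<kappa>c: "\<kappa> k \<in> carrier R" for k by (simp add: \<kappa>_def)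
  have \<kappa>_add: "\<kappa> (i + j) = \<kappa> i \<oplus> \<kappa> j" for i j by (simp add: \<kappa>_def add.int_pow_mult)
  have \<kappa>_0: "\<kappa> 0 = \<zero>" by (simp add: \<kappa>_def add_pow_int_ge)
  have c: "t \<in> carrier R" "u \<in> carrier R" using t u by auto
  define \<phi> where "\<phi> k h = (if k = 0 then \<zero> else \<kappa> k \<otimes> (SOME r. r \<in> carrier R \<and> u \<otimes> h = t \<otimes> r))" for k h
  have \<phi>: "\<phi> k h \<in> carrier R \<and> t \<otimes> \<phi> k h = \<kappa> k \<otimes> (u \<otimes> h)" if "h \<in> G k" for k h
  proof (cases "k = 0")
    case True
    then show ?thesis using that c by (simp add: \<phi>_def \<kappa>_0 G_carrier)
  next
    case False
    define r where "r = (SOME r. r \<in> carrier R \<and> u \<otimes> h = t \<otimes> r)"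
    have r: "r \<in> carrier R \<and> u \<otimes> h = t \<otimes> r" unfolding r_def
      using dvd[OF False that] by (intro someI_ex[of "\<lambda>r. r \<in> carrier R \<and> u \<otimes> h = t \<otimes> r"]) auto
    moreover have "\<phi> k h = \<kappa> k \<otimes> r" using False by (simp add: \<phi>_def r_def)
    ultimately show ?thesis using \<kappa>c c by (simp add: m_lcomm)
  qed
  have \<phi>_eqI: "\<phi> k h = z" if "h \<in> G k" "z \<in> carrier R" "t \<otimes> z = \<kappa> k \<otimes> (u \<otimes> h)" for k h z
    using mult_cancelD[of t "\<phi> k h" z] \<phi>[OF that(1)] that t c by simp
  have 1: "\<phi> k x \<in> span UNIV" if "k \<in> UNIV" "x \<in> G k" for k x
    using \<phi> that by (simp add: span_UNIV)
  have 2: "\<phi> k (x \<oplus> y) = \<phi> k x \<oplus> \<phi> k y" if "k \<in> UNIV" "x \<in> G k" "y \<in> G k" for k x y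
  proof (rule \<phi>_eqI)
    have "t \<otimes> (\<phi> k x \<oplus> \<phi> k y) = t \<otimes> \<phi> k x \<oplus> t \<otimes> \<phi> k y"
      using \<phi> that c by (simp add: r_distr)
    also have "\<dots> = \<kappa> k \<otimes> (u \<otimes> x) \<oplus> \<kappa> k \<otimes> (u \<otimes> y)" using \<phi> that by simp
    also have "\<dots> = \<kappa> k \<otimes> (u \<otimes> (x \<oplus> y))" using that c \<kappa>c by (simp add: r_distr G_carrier)
    finally show "t \<otimes> (\<phi> k x \<oplus> \<phi> k y) = \<kappa> k \<otimes> (u \<otimes> (x \<oplus> y))" .
  qed (use \<phi> that in auto)
  have 3: "\<phi> (i + j) (x \<otimes> y) = \<phi> i x \<otimes> y \<oplus> x \<otimes> \<phi> j y" if "x \<in> G i" "y \<in> G j" for i j x y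
  proof (rule \<phi>_eqI)
    have xy: "x \<in> carrier R" "y \<in> carrier R" using that by auto
    note p = \<phi>[OF that(1)] \<phi>[OF that(2)]
    have "t \<otimes> (\<phi> i x \<otimes> y \<oplus> x \<otimes> \<phi> j y) = (t \<otimes> \<phi> i x) \<otimes> y \<oplus> x \<otimes> (t \<otimes> \<phi> j y)"
      using conjunct1[OF p(1)] conjunct1[OF p(2)] xy c by algebra
    also have "\<dots> = (\<kappa> i \<otimes> (u \<otimes> x)) \<otimes> y \<oplus> x \<otimes> (\<kappa> j \<otimes> (u \<otimes> y))" using p by simp
    also have "\<dots> = (\<kappa> i \<oplus> \<kappa> j) \<otimes> (u \<otimes> (x \<otimes> y))"
      using xy c \<kappa>c[of i] \<kappa>c[of j] by algebra
    finally show "t \<otimes> (\<phi> i x \<otimes> y \<oplus> x \<otimes> \<phi> j y) = \<kappa> (i + j) \<otimes> (u \<otimes> (x \<otimes> y))" by (simp add: \<kappa>_add)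
    show "\<phi> i x \<otimes> y \<oplus> x \<otimes> \<phi> j y \<in> carrier R" using p xy by simp
  qed (use that in auto)
  have der: "derivation (R\<lparr>carrier := span UNIV\<rparr>) (extend \<phi>)"
    by (rule extend_derivation[of UNIV \<phi>, OF 1 2]) (use 3 in auto)
  have hom: "extend \<phi> x = \<phi> k x" if "x \<in> G k" for k x
    by (rule extend_homogeneous[of UNIV \<phi>, OF 1 2]) (use that in auto)
  have sub: "subring (span UNIV) R" by (rule span_subring) auto
  interpret E: subring_derivation R "span UNIV" "extend \<phi>"
    by (intro subring_derivation.intro domain_axioms subring_derivation_axioms.intro der sub)
  have "locally_nilpotent (R\<lparr>carrier := span UNIV\<rparr>) (extend \<phi>)"
  proof (rule nilpotent_on_homogeneous[OF der sub])
    \<comment> \<open>Each application lowers the degree by \<open>l\<close>, and degree 0 is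
      killed, so \<open>n + 1\<close> applications suffice in degree n l.\<close>
    have nil: "((extend \<phi>) ^^ Suc n) h = \<zero>" if "h \<in> G (int n * l)" for n h
      using that
    proof (induction n arbitrary: h)
      case 0
      then have "h \<in> G 0" by simp
      moreover have "\<phi> 0 h = \<zero>" by (simp add: \<phi>_def)
      ultimately show ?case using hom[of h 0] by simp
    next
      case (Suc n)
      note p = \<phi>[OF Suc.prems]
      have "\<kappa> (int (Suc n) * l) \<in> G 0"
      proof -
        have "[m] \<cdot> \<one> \<in> G 0" for m :: nat
          by (induction m) (auto intro: one_G0)
        then show ?thesis unfolding \<kappa>_def using G_minus
          by (cases "int (Suc n) * l \<ge> 0") (simp_all add: add_pow_int_ge add_pow_int_lt)
      qed
      then have "\<kappa> (int (Suc n) * l) \<otimes> (u \<otimes> h) \<in> G (0 + (0 + int (Suc n) * l))"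
        using u Suc.prems by (intro G_mult)
      then obtain r where r: "r \<in> G (0 + (0 + int (Suc n) * l) - l)" "\<kappa> (int (Suc n) * l) \<otimes> (u \<otimes> h) = t \<otimes> r"
        using homogeneous_quotient[OF t(1)] p by metis
      have "\<phi> (int (Suc n) * l) h = r" using r Suc.prems by (intro \<phi>_eqI) auto
      then have "extend \<phi> h = r" using hom Suc.prems by simp
      moreover have "r \<in> G (int n * l)" using r(1) by (simp add: algebra_simps)
      ultimately show ?case using Suc.IH by (simp add: funpow_swap1)
    qed
    fix k h assume h: "h \<in> G k"
    show "\<exists>n. ((extend \<phi>) ^^ n) h = \<zero>"
    proof (cases "h = \<zero>")
      case True
      then show ?thesis by (intro exI[of _ 0]) simp
    next
      case False
      then obtain n where "k = int n * l" using deg h by blast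
      then show ?thesis using nil h by blast
    qed
  qed
  moreover have "extend \<phi> t \<noteq> \<zero>"
  proof
    assume "extend \<phi> t = \<zero>"
    then have "\<kappa> l \<otimes> (u \<otimes> t) = \<zero>" using \<phi>[OF t(1)] hom[OF t(1)] c by simp
    then have "\<kappa> l = \<zero>" using t u c \<kappa>c by (simp add: integral_iff)
    moreover have "[m] \<cdot> \<one> \<noteq> \<zero>" if "m > 0" for m :: nat using char0 that by (simp add: char_zero_def)
    ultimately show False using l unfolding \<kappa>_def
      by (cases "l \<ge> 0") (auto simp: add_pow_int_ge add_pow_int_lt)
  qed
  moreover have "t \<in> span UNIV" using c by (simp add: span_UNIV)
  ultimately show ?thesis using der by (auto simp: rigid_def veronese_span)
qed

text \<open>All homogeneous elements outside \<open>P\<close> have degree 0. Finite divisibility by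
  t / u writes each nonzero homogeneous element as (t / u)^n times an element outside
  \<open>P\<close>, so its degree is a nonnegative multiple of the degree of
  \<open>t\<close>.\<close>

theorem nonrigid_of_degree_zero_quotient:
  assumes N: "noetherian_in (carrier R)" and normal: "normal_domain R" and char0: "char_zero R"
    and P: "P \<in> height_one_homogeneous_primes R G"
    and P0: "\<And>k h. h \<in> G k \<Longrightarrow> k \<noteq> 0 \<Longrightarrow> h \<in> P"
    and x: "x \<in> G i" "x \<noteq> \<zero>" "i \<noteq> 0"
  shows "\<not> rigid (R\<lparr>carrier := veronese R G 1\<rparr>)"
proof -
  have prime: "primeideal P R" and ht: "height R P = 1"
    using P by (auto simp: height_one_homogeneous_primes_def)
  have id: "ideal P R" using prime by (rule primeideal.axioms)
  have xP: "x \<in> P" using P0 x by blast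
  have one: "\<one> \<notin> P" by (rule primeideal_one_notin[OF prime])
  have zero: "\<zero> \<in> P" using additive_subgroup.zero_closed[OF ideal.axioms(1)[OF id]] .
  \<comment> \<open>A homogeneous conductor missing \<open>?W\<close> lies in \<open>P\<close>; as
    it is prime and contains the nonzero \<open>x\<close>, height one will force it to equal
    \<open>P\<close>.\<close>
  let ?W = "(\<Union>i. G i) - P"
  have xc: "x \<in> carrier R" using x by auto
  have disj: "conductor x \<one> \<inter> ?W = {}"
  proof -
    have "s \<in> P" if "s \<in> conductor x \<one>" for s
      using that ideal.I_r_closed[OF id xP] by (auto simp: conductor_def)
    then show ?thesis by blast
  qed
  obtain b k where b: "b \<in> G k" "primeideal (conductor x b) R" "conductor x b \<inter> ?W = {}"
  proof (rule prime_conductor[OF N x(1) one_G0 _ _ _ disj])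
    show "v \<otimes> w \<in> ?W" if "v \<in> ?W" "w \<in> ?W" for v w
      using that primeideal.I_prime[OF prime, of v w] G_mult by blast
  qed (use one one_G0 in auto)
  have bc: "b \<in> carrier R" using b by auto
  have "conductor x b \<subseteq> P"
  proof
    fix s assume s: "s \<in> conductor x b"
    then have sc: "s \<in> carrier R" by (simp add: conductor_def)
    have "comp s m \<in> P" for m
      using conductor_comps[OF x(1) b(1) s, of m] b(3) comp_G[OF sc, of m] by blast
    then show "s \<in> P" by (rule ideal_comps[OF id sc])
  qed
  moreover have "x \<in> conductor x b" using conductorI[of x b b x] xc bc by auto
  ultimately have PQ: "conductor x b = P" using height_one_primeD[OF ht prime b(2)] x(2) by blast
  obtain t u l where tu: "t \<in> G l" "t \<in> P" "u \<in> G (l + k - i)" "u \<notin> P" "t \<otimes> b = x \<otimes> u"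
    by (rule conductor_uniformizer[OF N normal x(1,2) b(1), unfolded PQ, OF one])
  have "l + k - i = 0" using P0 tu by blast
  then have u: "u \<in> G 0" using tu by simp
  have c: "t \<in> carrier R" "u \<in> carrier R" using tu by auto
  have unz: "u \<noteq> \<zero>" using tu zero by blast
  have dvd: "\<exists>r\<in>carrier R. u \<otimes> p = t \<otimes> r" if "p \<in> P" for p
    using uniformizer_divides[OF xc x(2) bc c tu(5)] that PQ by simp
  have tnz: "t \<noteq> \<zero>"
  proof
    assume "t = \<zero>"
    then have "u \<otimes> x = \<zero>" using dvd[OF xP] by auto
    then show False using unz x(2) c xc by (simp add: integral_iff)
  qed
  \<comment> \<open>\<open>good s\<close> says s = (t / u)^n r with \<open>r\<close> homogeneous
    outside \<open>P\<close>: the order of \<open>s\<close> at \<open>P\<close> is finite.\<close>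
  define good where "good s \<longleftrightarrow> (\<exists>n::nat. \<exists>r j. r \<in> G j \<and> r \<notin> P \<and> u [^] n \<otimes> s = t [^] n \<otimes> r)" for s
  have goodI: "good s" if "r \<in> G j" "r \<notin> P" "u [^] n \<otimes> s = t [^] n \<otimes> r" for s r j and n :: nat
    unfolding good_def using that by blast
  let ?T = "{s \<in> P. s \<noteq> \<zero> \<and> (\<exists>j. s \<in> G j) \<and> \<not> good s}"
  \<comment> \<open>For \<open>s\<close> in \<open>?T\<close> the quotient u s / t is again in
    \<open>?T\<close>, so a member of \<open>?T\<close> could be divided for ever.\<close>
  have "?T = {}"
  proof (rule no_infinite_division[OF N prime tu(2) c(2) tu(4)])
    show "?T \<subseteq> carrier R" by auto
    fix s assume "s \<in> ?T"
    then obtain j where s: "s \<in> P" "s \<noteq> \<zero>" "s \<in> G j" "\<not> good s" by blast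
    obtain r0 where r0: "r0 \<in> carrier R" "u \<otimes> s = t \<otimes> r0" using dvd s by blast
    then obtain r where r: "r \<in> G (0 + j - l)" "u \<otimes> s = t \<otimes> r"
      using homogeneous_quotient[OF tu(1) G_mult[OF u s(3)] r0] by blast
    have rc: "r \<in> carrier R" "s \<in> carrier R" using r s by auto
    have "r \<in> P"
    proof (rule ccontr)
      assume "r \<notin> P"
      then have "good s" using goodI[OF r(1), of 1 s] r(2) c by simp
      then show False using s(4) by simp
    qed
    moreover have "r \<noteq> \<zero>" using r(2) unz s(2) c rc integral_iff[of u s] by auto
    moreover have "\<not> good r"
    proof
      assume "good r"
      then obtain n :: nat and q j' where q: "q \<in> G j'" "q \<notin> P" "u [^] n \<otimes> r = t [^] n \<otimes> q"
        unfolding good_def by blast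
      have "u [^] Suc n \<otimes> s = u [^] n \<otimes> (t \<otimes> r)" using c rc by (simp add: m_assoc r(2))
      also have "\<dots> = t \<otimes> (u [^] n \<otimes> r)" using c rc by (simp add: m_lcomm)
      also have "\<dots> = t [^] Suc n \<otimes> q" using c q(1) unfolding q(3) by (simp add: m_ac G_carrier)
      finally have "good s" by (rule goodI[OF q(1,2)])
      then show False using s(4) by simp
    qed
    ultimately have "r \<in> ?T" using r(1) by blast
    then show "\<exists>r\<in>?T. u \<otimes> s = t \<otimes> r" using r(2) by blast
  qed auto
  then have good: "good s" if "s \<in> G j" "s \<noteq> \<zero>" for s j
  proof (cases "s \<in> P")
    case False
    then show ?thesis using goodI[OF that(1), of 0 s] by simp
  qed (use that in blast)
  have deg: "\<exists>n::nat. j = int n * l" if s: "s \<in> G j" "s \<noteq> \<zero>" for j s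
  proof -
    obtain n :: nat and r j' where r: "r \<in> G j'" "r \<notin> P" "u [^] n \<otimes> s = t [^] n \<otimes> r"
      using good[OF s] unfolding good_def by blast
    have "j' = 0" using P0 r by blast
    then have "t [^] n \<otimes> r \<in> G (int n * l + 0)" using G_mult[OF G_power[OF tu(1)]] r by blast
    moreover have "u [^] n \<otimes> s \<in> G (int n * 0 + j)" using G_mult[OF G_power[OF u] s(1)] .
    moreover have "u [^] n \<otimes> s \<noteq> \<zero>"
      using s pow_nonzero[OF c(2) unz] c by (simp add: integral_iff G_carrier)
    ultimately have "int n * l + 0 = int n * 0 + j" unfolding r(3) by (intro G_disjoint)
    then show ?thesis by (intro exI[of _ n]) simp
  qed
  have "l \<noteq> 0" using deg[OF x(1,2)] x(3) by auto
  then show ?thesis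
    by (rule nonrigid_of_uniformizer[OF tu(1) tnz u unz _ char0 dvd[OF P0] deg])
qed

end

section \<open>Degrees of homogeneous elements outside a prime\<close>

lemma int_subgroup_principal:
  fixes H :: "int set"
  assumes "H \<noteq> {}" and diff: "\<And>x y. x \<in> H \<Longrightarrow> y \<in> H \<Longrightarrow> x - y \<in> H"
  shows "\<exists>g. \<forall>z. z \<in> H \<longleftrightarrow> g dvd z"
proof -
  have zero: "0 \<in> H" using assms by (metis all_not_in_conv diff_self)
  have neg: "- x \<in> H" if "x \<in> H" for x using diff[OF zero that] by simp
  have add: "x + y \<in> H" if "x \<in> H" "y \<in> H" for x y using diff[OF that(1) neg[OF that(2)]] by simp
  have mult: "int n * x \<in> H" if "x \<in> H" for n x
    by (induction n) (use zero add that in \<open>auto simp: algebra_simps\<close>)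
  have zmult: "k * x \<in> H" if "x \<in> H" for k x
  proof (cases "k \<ge> 0")
    case True
    then show ?thesis using mult[OF that, of "nat k"] by simp
  next
    case False
    then show ?thesis using neg[OF mult[OF that, of "nat (- k)"]] by simp
  qed
  show ?thesis
  proof (cases "H = {0}")
    case True
    then show ?thesis by (intro exI[of _ 0]) simp
  next
    case False
    then obtain h where "h \<in> H" "h \<noteq> 0" using zero by auto
    then have "\<exists>n. n > 0 \<and> int n \<in> H"
      using neg by (intro exI[of _ "nat \<bar>h\<bar>"]) (auto simp: abs_if)
    then have L: "(LEAST n. n > 0 \<and> int n \<in> H) > 0 \<and> int (LEAST n. n > 0 \<and> int n \<in> H) \<in> H"
      by (rule LeastI_ex)
    define g where "g = (LEAST n. n > 0 \<and> int n \<in> H)"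
    have g: "g > 0" "int g \<in> H" using L by (auto simp: g_def)
    have "int g dvd z" if "z \<in> H" for z
    proof -
      have m: "z mod int g \<in> H"
        using diff[OF that zmult[OF g(2), of "z div int g"]] by (simp add: minus_div_mult_eq_mod)
      have "nat (z mod int g) < g" using g(1) by (simp add: nat_less_iff)
      then have "\<not> (nat (z mod int g) > 0 \<and> int (nat (z mod int g)) \<in> H)"
        using not_less_Least unfolding g_def by blast
      then have "z mod int g = 0"
        using m g(1) pos_mod_sign[of "int g" z] by (auto simp: not_less dest: order_antisym)
      then show ?thesis by auto
    qed
    moreover have "z \<in> H" if "int g dvd z" for z
      using that zmult[OF g(2)] by (auto elim!: dvdE simp: mult.commute)
    ultimately show ?thesis by blast
  qed
qed

context graded_domain
begin

lemma quotient_degrees: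
  assumes "ideal P R"
  shows "e_grading (R Quot P) (quotient_grading R G P) = nat (Gcd {k. \<exists>h\<in>G k. h \<notin> P})"
proof -
  have "quotient_grading R G P k \<noteq> {\<zero>\<^bsub>R Quot P\<^esub>} \<longleftrightarrow> (\<exists>h\<in>G k. h \<notin> P)" for k
  proof -
    have "P +> h = P \<longleftrightarrow> h \<in> P" if "h \<in> G k" for h
      using that ideal.rcos_const_imp_mem[OF assms G_carrier]
        abelian_subgroup.a_rcos_const[OF abelian_subgroupI3[OF ideal.axioms(1)[OF assms] is_abelian_group]]
      by blast
    moreover have "G k \<noteq> {}" using G_zero by blast
    ultimately show ?thesis unfolding quotient_grading_def FactRing_def by auto
  qed
  then show ?thesis unfolding e_grading_def by simp
qed

text \<open>Modulo \<open>d\<close>, the degrees of homogeneous elements outside \<open>P\<close>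
  form a subgroup, because \<open>P\<close> is prime and a power with exponent \<open>d - 1\<close>
  inverts a class. Its generator divides \<open>d\<close> and every such degree, hence also
  \<open>- i\<close>.\<close>

lemma degree_outside_prime:
  assumes P: "primeideal P R" and d: "d > 0"
    and i: "int (gcd d (nat (Gcd {k. \<exists>h\<in>G k. h \<notin> P}))) dvd i"
  shows "\<exists>j w. w \<in> G j \<and> w \<notin> P \<and> int d dvd i + j"
proof -
  let ?T = "{k. \<exists>h\<in>G k. h \<notin> P}"
  have id: "ideal P R" using P by (rule primeideal.axioms)
  have one: "\<one> \<notin> P" by (rule primeideal_one_notin[OF P])
  obtain n where n: "d = Suc n" using d by (cases d) auto
  define H where "H = {z. \<exists>j w. w \<in> G j \<and> w \<notin> P \<and> int d dvd z - j}"
  have T: "?T \<subseteq> H" unfolding H_def by force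
  have dH: "int d \<in> H" "0 \<in> H" unfolding H_def using one one_G0 by (auto intro!: exI[of _ 0] exI[of _ \<one>])
  have "z1 - z2 \<in> H" if H: "z1 \<in> H" "z2 \<in> H" for z1 z2
  proof -
    obtain j1 w1 j2 w2 where *: "w1 \<in> G j1" "w1 \<notin> P" "int d dvd z1 - j1"
      "w2 \<in> G j2" "w2 \<notin> P" "int d dvd z2 - j2" using H unfolding H_def by blast
    have "w1 \<otimes> w2 [^] n \<in> G (j1 + int n * j2)" using * G_mult G_power by blast
    moreover have "w1 \<otimes> w2 [^] n \<notin> P"
      using primeideal.I_prime[OF P, of w1 "w2 [^] n"] * primeideal_pow_notin[OF P, of w2 n] by auto
    moreover have "int d dvd (z1 - j1) - (z2 - j2) - int d * j2" using * by simp
    moreover have "(z1 - j1) - (z2 - j2) - int d * j2 = (z1 - z2) - (j1 + int n * j2)"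
      by (simp add: n algebra_simps)
    ultimately show ?thesis unfolding H_def by (metis (mono_tags, lifting) mem_Collect_eq)
  qed
  then obtain g where g: "\<And>z. z \<in> H \<longleftrightarrow> g dvd z"
    using int_subgroup_principal[of H] dH(2) by blast
  have "g dvd Gcd ?T" using T g by (intro Gcd_greatest) auto
  moreover have "int (nat (Gcd ?T)) = Gcd ?T" by simp
  ultimately have "g dvd int (gcd d (nat (Gcd ?T)))"
    using dH(1) g by (simp only: gcd_int_int_eq[symmetric]) simp
  then have "g dvd - i" using i dvd_trans by simp
  then have "- i \<in> H" using g by blast
  then obtain j w where w: "w \<in> G j" "w \<notin> P" "int d dvd - i - j" unfolding H_def by blast
  have "int d dvd - (- i - j)" using w(3) by (simp only: dvd_minus_iff)
  then have "int d dvd i + j" by (simp add: add.commute)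
  then show ?thesis using w by blast
qed

text \<open>In a domain the product of leading terms is the leading term of the product, at either
  end. Hence the highest degrees of \<open>u\<close> and \<open>v\<close> add up to 0, and so do the
  lowest ones, which leaves \<open>u\<close> with a single degree.\<close>

lemma unit_homogeneous:
  assumes u: "u \<in> carrier R" "v \<in> carrier R" "u \<otimes> v = \<one>"
  obtains i where "u \<in> G i"
proof -
  have nz: "u \<noteq> \<zero>" "v \<noteq> \<zero>" using u by auto
  have z: "ideal {\<zero>} R" by (rule zeroideal)
  have lead: "\<exists>i j h l. h \<in> G i \<and> h \<noteq> \<zero> \<and> l \<in> span {k. \<sigma> * k < \<sigma> * i} \<and> u = h \<oplus> l \<and> i + j = 0 \<and>
      (\<exists>h' l'. h' \<in> G j \<and> h' \<noteq> \<zero> \<and> l' \<in> span {k. \<sigma> * k < \<sigma> * j} \<and> v = h' \<oplus> l')"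
    if "\<sigma> \<noteq> 0" for \<sigma> :: int
  proof -
    obtain i h l q where 1: "h \<in> G i" "h \<notin> {\<zero>}" "l \<in> span {k. \<sigma> * k < \<sigma> * i}" "q \<in> {\<zero>}" "u = h \<oplus> l \<oplus> q"
      by (rule leading_decomposition[OF z u(1) _ \<open>\<sigma> \<noteq> 0\<close>]) (use nz in auto)
    obtain j h' l' q' where 2: "h' \<in> G j" "h' \<notin> {\<zero>}" "l' \<in> span {k. \<sigma> * k < \<sigma> * j}" "q' \<in> {\<zero>}" "v = h' \<oplus> l' \<oplus> q'"
      by (rule leading_decomposition[OF z u(2) _ \<open>\<sigma> \<noteq> 0\<close>]) (use nz in auto)
    have c: "h \<in> carrier R" "l \<in> carrier R" "h' \<in> carrier R" "l' \<in> carrier R" using 1 2 by auto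
    have uv: "u = h \<oplus> l" "v = h' \<oplus> l'" using 1 2 c by auto
    have "comp \<one> (i + j) = h \<otimes> h'" using leading_product[OF 1(1,3) 2(1,3)] u(3) uv by simp
    moreover have "h \<otimes> h' \<noteq> \<zero>" using 1 2 c by (simp add: integral_iff)
    ultimately have "i + j = 0" using comp_homogeneous[OF one_G0] by (auto split: if_splits)
    then show ?thesis using 1 2 uv by blast
  qed
  have bound: "\<sigma> * k \<le> \<sigma> * i" if "b = h \<oplus> l" "h \<in> G i" "l \<in> span {k. \<sigma> * k < \<sigma> * i}" "comp b k \<noteq> \<zero>"
    for \<sigma> k i :: int and b h l
  proof (rule ccontr)
    assume "\<not> \<sigma> * k \<le> \<sigma> * i"
    then have "comp h k = \<zero>" "comp l k = \<zero>" using that by (auto simp: comp_homogeneous span_def)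
    then have "comp b k = \<zero>" using that comp_add[of h l k] by auto
    then show False using that by simp
  qed
  have top: "comp b i = h" if "b = h \<oplus> l" "h \<in> G i" "l \<in> span {k. \<sigma> * k < \<sigma> * i}"
    for \<sigma> i :: int and b h l
  proof -
    have "comp l i = \<zero>" using that by (auto simp: span_def)
    then show ?thesis using that comp_add[of h l i] by (simp add: comp_homogeneous span_carrier G_carrier)
  qed
  obtain i j h l h' l' where a: "h \<in> G i" "h \<noteq> \<zero>" "l \<in> span {k. 1 * k < 1 * i}" "u = h \<oplus> l" "i + j = 0"
    "h' \<in> G j" "h' \<noteq> \<zero>" "l' \<in> span {k. 1 * k < 1 * j}" "v = h' \<oplus> l'" using lead[of 1] by auto
  obtain i2 j2 h2 l2 h2' l2' where b: "h2 \<in> G i2" "h2 \<noteq> \<zero>" "l2 \<in> span {k. - 1 * k < - 1 * i2}" "u = h2 \<oplus> l2" "i2 + j2 = 0"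
    "h2' \<in> G j2" "h2' \<noteq> \<zero>" "l2' \<in> span {k. - 1 * k < - 1 * j2}" "v = h2' \<oplus> l2'"
    using lead[of "- 1"] by auto
  have "i2 \<le> i" using bound[OF a(4,1,3), of i2] top[OF b(4,1,3)] b(2) by simp
  moreover have "j2 \<le> j" using bound[OF a(9,6,8), of j2] top[OF b(9,6,8)] b(7) by simp
  ultimately have "i2 = i" using a(5) b(5) by simp
  have "u \<in> span {i}"
  proof -
    have "k = i" if "comp u k \<noteq> \<zero>" for k
      using bound[OF a(4,1,3) that] bound[OF b(4,1,3) that] \<open>i2 = i\<close> by simp
    then show ?thesis using u by (auto simp: span_def)
  qed
  have lc: "l \<in> carrier R" using a(3) by auto
  have "comp l k = \<zero>" for k
  proof (cases "k < i")
    case True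
    then have "comp u k = comp l k"
      using comp_add[OF G_carrier[OF a(1)] lc, of k] comp_carrier[OF lc] a(4) by (simp add: comp_homogeneous[OF a(1)])
    moreover have "comp u k = \<zero>" using \<open>u \<in> span {i}\<close> True unfolding span_def by blast
    ultimately show ?thesis by simp
  qed (use a(3) in \<open>auto simp: span_def\<close>)
  then have "l = \<zero>" using nonzero_comp[OF lc] by blast
  then show thesis using that[of i] a(1,4) by (simp add: G_carrier)
qed

text \<open>Nonzero elements of \<open>F\<close> are units, hence homogeneous. If a nonzero
  \<open>a\<close> had nonzero degree, then \<open>\<one> \<oplus> a\<close>, again in
  \<open>F\<close>, would have two nonzero components.\<close>

lemma subfield_degree_zero:
  assumes F: "F \<subseteq> carrier R" "\<And>a. a \<in> F \<Longrightarrow> \<one> \<oplus> a \<in> F"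
    and inv: "\<And>a. a \<in> F \<Longrightarrow> a \<noteq> \<zero> \<Longrightarrow> \<exists>b\<in>F. b \<otimes> a = \<one>"
  shows "F \<subseteq> G 0"
proof
  fix a assume a: "a \<in> F"
  then have ac: "a \<in> carrier R" using F by auto
  have hom: "\<exists>i. b \<in> G i" if "b \<in> F" "b \<noteq> \<zero>" for b
  proof -
    obtain c where "c \<in> F" "c \<otimes> b = \<one>" using inv \<open>b \<in> F\<close> \<open>b \<noteq> \<zero>\<close> by blast
    then show ?thesis
      using unit_homogeneous[of b c] F \<open>b \<in> F\<close> by (metis m_comm subsetD)
  qed
  show "a \<in> G 0"
  proof (cases "a = \<zero> \<or> \<one> \<oplus> a = \<zero>")
    case True
    then show ?thesis
    proof
      assume "\<one> \<oplus> a = \<zero>"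
      then have "a = \<ominus> \<one>" using ac by (metis add.m_comm minus_equality one_closed)
      then show ?thesis using G_minus[OF one_G0] by simp
    qed simp
  next
    case False
    then obtain i j where ij: "a \<in> G i" "\<one> \<oplus> a \<in> G j" using hom a F by metis
    have "i = 0"
    proof (rule ccontr)
      assume "i \<noteq> 0"
      then have "comp (\<one> \<oplus> a) 0 = \<one>" "comp (\<one> \<oplus> a) i = a"
        using comp_add[OF one_closed ac] ij(1) ac by (auto simp: comp_homogeneous[OF one_G0] comp_homogeneous[OF ij(1)])
      then have "j = 0" "j = i"
        using comp_homogeneous[OF ij(2)] False by (auto split: if_splits)
      then show False using \<open>i \<noteq> 0\<close> by simp
    qed
    then show ?thesis using ij by simp
  qed
qed

text \<open>Let \<open>?g\<close> be the gcd on the right. Elements that agree modulo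
  \<open>P\<close> with one whose degrees are multiples of \<open>?g\<close> form a subring
  containing the generators, hence the whole ring. Taking the component of degree \<open>k\<close>
  of a homogeneous element outside \<open>P\<close> then shows that \<open>?g\<close> divides
  \<open>k\<close>.\<close>

lemma degrees_of_generators:
  assumes P: "primeideal P R" and hP: "homogeneous_ideal R G P"
    and gen: "generate_ring R (F \<union> S) = carrier R" and F: "F \<subseteq> G 0" and S: "S \<subseteq> carrier R"
  shows "Gcd {k. \<exists>h\<in>G k. h \<notin> P} = Gcd {k. \<exists>s\<in>S. comp s k \<notin> P}"
proof -
  have id: "ideal P R" using P by (rule primeideal.axioms)
  have sub: "additive_subgroup P R" using id by (rule ideal.axioms)
  let ?g = "Gcd {k. \<exists>s\<in>S. comp s k \<notin> P}"
  let ?V = "span {k. ?g dvd k}"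
  have V: "subring ?V R" by (rule span_subring) auto
  note VE = subringE[OF V]
  let ?C = "{b. \<exists>v\<in>?V. \<exists>q\<in>P. b = v \<oplus> q}"
  have Pc: "q \<in> P \<Longrightarrow> q \<in> carrier R" for q using ideal.Icarr[OF id] .
  have CI: "v \<oplus> q \<in> ?C" if "v \<in> ?V" "q \<in> P" for v q using that by blast
  have CV: "v \<in> ?C" if "v \<in> ?V" for v
    using CI[OF that additive_subgroup.zero_closed[OF sub]] that by (simp add: span_carrier)
  have CP: "q \<in> ?C" if "q \<in> P" for q
    using CI[OF span_zero that] that Pc by simp
  have Cadd: "a \<oplus> b \<in> ?C" if "a \<in> ?C" "b \<in> ?C" for a b
  proof -
    obtain v q w r where *: "v \<in> ?V" "q \<in> P" "a = v \<oplus> q" "w \<in> ?V" "r \<in> P" "b = w \<oplus> r"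
      using \<open>a \<in> ?C\<close> \<open>b \<in> ?C\<close> by blast
    have "a \<oplus> b = (v \<oplus> w) \<oplus> (q \<oplus> r)"
      unfolding * using * Pc span_carrier by (simp add: a_ac)
    then show ?thesis using CI[OF span_add[OF *(1,4)] additive_subgroup.a_closed[OF sub *(2,5)]] by simp
  qed
  have homC: "comp s k \<in> ?C" if "s \<in> S" for s k
  proof (cases "comp s k \<in> P")
    case False
    then have "?g dvd k" using that by (intro Gcd_dvd) auto
    then show ?thesis using that S comp_G by (intro CV G_subset_span[of k]) auto
  qed (rule CP)
  have "b \<in> ?C" if "b \<in> generate_ring R (F \<union> S)" for b
    using that
  proof (induction rule: generate_ring.induct)
    case one
    then show ?case using CV[OF VE(3)] .
  next
    case (incl h)
    then show ?case
    proof
      assume "h \<in> F"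
      then show ?thesis using F by (intro CV G_subset_span[of 0]) auto
    next
      assume h: "h \<in> S"
      then have hc: "h \<in> carrier R" using S by auto
      have "(\<Oplus>i\<in>I. comp h i) \<in> ?C" if "finite I" for I
        using that
      proof (induction I rule: finite_induct)
        case empty
        then show ?case using CV[OF span_zero] by simp
      next
        case (insert x I)
        then have "(\<Oplus>i\<in>insert x I. comp h i) = comp h x \<oplus> (\<Oplus>i\<in>I. comp h i)"
          using hc by (intro finsum_insert) auto
        then show ?case using Cadd[OF homC[OF h, of x] insert.IH] by (simp only:)
      qed
      from this[OF finite_supp[OF hc]] show ?thesis by (simp only: finsum_comp[OF hc, symmetric])
    qed
  next
    case (a_inv h)
    then obtain v q where *: "v \<in> ?V" "q \<in> P" "h = v \<oplus> q" by blast
    have "\<ominus> h = \<ominus> v \<oplus> \<ominus> q" unfolding * using * Pc by (simp add: minus_add span_carrier)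
    then show ?case using CI[OF span_minus[OF *(1)] additive_subgroup.a_inv_closed[OF sub *(2)]] by simp
  next
    case (eng_add h1 h2)
    then show ?case using Cadd by blast
  next
    case (eng_mult h1 h2)
    then obtain v q w r where *: "v \<in> ?V" "q \<in> P" "h1 = v \<oplus> q" "w \<in> ?V" "r \<in> P" "h2 = w \<oplus> r" by blast
    have c: "v \<in> carrier R" "q \<in> carrier R" "w \<in> carrier R" "r \<in> carrier R" using * Pc by auto
    have "h1 \<otimes> h2 = v \<otimes> w \<oplus> (q \<otimes> (w \<oplus> r) \<oplus> v \<otimes> r)" unfolding * using c by algebra
    moreover have "q \<otimes> (w \<oplus> r) \<oplus> v \<otimes> r \<in> P"
      using * c by (intro additive_subgroup.a_closed[OF sub] ideal.I_r_closed[OF id] ideal.I_l_closed[OF id]) auto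
    ultimately show ?case using CI[OF VE(6)[OF *(1,4)]] by simp
  qed
  then have all: "b \<in> ?C" if "b \<in> carrier R" for b using gen that by simp
  have "?g dvd k" if h: "h \<in> G k" "h \<notin> P" for h k
  proof -
    obtain v q where *: "v \<in> ?V" "q \<in> P" "h = v \<oplus> q" using all[OF G_carrier[OF h(1)]] by blast
    have "h = comp v k \<oplus> comp q k"
      using comp_add[of v q k] * comp_homogeneous[OF h(1)] Pc by auto
    moreover have "comp q k \<in> P" using homogeneous_ideal_comps[OF hP *(2)] .
    ultimately have "comp v k \<noteq> \<zero>" using h(2) Pc by auto
    then show ?thesis using *(1) by (auto simp: span_def)
  qed
  then have "?g dvd Gcd {k. \<exists>h\<in>G k. h \<notin> P}" by (intro Gcd_greatest) auto
  moreover have "Gcd {k. \<exists>h\<in>G k. h \<notin> P} dvd ?g"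
    by (intro Gcd_greatest Gcd_dvd) (use S comp_G in blast)
  ultimately show ?thesis by (simp add: zdvd_antisym_nonneg)
qed

text \<open>By \<open>degrees_of_generators\<close> every value is the gcd of a subset of one finite
  set, the degrees occurring in the generators.\<close>

lemma finite_quotient_degrees:
  assumes gen: "generate_ring R (F \<union> S) = carrier R" and F: "F \<subseteq> G 0" and S: "S \<subseteq> carrier R" "finite S"
  shows "finite ((\<lambda>P. e_grading (R Quot P) (quotient_grading R G P)) ` height_one_homogeneous_primes R G)"
proof -
  let ?D = "\<Union>s\<in>S. {k. comp s k \<noteq> \<zero>}"
  have "finite ?D" using S finite_supp by auto
  then have "finite ((\<lambda>T. nat (Gcd T)) ` Pow ?D)" by simp
  moreover have "e_grading (R Quot P) (quotient_grading R G P) \<in> (\<lambda>T. nat (Gcd T)) ` Pow ?D"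
    if "P \<in> height_one_homogeneous_primes R G" for P
  proof -
    have P: "primeideal P R" "homogeneous_ideal R G P"
      using that by (auto simp: height_one_homogeneous_primes_def)
    have id: "ideal P R" using P(1) by (rule primeideal.axioms)
    have "\<zero> \<in> P" using additive_subgroup.zero_closed[OF ideal.axioms(1)[OF id]] .
    then have "{k. \<exists>s\<in>S. comp s k \<notin> P} \<in> Pow ?D" by auto
    then show ?thesis
      using quotient_degrees[OF id] degrees_of_generators[OF P gen F S(1)] by auto
  qed
  ultimately show ?thesis by (meson finite_subset image_subsetI)
qed

section \<open>Rigidity of Veronese subrings\<close>

theorem NR_gcd:
  assumes N: "noetherian_in (carrier R)" and normal: "normal_domain R" and char0: "char_zero R"
    and d: "d \<in> NR R G"
    and m: "\<And>P. P \<in> height_one_homogeneous_primes R G \<Longrightarrow> e_grading (R Quot P) (quotient_grading R G P) dvd m"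
  shows "gcd d m \<in> NR R G"
proof -
  have d0: "d > 0" using d by (simp add: NR_def)
  obtain n where n: "d = Suc n" using d0 by (cases d) auto
  obtain D x where D: "derivation (R\<lparr>carrier := veronese R G (Suc n)\<rparr>) D"
    "locally_nilpotent (R\<lparr>carrier := veronese R G (Suc n)\<rparr>) D" "x \<in> veronese R G (Suc n)" "D x \<noteq> \<zero>"
    using d by (auto simp: NR_def rigid_def n)
  interpret D: subring_derivation R "veronese R G (Suc n)" D
    by (intro subring_derivation.intro domain_axioms subring_derivation_axioms.intro D(1) veronese_subring)
  have "\<exists>c\<in>carrier R. D (b [^] Suc n) = b [^] n \<otimes> c" if i: "int (gcd d m) dvd i" and b: "b \<in> G i" for i b
  proof (cases "b = \<zero>")
    case True
    then show ?thesis by (intro bexI[of _ \<zero>]) auto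
  next
    case False
    have bc: "b \<in> carrier R" using b by auto
    have pm: "y [^] Suc n \<in> veronese R G (Suc n)" if "y \<in> G k" for y k
      unfolding veronese_span by (rule G_subset_span[OF _ G_power[OF that]]) simp
    have Db: "D (b [^] Suc n) \<in> carrier R" using D.D_carrier[OF pm[OF b]] .
    have bn: "b [^] n \<in> G (int n * i)" "b [^] n \<noteq> \<zero>" using G_power[OF b] pow_nonzero[OF bc False] .
    show ?thesis
    proof (rule homogeneous_divides[OF bn(1) Db])
      fix k
      show "\<exists>r\<in>carrier R. comp (D (b [^] Suc n)) k = b [^] n \<otimes> r"
      proof (rule ccontr)
        assume nd: "\<not> ?thesis"
        obtain P where P: "P \<in> height_one_homogeneous_primes R G"
          "conductor (b [^] n) (comp (D (b [^] Suc n)) k) \<subseteq> P"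
          by (rule non_divisible_height_one[OF N normal bn comp_G[OF Db] nd])
        then have prime: "primeideal P R" by (auto simp: height_one_homogeneous_primes_def)
        have id: "ideal P R" using prime by (rule primeideal.axioms)
        \<comment> \<open>As e(R/P) divides \<open>m\<close>, its gcd with \<open>d\<close> divides
          \<open>gcd d m\<close> and with it the degree of \<open>b\<close>.\<close>
        have "gcd d (e_grading (R Quot P) (quotient_grading R G P)) dvd gcd d m"
          using m[OF P(1)] by (intro gcd_greatest) (auto intro: dvd_trans[OF gcd_dvd2])
        then have "int (gcd d (nat (Gcd {k. \<exists>h\<in>G k. h \<notin> P}))) dvd int (gcd d m)"
          unfolding quotient_degrees[OF id] by (simp only: int_dvd_int_iff)
        then have "int (gcd d (nat (Gcd {k. \<exists>h\<in>G k. h \<notin> P}))) dvd i"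
          using i by (rule dvd_trans)
        then obtain j w where w: "w \<in> G j" "w \<notin> P" "int d dvd i + j"
          using degree_outside_prime[OF prime d0] by blast
        have wc: "w \<in> carrier R" using w by auto
        have bw: "b \<otimes> w \<in> veronese R G (Suc n)"
          unfolding veronese_span using w(3) by (intro G_subset_span[OF _ G_mult[OF b w(1)]]) (simp add: n)
        have cD: "D (b \<otimes> w) \<in> carrier R" "D (w [^] Suc n) \<in> carrier R"
          using D.D_carrier bw pm[OF w(1)] by auto
        have cp: "b [^] n \<in> carrier R" "w [^] n \<in> carrier R" "w [^] Suc n \<in> carrier R" "[(Suc n)] \<cdot> \<one> \<in> carrier R"
          using bc wc by auto
        \<comment> \<open>This is the right-hand side of
          \<open>root_derivation_linear_formula\<close>. Before divisibility by b^n is known,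
          \<open>Y\<close> stands in for w^d times the value of the extension at
          \<open>b\<close>.\<close>
        define Y where "Y = ([(Suc n)] \<cdot> \<one>) \<otimes> (w [^] n \<otimes> D (b \<otimes> w)) \<ominus> b \<otimes> D (w [^] Suc n)"
        have Yc: "Y \<in> carrier R" unfolding Y_def using cp cD bc by auto
        have "D (b [^] Suc n) \<otimes> w [^] Suc n \<oplus> b [^] Suc n \<otimes> D (w [^] Suc n) = D ((b \<otimes> w) [^] Suc n)"
          using D.D_mult[OF pm[OF b] pm[OF w(1)]] bc wc by (simp only: nat_pow_distrib)
        also have "\<dots> = ([(Suc n)] \<cdot> \<one>) \<otimes> (b [^] n \<otimes> w [^] n \<otimes> D (b \<otimes> w))"
        proof -
          have "D ((b \<otimes> w) [^] Suc n) = ([(Suc n)] \<cdot> \<one>) \<otimes> ((b \<otimes> w) [^] n \<otimes> D (b \<otimes> w))"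
            unfolding D.D_pow[OF bw] using bc wc cD by (intro add_pow_one_mult) auto
          then show ?thesis using bc wc by (simp only: nat_pow_distrib)
        qed
        finally have eq: "([(Suc n)] \<cdot> \<one>) \<otimes> (b [^] n \<otimes> w [^] n \<otimes> D (b \<otimes> w)) =
            D (b [^] Suc n) \<otimes> w [^] Suc n \<oplus> (b [^] n \<otimes> b) \<otimes> D (w [^] Suc n)" by simp
        have "b [^] n \<otimes> Y = ([(Suc n)] \<cdot> \<one>) \<otimes> (b [^] n \<otimes> w [^] n \<otimes> D (b \<otimes> w)) \<ominus> (b [^] n \<otimes> b) \<otimes> D (w [^] Suc n)"
          unfolding Y_def using cp cD bc by algebra
        also have "\<dots> = w [^] Suc n \<otimes> D (b [^] Suc n)" unfolding eq using cp cD bc Db by algebra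
        finally have div: "w [^] Suc n \<otimes> D (b [^] Suc n) = b [^] n \<otimes> Y" by simp
        \<comment> \<open>Multiplication by w^d shifts degrees by d j; comparing components turns
          \<open>div\<close> into the denominator w^d for the single component of degree
          \<open>k\<close>.\<close>
        let ?k = "k + int (Suc n) * j"
        have "w [^] Suc n \<otimes> comp (D (b [^] Suc n)) k = comp (w [^] Suc n \<otimes> D (b [^] Suc n)) ?k"
          using comp_mult_homogeneous[OF G_power[OF w(1), of "Suc n"] Db, of ?k] by simp
        also have "\<dots> = b [^] n \<otimes> comp Y (?k - int n * i)"
          unfolding div by (rule comp_mult_homogeneous[OF bn(1) Yc])
        finally have "w [^] Suc n \<in> conductor (b [^] n) (comp (D (b [^] Suc n)) k)"
          using cp(3) comp_carrier[OF Yc] by (intro conductorI)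
        then show False using P(2) primeideal_pow_notin[OF prime wc w(2)] by blast
      qed
    qed
  qed
  then have "\<not> rigid (R\<lparr>carrier := veronese R G (gcd d m)\<rparr>)"
    by (intro nonrigid_extension[OF char0 D(1,2) _ _ D(3,4)]) (auto simp: n)
  then show ?thesis using d0 by (simp add: NR_def)
qed

end

section \<open>From the Veronese criteria to the three statements about M(B)\<close>

lemma nat_Gcd_eq_0D:
  fixes T :: "int set"
  assumes "nat (Gcd T) = 0"
  shows "T \<subseteq> {0}"
proof -
  have "Gcd T = 0" using assms Gcd_int_greater_eq_0[of T] by linarith
  then show ?thesis by (simp add: Gcd_0_iff)
qed

lemma maximal_NR_one: "1 \<in> NR B G \<Longrightarrow> maximal_NR B G = {1}"
  by (auto simp: maximal_NR_def NR_le_def)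

theorem proposition7p21:
  fixes K :: "('a, 'm) ring_scheme"
    and B :: "('a, 'b, 'n) module_scheme"
    and G :: "int \<Rightarrow> 'b set"
  assumes "field K" and "char_zero K"
    and "affine_domain K B" and "normal_domain B"
    and "grading B G"
  shows "(finite (maximal_NR B G) \<and> primitive_set (maximal_NR B G) \<and>
            maximal_NR B G \<subseteq> {d. d dvd e_bar B G}) \<and>
         (e_grading B G = 0 \<longrightarrow> maximal_NR B G = {} \<or> maximal_NR B G = {1}) \<and>
         (e_grading B G \<noteq> 0 \<and> e_bar B G = 0 \<longrightarrow> maximal_NR B G = {1})"
proof -
  interpret K: field K by fact
  have "domain B" and fg: "finitely_generated_algebra K B" using assms(3) by (auto simp: affine_domain_def)
  then have "algebra K B" by (auto simp: finitely_generated_algebra_def)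
  interpret B: graded_domain B G
    using \<open>domain B\<close> assms(5) by (intro graded_domain.intro graded_domain_axioms.intro)
  interpret A: algebra K B by fact
  define F where "F = (\<lambda>c. c \<odot>\<^bsub>B\<^esub> \<one>\<^bsub>B\<^esub>) ` carrier K"
  obtain S where S: "finite S" "S \<subseteq> carrier B" "generate_ring B (F \<union> S) = carrier B"
    using fg by (auto simp: finitely_generated_algebra_def F_def)
  have Fc: "F \<subseteq> carrier B" by (auto simp: F_def)
  have Fmult: "(c \<odot>\<^bsub>B\<^esub> \<one>\<^bsub>B\<^esub>) \<otimes>\<^bsub>B\<^esub> (c' \<odot>\<^bsub>B\<^esub> \<one>\<^bsub>B\<^esub>) = (c \<otimes>\<^bsub>K\<^esub> c') \<odot>\<^bsub>B\<^esub> \<one>\<^bsub>B\<^esub>"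
    if "c \<in> carrier K" "c' \<in> carrier K" for c c'
    using that by (simp add: A.smult_assoc2 A.smult_assoc1)
  have Finv: "\<exists>b\<in>F. b \<otimes>\<^bsub>B\<^esub> a = \<one>\<^bsub>B\<^esub>" if a: "a \<in> F" "a \<noteq> \<zero>\<^bsub>B\<^esub>" for a
  proof -
    obtain c where c: "c \<in> carrier K" "a = c \<odot>\<^bsub>B\<^esub> \<one>\<^bsub>B\<^esub>" using a by (auto simp: F_def)
    then have "c \<noteq> \<zero>\<^bsub>K\<^esub>" using a(2) A.smult_l_null by auto
    then have "c \<in> Units K" using c K.field_Units by auto
    then have "inv\<^bsub>K\<^esub> c \<in> carrier K" "inv\<^bsub>K\<^esub> c \<otimes>\<^bsub>K\<^esub> c = \<one>\<^bsub>K\<^esub>" by auto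
    then have "((inv\<^bsub>K\<^esub> c) \<odot>\<^bsub>B\<^esub> \<one>\<^bsub>B\<^esub>) \<otimes>\<^bsub>B\<^esub> a = \<one>\<^bsub>B\<^esub>" using c Fmult by simp
    then show ?thesis using \<open>inv\<^bsub>K\<^esub> c \<in> carrier K\<close> by (auto simp: F_def)
  qed
  have Fsub: "subring F B"
  proof (rule B.subringI)
    show "\<one>\<^bsub>B\<^esub> \<in> F" unfolding F_def using A.smult_one[of "\<one>\<^bsub>B\<^esub>"] by force
    show "\<ominus>\<^bsub>B\<^esub> h \<in> F" if "h \<in> F" for h
    proof -
      obtain c where c: "c \<in> carrier K" "h = c \<odot>\<^bsub>B\<^esub> \<one>\<^bsub>B\<^esub>" using \<open>h \<in> F\<close> by (auto simp: F_def)
      then have "\<ominus>\<^bsub>B\<^esub> h = (\<ominus>\<^bsub>K\<^esub> c) \<odot>\<^bsub>B\<^esub> \<one>\<^bsub>B\<^esub>" by (simp add: A.smult_l_minus)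
      then show ?thesis using c by (auto simp: F_def)
    qed
    show "g \<otimes>\<^bsub>B\<^esub> h \<in> F" if "g \<in> F" "h \<in> F" for g h
      using that Fmult unfolding F_def by auto
    show "g \<oplus>\<^bsub>B\<^esub> h \<in> F" if "g \<in> F" "h \<in> F" for g h
      using that unfolding F_def by (auto simp flip: A.smult_l_distr)
  qed (rule Fc)
  \<comment> \<open>Scalars end up in degree 0 because they form a field, although
    \<open>grading\<close> says nothing about them.\<close>
  have F0: "F \<subseteq> G 0"
    using B.subfield_degree_zero[OF Fc _ Finv] subringE(3,7)[OF Fsub] by blast
  have N: "B.noetherian_in (carrier B)"
  proof -
    obtain A' where A': "subring A' B" "B.noetherian_in A'" "F \<union> S \<subseteq> A'"
      using B.noetherian_generated[OF S(1,2) Fsub B.noetherian_subfield[OF Finv Fc]] by blast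
    have "generate_ring B (F \<union> S) \<subseteq> A'"
      using A' Fc S(2) by (intro B.generate_ring_min_subring1) auto
    then have "A' = carrier B" using S(3) subringE(1)[OF A'(1)] by auto
    then show ?thesis using A'(2) by simp
  qed
  have char0: "char_zero B"
    unfolding char_zero_def
  proof (intro allI impI notI)
    fix n :: nat assume n: "n > 0" "[n] \<cdot>\<^bsub>B\<^esub> \<one>\<^bsub>B\<^esub> = \<zero>\<^bsub>B\<^esub>"
    have eq: "([m] \<cdot>\<^bsub>K\<^esub> \<one>\<^bsub>K\<^esub>) \<odot>\<^bsub>B\<^esub> \<one>\<^bsub>B\<^esub> = [m] \<cdot>\<^bsub>B\<^esub> \<one>\<^bsub>B\<^esub>" for m :: nat
      by (induction m) (auto simp: A.smult_l_distr A.smult_l_null)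
    let ?c = "[n] \<cdot>\<^bsub>K\<^esub> \<one>\<^bsub>K\<^esub>"
    have c: "?c \<in> Units K" using assms(2) n K.field_Units by (auto simp: char_zero_def)
    then have "\<one>\<^bsub>B\<^esub> = (inv\<^bsub>K\<^esub> ?c \<otimes>\<^bsub>K\<^esub> ?c) \<odot>\<^bsub>B\<^esub> \<one>\<^bsub>B\<^esub>" by simp
    also have "\<dots> = inv\<^bsub>K\<^esub> ?c \<odot>\<^bsub>B\<^esub> (?c \<odot>\<^bsub>B\<^esub> \<one>\<^bsub>B\<^esub>)" using c by (intro A.smult_assoc1) auto
    also have "\<dots> = \<zero>\<^bsub>B\<^esub>" using eq[of n] n(2) c by (simp add: A.smult_r_null)
    finally show False using B.one_not_zero by simp
  qed
  let ?e = "\<lambda>P. e_grading (B Quot P) (quotient_grading B G P)"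
  let ?Z = "height_one_homogeneous_primes B G"
  have fin: "finite (?e ` ?Z)" using B.finite_quotient_degrees[OF S(3) F0 S(2,1)] .
  have prim: "primitive_set (maximal_NR B G)"
    by (auto simp: primitive_set_def maximal_NR_def NR_def NR_le_def)
  \<comment> \<open>When there are no such primes this is vacuous, and \<open>NR_gcd\<close> applies
    to any modulus, in particular to \<open>e_grading B G\<close>.\<close>
  have dvd: "?e P dvd e_bar B G" if "P \<in> ?Z" for P
    using that by (auto simp: e_bar_def intro!: dvd_Lcm)
  have max_dvd: "maximal_NR B G \<subseteq> {d. d dvd e_bar B G}"
  proof
    fix d assume d: "d \<in> maximal_NR B G"
    then have "gcd d (e_bar B G) \<in> NR B G"
      using B.NR_gcd[OF N assms(4) char0 _ dvd] by (auto simp: maximal_NR_def)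
    \<comment> \<open>The gcd divides \<open>d\<close>, so it lies above \<open>d\<close> in the
      reversed order, and maximality makes them equal.\<close>
    then have "gcd d (e_bar B G) = d" using d by (auto simp: maximal_NR_def NR_le_def)
    then show "d \<in> {d. d dvd e_bar B G}" by (metis gcd_dvd2 mem_Collect_eq)
  qed
  have b: "maximal_NR B G = {} \<or> maximal_NR B G = {1}" if "e_grading B G = 0"
  proof -
    have deg: "n = 0" if "G n \<noteq> {\<zero>\<^bsub>B\<^esub>}" for n
    proof -
      have "{n. G n \<noteq> {\<zero>\<^bsub>B\<^esub>}} \<subseteq> {0}"
        using \<open>e_grading B G = 0\<close> unfolding e_grading_def by (rule nat_Gcd_eq_0D)
      then show ?thesis using that by blast
    qed
    \<comment> \<open>Concentration in degree 0 makes every Veronese subring the whole ring, so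
      membership in \<open>NR\<close> is the same for all positive \<open>d\<close>.\<close>
    have "veronese B G d = carrier B" for d
    proof -
      have "k = 0" if "b \<in> carrier B" "B.comp b k \<noteq> \<zero>\<^bsub>B\<^esub>" for b k
        using deg[of k] B.comp_G[OF that(1), of k] that(2) by blast
      then show ?thesis unfolding B.veronese_span B.span_def by force
    qed
    then have "1 \<in> NR B G" if "d \<in> NR B G" for d using that by (simp add: NR_def)
    then show ?thesis using maximal_NR_one[of B G] by (auto simp: maximal_NR_def)
  qed
  have c: "maximal_NR B G = {1}" if e0: "e_grading B G \<noteq> 0" "e_bar B G = 0"
  proof -
    \<comment> \<open>Without height-one homogeneous primes \<open>e_bar\<close> would be
      \<open>e_grading\<close>, which is nonzero here.\<close>
    have Z: "?Z \<noteq> {}" using e0 by (auto simp: e_bar_def)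
    then have "Lcm (?e ` ?Z) = 0" using e0(2) by (simp add: e_bar_def)
    \<comment> \<open>The least common multiple of a finite set vanishes only if a member does;
      \<open>fin\<close> rules out the value 0 that an infinite set would give.\<close>
    then have "0 \<in> ?e ` ?Z" using Lcm_0_iff[OF fin] by simp
    then obtain P where P: "P \<in> ?Z" "?e P = 0" by auto
    have id: "ideal P B" using P(1) by (auto simp: height_one_homogeneous_primes_def primeideal.axioms)
    have "{k. \<exists>h\<in>G k. h \<notin> P} \<subseteq> {0}"
      using P(2) unfolding B.quotient_degrees[OF id] by (rule nat_Gcd_eq_0D)
    then have P0: "h \<in> P" if "h \<in> G k" "k \<noteq> 0" for h k using that by blast
    have "\<exists>i. i \<noteq> 0 \<and> G i \<noteq> {\<zero>\<^bsub>B\<^esub>}"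
    proof (rule ccontr)
      assume "\<not> ?thesis"
      then have "{n. G n \<noteq> {\<zero>\<^bsub>B\<^esub>}} \<subseteq> {0}" by blast
      then have "Gcd {n. G n \<noteq> {\<zero>\<^bsub>B\<^esub>}} = 0" by (simp only: Gcd_0_iff)
      then show False using e0(1) by (simp only: e_grading_def)
    qed
    then obtain i x where "i \<noteq> 0" "x \<in> G i" "x \<noteq> \<zero>\<^bsub>B\<^esub>" using B.G_zero by blast
    then have "1 \<in> NR B G"
      using B.nonrigid_of_degree_zero_quotient[OF N assms(4) char0 P(1) P0] by (simp add: NR_def)
    then show ?thesis by (rule maximal_NR_one)
  qed
  have "finite (maximal_NR B G)"
  proof (cases "e_bar B G = 0")
    case True
    then have "maximal_NR B G = {} \<or> maximal_NR B G = {1}" using b c by blast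
    then show ?thesis by (elim disjE) (simp_all only: finite.intros)
  next
    case False
    then have "finite {d. d dvd e_bar B G}" by simp
    then show ?thesis using max_dvd by (rule rev_finite_subset)
  qed
  then show ?thesis using prim max_dvd b c by blast
qed

end
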